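(* Let $A$ be a unital dg algebra over a field $\Bbbk$, and let $C(A)$ be the unital dg algebra $\mathrm{Cobar}_+(\mathrm{Bar}(A_+))$ with differential $d_{\mathrm{Bar}}+d_{\mathrm{Cobar}}+d_\xi$ defined in the context. Then there is a map of unital dg algebras $p\colon C(A)\to A$ which is a quasi-isomorphism.
   Context: Let $1_A$ be the unit of $A$. Let $A_+=A\oplus\Bbbk\xi$ as a complex, with $\deg\xi=-1$ and $d\xi=0$, with the product of $A$ extended so that the product of $\xi$ with any element of $A$ on either side, and $\xi\cdot\xi$, are $0$; $A_+$ is regarded as a non-unital dg algebra. Bar. $\mathrm{Bar}(A_+)=\bigoplus_{n\ge1}(A_+[1])^{\otimes n}$ with the deconcatenation coproduct (without counit) $\Delta[x_1|\dots|x_n]=\sum_{0<i<n}[x_1|\dots|x_i]\otimes[x_{i+1}|\dots|x_n]$, where $[x_1|\dots|x_n]=sx_1\otimes\dots\otimes sx_n$ and $|sx|=|x|-1$. The bar differential $b$ is the coderivation with components $b_1(sx)=-s(dx)$ and $b_2(sx\otimes sy)=(-1)^{|x|}s(xy)$. Cobar. For a dg coalgebra $B$ (without counit), $\mathrm{Cobar}_+(B)=\Bbbk\oplus\bigoplus_{n\ge1}(B[-1])^{\otimes n}$ is the free unital algebra on $B[-1]$, with unit $1_\Bbbk$ and product denoted $\boxtimes$; $s^{-1}c$ denotes the generator corresponding to $c\in B$, $|s^{-1}c|=|c|+1$. On $\mathrm{Cobar}_+(\mathrm{Bar}(A_+))$ let $d_{\mathrm{Bar}}$ and $d_{\mathrm{Cobar}}$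 be the degree $+1$ derivations given on generators by $d_{\mathrm{Bar}}(s^{-1}c)=-s^{-1}b(c)$ and $d_{\mathrm{Cobar}}(s^{-1}c)=-\sum(-1)^{|c'|}s^{-1}c'\boxtimes s^{-1}c''$, where $\Delta c=\sum c'\otimes c''$. An element $x\in A_+$ is identified with the generator $s^{-1}[x]$. The derivation $d_\xi$. It is the degree $+1$ derivation given on generators by $d_\xi(\xi)=1_\Bbbk-1_A$, $d_\xi|_A=0$, and, for $n\ge2$, $$d_\xi\bigl(s^{-1}[x_1|\dots|x_n]\bigr)=-\sum_{i:\ x_i=\xi}(-1)^{\sum_{j<i}|sx_j|}\,s^{-1}[x_1|\dots|x_{i-1}|1_A|x_{i+1}|\dots|x_n],$$ where each $x_j$ is either $\xi$ or a homogeneous element of $A$. The total differential $d_{\mathrm{Bar}}+d_{\mathrm{Cobar}}+d_\xi$ squares to zero. *)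

theory Defs
  imports Complex_Main "HOL-Library.Function_Algebras" "HOL-Library.Product_Plus"
begin

section \<open>Graded vector spaces, complexes, dg algebras\<close>

text \<open>
  A graded vector space is a family of linearly independent subspaces \<open>homog V n\<close> of an ambient
  vector space; its underlying vector space \<open>underlying V\<close> is their (internal direct) sum, which need not
  exhaust the ambient type. Differentials have degree \<open>+1\<close>.
\<close>

record ('k, 'v) gvs =
  scale :: "'k \<Rightarrow> 'v \<Rightarrow> 'v"
  homog :: "int \<Rightarrow> 'v set"

record ('k, 'v) dgvs = "('k, 'v) gvs" +
  diff :: "'v \<Rightarrow> 'v"

record ('k, 'v) nudga = "('k, 'v) dgvs" +
  mult :: "'v \<Rightarrow> 'v \<Rightarrow> 'v"

record ('k, 'v) dga = "('k, 'v) nudga" +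
  unit :: "'v"

definition underlying :: "('k::field, 'v::ab_group_add, 'm) gvs_scheme \<Rightarrow> 'v set" where
  "underlying V = module.span (scale V) (\<Union>n. homog V n)"

definition linear_map ::
  "('k::field, 'v::ab_group_add, 'm) gvs_scheme \<Rightarrow> ('k, 'w::ab_group_add, 'n) gvs_scheme \<Rightarrow> ('v \<Rightarrow> 'w) \<Rightarrow> bool"
  where
  "linear_map V W f \<longleftrightarrow>
     (\<forall>x\<in>underlying V. f x \<in> underlying W) \<and>
     (\<forall>x\<in>underlying V. \<forall>y\<in>underlying V. f (x + y) = f x + f y) \<and>
     (\<forall>c. \<forall>x\<in>underlying V. f (scale V c x) = scale W c (f x))"

definition linear_map_of_degree ::
  "int \<Rightarrow> ('k::field, 'v::ab_group_add, 'm) gvs_scheme \<Rightarrow> ('k, 'w::ab_group_add, 'n) gvs_scheme \<Rightarrow> ('v \<Rightarrow> 'w) \<Rightarrow> bool"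
  where
  "linear_map_of_degree r V W f \<longleftrightarrow>
     linear_map V W f \<and> (\<forall>m. \<forall>x\<in>homog V m. f x \<in> homog W (m + r))"

definition derivation ::
  "('k::field, 'v::ab_group_add, 'm) gvs_scheme \<Rightarrow> ('v \<Rightarrow> 'v \<Rightarrow> 'v) \<Rightarrow> ('v \<Rightarrow> 'v) \<Rightarrow> bool" where
  "derivation V mul D \<longleftrightarrow>
     linear_map_of_degree 1 V V D \<and>
     (\<forall>m. \<forall>x\<in>homog V m. \<forall>y\<in>underlying V.
        D (mul x y) = mul (D x) y + scale V ((-1) powi m) (mul x (D y)))"

locale graded_space = vector_space "scale V"
  for V :: "('k::field, 'v::ab_group_add, 'm) gvs_scheme" +
  assumes subspace_homog: "subspace (homog V n)"
    and independent_homog: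
      "\<lbrakk>finite S; \<And>n. n \<in> S \<Longrightarrow> f n \<in> homog V n; (\<Sum>n\<in>S. f n) = 0; n \<in> S\<rbrakk> \<Longrightarrow> f n = 0"

locale dg_space = graded_space V
  for V :: "('k::field, 'v::ab_group_add, 'm) dgvs_scheme" +
  assumes diff_degree: "linear_map_of_degree 1 V V (diff V)"
    and diff_diff: "x \<in> underlying V \<Longrightarrow> diff V (diff V x) = 0"

locale nonunital_dg_algebra = dg_space A
  for A :: "('k::field, 'v::ab_group_add, 'm) nudga_scheme" +
  assumes mult_degree: "\<lbrakk>x \<in> homog A m; y \<in> homog A n\<rbrakk> \<Longrightarrow> mult A x y \<in> homog A (m + n)"
    and mult_linear_left: "y \<in> underlying A \<Longrightarrow> linear_map A A (\<lambda>x. mult A x y)"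
    and mult_linear_right: "x \<in> underlying A \<Longrightarrow> linear_map A A (\<lambda>y. mult A x y)"
    and mult_assoc:
      "\<lbrakk>x \<in> underlying A; y \<in> underlying A; z \<in> underlying A\<rbrakk> \<Longrightarrow> mult A (mult A x y) z = mult A x (mult A y z)"
    and diff_derivation: "derivation A (mult A) (diff A)"

locale dg_algebra = nonunital_dg_algebra A
  for A :: "('k::field, 'v::ab_group_add, 'm) dga_scheme" +
  assumes unit_degree: "unit A \<in> homog A 0"
    and mult_unit_left: "x \<in> underlying A \<Longrightarrow> mult A (unit A) x = x"
    and mult_unit_right: "x \<in> underlying A \<Longrightarrow> mult A x (unit A) = x"

locale dg_algebra_hom = source: dg_algebra A + target: dg_algebra B
  for A :: "('k::field, 'v::ab_group_add, 'm) dga_scheme"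
    and B :: "('k, 'w::ab_group_add, 'n) dga_scheme"
    and f :: "'v \<Rightarrow> 'w" +
  assumes hom_degree: "linear_map_of_degree 0 A B f"
    and hom_diff: "x \<in> underlying A \<Longrightarrow> f (diff A x) = diff B (f x)"
    and hom_mult: "\<lbrakk>x \<in> underlying A; y \<in> underlying A\<rbrakk> \<Longrightarrow> f (mult A x y) = mult B (f x) (f y)"
    and hom_unit: "f (unit A) = unit B"


section \<open>Cohomology\<close>

definition cocycles :: "('k::field, 'v::ab_group_add, 'm) dgvs_scheme \<Rightarrow> int \<Rightarrow> 'v set" where
  "cocycles V n = {x \<in> homog V n. diff V x = 0}"

definition cohomologous :: "('k::field, 'v::ab_group_add, 'm) dgvs_scheme \<Rightarrow> int \<Rightarrow> 'v rel" where
  "cohomologous V n =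
     {(x, y). x \<in> cocycles V n \<and> y \<in> cocycles V n \<and> x - y \<in> diff V ` homog V (n - 1)}"

definition cohomology :: "('k::field, 'v::ab_group_add, 'm) dgvs_scheme \<Rightarrow> int \<Rightarrow> 'v set set" where
  "cohomology V n = cocycles V n // cohomologous V n"

definition cohomology_map ::
  "('k::field, 'w::ab_group_add, 'n) dgvs_scheme \<Rightarrow> int \<Rightarrow> ('v \<Rightarrow> 'w) \<Rightarrow> 'v set \<Rightarrow> 'w set" where
  "cohomology_map W n f X = cohomologous W n `` (f ` X)"

definition quasi_isomorphism ::
  "('k::field, 'v::ab_group_add, 'm) dgvs_scheme \<Rightarrow> ('k, 'w::ab_group_add, 'n) dgvs_scheme \<Rightarrow> ('v \<Rightarrow> 'w) \<Rightarrow> bool"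
  where
  "quasi_isomorphism V W f \<longleftrightarrow>
     (\<forall>n. bij_betw (cohomology_map W n f) (cohomology V n) (cohomology W n))"


section \<open>The tensor algebra of a graded vector space\<close>

text \<open>
  The direct sum \<open>\<Oplus>\<^sub>n V\<^sup>\<otimes>\<^sup>n\<close> is realised inside the linear dual of the space of multilinear forms on
  \<open>V\<close>: the tensor \<open>x\<^sub>1 \<otimes> \<dots> \<otimes> x\<^sub>n\<close> is evaluation of forms at \<open>[x\<^sub>1, \<dots>, x\<^sub>n]\<close>. As \<open>k\<close> is a field,
  this is a model of the tensor algebra; see \<open>tensor_universal\<close> below. A form is a function on
  lists, i.e. a family consisting of one \<open>n\<close>-linear form for each \<open>n\<close>.
\<close>

type_synonym ('k, 'v) tens = "('v list \<Rightarrow> 'k) \<Rightarrow> 'k"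

definition multilinear ::
  "('k::field, 'v::ab_group_add, 'm) gvs_scheme \<Rightarrow> ('k \<Rightarrow> 'w::ab_group_add \<Rightarrow> 'w) \<Rightarrow> ('v list \<Rightarrow> 'w) \<Rightarrow> bool" where
  "multilinear V s f \<longleftrightarrow>
     (\<forall>us ws. set us \<subseteq> underlying V \<longrightarrow> set ws \<subseteq> underlying V \<longrightarrow>
        (\<forall>x\<in>underlying V. \<forall>y\<in>underlying V. f (us @ (x + y) # ws) = f (us @ x # ws) + f (us @ y # ws)) \<and>
        (\<forall>c. \<forall>x\<in>underlying V. f (us @ scale V c x # ws) = s c (f (us @ x # ws))))"

abbreviation multilinear_form :: "('k::field, 'v::ab_group_add, 'm) gvs_scheme \<Rightarrow> ('v list \<Rightarrow> 'k) \<Rightarrow> bool" where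
  "multilinear_form V \<equiv> multilinear V (*)"

definition tscale :: "'k::field \<Rightarrow> ('k, 'v) tens \<Rightarrow> ('k, 'v) tens" where
  "tscale c F = (\<lambda>\<phi>. c * F \<phi>)"

definition pure :: "('k::field, 'v::ab_group_add, 'm) gvs_scheme \<Rightarrow> 'v list \<Rightarrow> ('k, 'v) tens" where
  "pure V xs = (\<lambda>\<phi>. if multilinear_form V \<phi> then \<phi> xs else 0)"

text \<open>Words whose letters are homogeneous of the listed degrees:\<close>

definition homog_word :: "('k, 'v, 'm) gvs_scheme \<Rightarrow> 'v list \<Rightarrow> int list \<Rightarrow> bool" where
  "homog_word V xs ns \<longleftrightarrow> list_all2 (\<lambda>x n. x \<in> homog V n) xs ns"

definition tensor_algebra ::
  "('k::field, 'v::ab_group_add, 'm) gvs_scheme \<Rightarrow> ('k, ('k, 'v) tens) gvs" where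
  "tensor_algebra V = \<lparr>scale = tscale,
     homog = (\<lambda>m. module.span tscale {pure V xs |xs ns. homog_word V xs ns \<and> sum_list ns = m})\<rparr>"

definition reduced_tensors ::
  "('k::field, 'v::ab_group_add, 'm) gvs_scheme \<Rightarrow> ('k, ('k, 'v) tens) gvs" where
  "reduced_tensors V = \<lparr>scale = tscale,
     homog = (\<lambda>m. module.span tscale {pure V xs |xs ns. xs \<noteq> [] \<and> homog_word V xs ns \<and> sum_list ns = m})\<rparr>"

text \<open>
  Linear maps out of tensors are given by their transposes on forms; the resulting values on pure
  tensors are given by \<open>tmult_pure\<close>, \<open>tpart_pure\<close> and \<open>deconcatenation_pure\<close>.
\<close>

definition tmult ::
  "('k::field, 'v::ab_group_add, 'm) gvs_scheme \<Rightarrow> ('k, 'v) tens \<Rightarrow> ('k, 'v) tens \<Rightarrow> ('k, 'v) tens" where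
  "tmult V F G = (\<lambda>\<phi>. if multilinear_form V \<phi> then F (\<lambda>xs. G (\<lambda>ys. \<phi> (xs @ ys))) else 0)"

definition tpart ::
  "('k::field, 'v::ab_group_add, 'm) gvs_scheme \<Rightarrow> nat \<Rightarrow> ('k, 'v) tens \<Rightarrow> ('k, 'v) tens" where
  "tpart V n F =
     (\<lambda>\<phi>. if multilinear_form V \<phi> then F (\<lambda>xs. if length xs = n then \<phi> xs else 0) else 0)"

lemma vector_space_tscale: "vector_space (tscale :: 'k::field \<Rightarrow> ('k, 'v) tens \<Rightarrow> _)"
  by unfold_locales (auto simp: tscale_def fun_eq_iff algebra_simps)

interpretation tens: vector_space "tscale :: 'k::field \<Rightarrow> ('k, 'v) tens \<Rightarrow> ('k, 'v) tens"
  by (rule vector_space_tscale)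

lemma multilinear_pure: "multilinear V tscale (pure V)"
  unfolding multilinear_def pure_def tscale_def by (auto simp: fun_eq_iff)

lemma multilinearD:
  assumes "multilinear V s f" "set us \<subseteq> underlying V" "set ws \<subseteq> underlying V"
  shows "x \<in> underlying V \<Longrightarrow> y \<in> underlying V \<Longrightarrow> f (us @ (x + y) # ws) = f (us @ x # ws) + f (us @ y # ws)"
    and "x \<in> underlying V \<Longrightarrow> f (us @ scale V c x # ws) = s c (f (us @ x # ws))"
  using assms unfolding multilinear_def by blast+

lemma tpart_pure: "tpart V n (pure V xs) = (if length xs = n then pure V xs else 0)"
proof -
  have "multilinear_form V (\<lambda>xs. if length xs = n then \<phi> xs else 0)" if "multilinear_form V \<phi>" for \<phi>
    using that unfolding multilinear_def by auto
  then show ?thesis by (auto simp: tpart_def pure_def fun_eq_iff)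
qed

lemma multilinear_cong:
  fixes V :: "('k::field, 'v::ab_group_add, 'm) gvs_scheme"
  assumes "vector_space (scale V)" "multilinear V s f"
    and "\<And>xs. set xs \<subseteq> underlying V \<Longrightarrow> g xs = f xs"
  shows "multilinear V s g"
proof -
  interpret V: vector_space "scale V" by fact
  have [simp]: "x + y \<in> underlying V" "scale V c x \<in> underlying V"
    if "x \<in> underlying V" "y \<in> underlying V" for x y c
    using that by (simp_all add: underlying_def V.span_add V.span_scale)
  show ?thesis
    using assms(2) unfolding multilinear_def by (simp add: assms(3))
qed

lemma multilinear_append:
  assumes "multilinear V s f" "set us \<subseteq> underlying V"
  shows "multilinear V s (\<lambda>ys. f (us @ ys))" "multilinear V s (\<lambda>ys. f (ys @ us))"
proof -
  note D = multilinearD[OF assms(1)]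
  show "multilinear V s (\<lambda>ys. f (us @ ys))"
    unfolding multilinear_def using D[of "us @ vs" ws for vs ws] assms(2) by simp
  show "multilinear V s (\<lambda>ys. f (ys @ us))"
    unfolding multilinear_def using D[of vs "ws @ us" for vs ws] assms(2) by simp
qed

lemma tmult_pure:
  fixes V :: "('k::field, 'v::ab_group_add, 'm) gvs_scheme"
  assumes "vector_space (scale V)" "set xs \<subseteq> underlying V" "set ys \<subseteq> underlying V"
  shows "tmult V (pure V xs) (pure V ys) = pure V (xs @ ys)"
proof
  fix \<phi>
  show "tmult V (pure V xs) (pure V ys) \<phi> = pure V (xs @ ys) \<phi>"
  proof (cases "multilinear_form V \<phi>")
    case True
    have "pure V ys (\<lambda>ys. \<phi> (us @ ys)) = \<phi> (us @ ys)" if "set us \<subseteq> underlying V" for us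
      using multilinear_append(1)[OF True that] by (simp add: pure_def)
    moreover from this have "multilinear_form V (\<lambda>xs. pure V ys (\<lambda>ys. \<phi> (xs @ ys)))"
      by (intro multilinear_cong[OF assms(1) multilinear_append(2)[OF True assms(3)]])
    ultimately show ?thesis using True assms(2) by (simp add: tmult_def pure_def)
  qed (simp add: tmult_def pure_def)
qed

lemma pure_in_span:
  fixes V :: "('k::field, 'v::ab_group_add, 'm) gvs_scheme"
  assumes "vector_space (scale V)" "set xs \<subseteq> underlying V"
  shows "pure V xs \<in> module.span tscale {pure V ys |ys ns. length ys = length xs \<and> homog_word V ys ns}"
proof -
  interpret V: vector_space "scale V" by fact
  define T where "T = tens.span {pure V ys |ys ns. length ys = length xs \<and> homog_word V ys ns}"
  have "pure V (us @ ws) \<in> T" if "homog_word V us ns" "set ws \<subseteq> underlying V" "length us + length ws = length xs" for us ws ns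
    using that
  proof (induction ws arbitrary: us ns)
    case Nil
    then show ?case unfolding T_def by (intro tens.span_base) auto
  next
    case (Cons w ws)
    have us: "set us \<subseteq> underlying V"
    proof
      fix u assume "u \<in> set us"
      with Cons.prems(1) obtain n where "u \<in> homog V n"
        unfolding homog_word_def by (metis in_set_conv_nth list_all2_conv_all_nth)
      then show "u \<in> underlying V" unfolding underlying_def by (intro V.span_base) auto
    qed
    have sub: "w \<in> V.span (\<Union>n. homog V n)" using Cons.prems(2) by (simp add: underlying_def)
    have wsU: "set ws \<subseteq> underlying V" using Cons.prems(2) by simp
    note M = multilinearD[OF multilinear_pure us wsU]
    have [simp]: "0 \<in> underlying V" by (simp add: underlying_def V.span_zero)
    have "underlying V \<subseteq> {w \<in> underlying V. pure V (us @ w # ws) \<in> T}"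
      unfolding underlying_def[of V]
    proof (rule V.span_minimal)
      show "(\<Union>n. homog V n) \<subseteq> {w \<in> V.span (\<Union>n. homog V n). pure V (us @ w # ws) \<in> T}"
      proof safe
        fix w n assume w: "w \<in> homog V n"
        then show "w \<in> V.span (\<Union>n. homog V n)" by (auto intro: V.span_base)
        have "homog_word V (us @ [w]) (ns @ [n])"
          using Cons.prems(1) w by (simp add: homog_word_def list_all2_appendI)
        from Cons.IH[OF this wsU] Cons.prems(3) show "pure V (us @ w # ws) \<in> T" by simp
      qed
      have "pure V (us @ 0 # ws) = 0" using M(2)[of 0 0] by simp
      then show "V.subspace {w \<in> V.span (\<Union>n. homog V n). pure V (us @ w # ws) \<in> T}"
        using M unfolding V.subspace_def underlying_def T_def
        by (simp add: V.span_zero V.span_add V.span_scale tens.span_zero tens.span_add tens.span_scale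
            del: zero_fun_def)
    qed
    then show ?case using Cons.prems(2) by auto
  qed
  from this[of "[]" "[]" xs] assms show ?thesis by (simp add: T_def homog_word_def)
qed

theorem tensor_universal:
  fixes V :: "('k::field, 'v::ab_group_add, 'm) gvs_scheme"
    and s :: "'k \<Rightarrow> 'w::ab_group_add \<Rightarrow> 'w"
  assumes "vector_space s" "multilinear V s f"
  shows "\<exists>L. Vector_Spaces.linear tscale s L \<and> (\<forall>xs. set xs \<subseteq> underlying V \<longrightarrow> L (pure V xs) = f xs)"
proof -
  interpret W: vector_space s by fact
  interpret K: vector_space "(*) :: 'k \<Rightarrow> 'k \<Rightarrow> 'k"
    by unfold_locales (auto simp: algebra_simps)
  interpret P: vector_space_pair "tscale :: 'k \<Rightarrow> ('k, 'v) tens \<Rightarrow> _" s ..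
  interpret Q: vector_space_pair s "(*) :: 'k \<Rightarrow> 'k \<Rightarrow> 'k" ..
  interpret T: vector_space_pair "tscale :: 'k \<Rightarrow> ('k, 'v) tens \<Rightarrow> _" "(*) :: 'k \<Rightarrow> 'k \<Rightarrow> 'k" ..
  define S where "S = pure V ` {xs. set xs \<subseteq> underlying V}"
  obtain B where B: "B \<subseteq> S" "tens.independent B" "S \<subseteq> tens.span B"
    using tens.maximal_independent_subset[of S] by blast
  have "\<forall>b\<in>B. \<exists>xs. set xs \<subseteq> underlying V \<and> pure V xs = b"
    using B(1) unfolding S_def by blast
  then obtain r where r: "\<And>b. b \<in> B \<Longrightarrow> set (r b) \<subseteq> underlying V \<and> pure V (r b) = b" by metis
  define L where "L = P.construct B (\<lambda>b. f (r b))"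
  have L: "Vector_Spaces.linear tscale s L"
    unfolding L_def by (rule P.linear_construct[OF B(2)])
  have "L (pure V xs) = f xs" if xs: "set xs \<subseteq> underlying V" for xs
  proof (rule ccontr)
    define w where "w = L (pure V xs) - f xs"
    assume "L (pure V xs) \<noteq> f xs"
    then have ind: "W.independent {w}" by (simp add: w_def)
    define g where "g = Q.construct {w} (\<lambda>_. 1)"
    interpret g: Vector_Spaces.linear s "(*)" g
      unfolding g_def by (rule Q.linear_construct[OF ind])
    have gw: "g w = 1" unfolding g_def using Q.construct_basis[OF ind] by simp
    have gf: "multilinear_form V (\<lambda>xs. g (f xs))"
      using assms(2) unfolding multilinear_def by (simp add: g.add g.scale)
    interpret L: Vector_Spaces.linear tscale s L by (rule L)
    have "g (L F) = F (\<lambda>xs. g (f xs))" if "F \<in> tens.span B" for F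
    proof (rule T.linear_eq_on[where f = "\<lambda>F. g (L F)" and g = "\<lambda>F. F (\<lambda>xs. g (f xs))", OF _ _ that])
      show "Vector_Spaces.linear tscale (*) (\<lambda>F. g (L F))"
        by unfold_locales (simp_all add: L.add L.scale g.add g.scale)
      show "Vector_Spaces.linear tscale (*) (\<lambda>F. F (\<lambda>xs. g (f xs)))"
        by unfold_locales (simp_all add: tscale_def)
      fix b assume "b \<in> B"
      have "b (\<lambda>xs. g (f xs)) = pure V (r b) (\<lambda>xs. g (f xs))" using r[OF \<open>b \<in> B\<close>] by simp
      with \<open>b \<in> B\<close> show "g (L b) = b (\<lambda>xs. g (f xs))"
        using gf by (simp add: L_def P.construct_basis[OF B(2)] pure_def)
    qed
    from this[of "pure V xs"] have "g (L (pure V xs)) = g (f xs)"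
      using B(3) xs gf unfolding S_def by (auto simp: pure_def)
    with gw show False by (simp add: w_def g.diff)
  qed
  with L show ?thesis by blast
qed

lemma underlying_tensor_algebra:
  "underlying (tensor_algebra V) = module.span tscale {pure V xs |xs ns. homog_word V xs ns}"
proof -
  have "tens.span (\<Union>m. homog (tensor_algebra V) m) = tens.span {pure V xs |xs ns. homog_word V xs ns}" (is "_ = tens.span ?S")
  proof (rule tens.span_eq[THEN iffD2], intro conjI UN_least)
    show "homog (tensor_algebra V) m \<subseteq> tens.span ?S" for m
      unfolding tensor_algebra_def gvs.simps by (rule tens.span_mono) blast
    show "?S \<subseteq> tens.span (\<Union>m. homog (tensor_algebra V) m)"
      unfolding tensor_algebra_def gvs.simps by (auto intro!: tens.span_base)
  qed
  then show ?thesis by (simp add: underlying_def tensor_algebra_def)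
qed

lemma underlying_reduced_tensors:
  "underlying (reduced_tensors V) = module.span tscale {pure V xs |xs ns. xs \<noteq> [] \<and> homog_word V xs ns}"
proof -
  have "tens.span (\<Union>m. homog (reduced_tensors V) m) = tens.span {pure V xs |xs ns. xs \<noteq> [] \<and> homog_word V xs ns}" (is "_ = tens.span ?S")
  proof (rule tens.span_eq[THEN iffD2], intro conjI UN_least)
    show "homog (reduced_tensors V) m \<subseteq> tens.span ?S" for m
      unfolding reduced_tensors_def gvs.simps by (rule tens.span_mono) blast
    show "?S \<subseteq> tens.span (\<Union>m. homog (reduced_tensors V) m)"
      unfolding reduced_tensors_def gvs.simps by (auto intro!: tens.span_base)
  qed
  then show ?thesis by (simp add: underlying_def reduced_tensors_def)
qed

lemma pure_in_tensor_algebra: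
  assumes "vector_space (scale V)" "set xs \<subseteq> underlying V"
  shows "pure V xs \<in> underlying (tensor_algebra V)"
  using pure_in_span[OF assms] unfolding underlying_tensor_algebra
  by (rule tens.span_mono[THEN subsetD, rotated]) auto

lemma pure_in_reduced_tensors:
  assumes "vector_space (scale V)" "set xs \<subseteq> underlying V" "xs \<noteq> []"
  shows "pure V xs \<in> underlying (reduced_tensors V)"
  using pure_in_span[OF assms(1,2)] unfolding underlying_reduced_tensors
  by (rule tens.span_mono[THEN subsetD, rotated]) (use assms(3) in auto)



section \<open>Shifts\<close>

text \<open>
  The suspension \<open>s\<close> is the identity on underlying vector spaces, so \<open>sx\<close> is written \<open>x\<close>; only the
  degree changes: \<open>V[r]\<^sup>n = V\<^sup>n\<^sup>+\<^sup>r\<close>.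
\<close>

definition shift :: "int \<Rightarrow> ('k, 'v, 'm) gvs_scheme \<Rightarrow> ('k, 'v, 'm) gvs_scheme" where
  "shift r V = V\<lparr>homog := (\<lambda>n. homog V (n + r))\<rparr>"

lemma underlying_shift [simp]: "underlying (shift r V) = underlying V"
proof -
  have "(\<Union>n. homog V (n + r)) = (\<Union>n. homog V n)"
    by (auto, metis diff_add_cancel)
  then show ?thesis by (simp add: underlying_def shift_def)
qed


section \<open>Dg coalgebras without counit\<close>

text \<open>
  The coproduct \<open>B \<rightarrow> B \<otimes> B\<close> takes values in the tensors of length two over \<open>B\<close>, and
  \<open>sweedler B \<Delta> c ts\<close> says that \<open>ts\<close>, a list of triples \<open>(|c'|, c', c'')\<close>, represents
  \<open>\<Delta> c = \<Sum> c' \<otimes> c''\<close>.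
\<close>

record ('k, 'v) dgcoalg = "('k, 'v) dgvs" +
  comult :: "'v \<Rightarrow> ('k, 'v) tens"

definition sweedler ::
  "('k::field, 'v::ab_group_add, 'm) gvs_scheme \<Rightarrow> ('v \<Rightarrow> ('k, 'v) tens) \<Rightarrow> 'v \<Rightarrow> (int \<times> 'v \<times> 'v) list \<Rightarrow> bool"
  where
  "sweedler B \<Delta> c ts \<longleftrightarrow>
     (\<forall>(m, c', c'') \<in> set ts. c' \<in> homog B m \<and> c'' \<in> underlying B) \<and>
     \<Delta> c = (\<Sum>(m, c', c'') \<leftarrow> ts. pure B [c', c''])"

text \<open>Degree \<open>+1\<close> coderivations, \<open>\<Delta> b = (b \<otimes> 1 + 1 \<otimes> b) \<Delta>\<close> with the Koszul sign rule:\<close>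

definition coderivation ::
  "('k::field, 'v::ab_group_add, 'm) gvs_scheme \<Rightarrow> ('v \<Rightarrow> ('k, 'v) tens) \<Rightarrow> ('v \<Rightarrow> 'v) \<Rightarrow> bool" where
  "coderivation B \<Delta> b \<longleftrightarrow>
     linear_map_of_degree 1 B B b \<and>
     (\<forall>c\<in>underlying B. \<forall>ts. sweedler B \<Delta> c ts \<longrightarrow>
        \<Delta> (b c) = (\<Sum>(m, c', c'') \<leftarrow> ts. pure B [b c', c''] + tscale ((-1) powi m) (pure B [c', b c''])))"


section \<open>The bar construction\<close>

abbreviation bar_word :: "('k::field, 'v::ab_group_add, 'm) nudga_scheme \<Rightarrow> 'v list \<Rightarrow> ('k, 'v) tens" where
  "bar_word R xs \<equiv> pure (shift 1 R) xs"

definition bar_space :: "('k::field, 'v::ab_group_add, 'm) nudga_scheme \<Rightarrow> ('k, ('k, 'v) tens) gvs" where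
  "bar_space R = reduced_tensors (shift 1 R)"

definition deconcatenation ::
  "('k::field, 'v::ab_group_add, 'm) nudga_scheme \<Rightarrow> ('k, 'v) tens \<Rightarrow> ('k, ('k, 'v) tens) tens" where
  "deconcatenation R F = (\<lambda>\<psi>. if multilinear_form (bar_space R) \<psi>
     then F (\<lambda>xs. \<Sum>i\<in>{0<..<length xs}. \<psi> [bar_word R (take i xs), bar_word R (drop i xs)]) else 0)"

lemma deconcatenation_pure:
  fixes R :: "('k::field, 'v::ab_group_add, 'm) nudga_scheme"
  assumes "vector_space (scale R)" "set xs \<subseteq> underlying R"
  shows "deconcatenation R (bar_word R xs) =
    (\<Sum>i\<in>{0<..<length xs}. pure (bar_space R) [bar_word R (take i xs), bar_word R (drop i xs)])"
proof
  fix \<psi> :: "('k, 'v) tens list \<Rightarrow> 'k"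
  let ?f = "\<lambda>xs. \<Sum>i\<in>{0<..<length xs}. \<psi> [bar_word R (take i xs), bar_word R (drop i xs)]"
  show "deconcatenation R (bar_word R xs) \<psi> =
    (\<Sum>i\<in>{0<..<length xs}. pure (bar_space R) [bar_word R (take i xs), bar_word R (drop i xs)]) \<psi>"
  proof (cases "multilinear_form (bar_space R) \<psi>")
    case True
    have sc: "scale (shift 1 R) = scale R" by (simp add: shift_def)
    have bw: "bar_word R ws \<in> underlying (bar_space R)" if "set ws \<subseteq> underlying R" "ws \<noteq> []" for ws
      unfolding bar_space_def using assms(1) that by (intro pure_in_reduced_tensors) (simp_all add: sc)
    interpret R: vector_space "scale R" by fact
    note M = multilinearD[OF multilinear_pure[of "shift 1 R"], unfolded underlying_shift sc]
    note P1 = multilinearD(1)[OF True, of "[]" "[y]" for y, simplified]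
      and S1 = multilinearD(2)[OF True, of "[]" "[y]" for y, simplified]
      and P2 = multilinearD(1)[OF True, of "[y]" "[]" for y, simplified]
      and S2 = multilinearD(2)[OF True, of "[y]" "[]" for y, simplified]
    have bsc: "scale (bar_space R) = tscale" by (simp add: bar_space_def reduced_tensors_def)
    have "multilinear_form (shift 1 R) ?f"
      unfolding multilinear_def underlying_shift sc
    proof (intro allI impI conjI ballI)
      fix us ws x assume a: "set us \<subseteq> underlying R" "set ws \<subseteq> underlying R" "x \<in> underlying R"
      let ?I = "{0<..<length (us @ x # ws)}"
      let ?g = "\<lambda>y i. \<psi> [bar_word R (take i (us @ y # ws)), bar_word R (drop i (us @ y # ws))]"
      have tk: "set (take i us) \<subseteq> underlying R" "set (take i ws) \<subseteq> underlying R" 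
        "set (drop i us) \<subseteq> underlying R" "set (drop i ws) \<subseteq> underlying R" for i
        using a by (meson order.trans set_take_subset set_drop_subset)+
      have cases: "(\<exists>ws1 ws2. ws2 \<noteq> [] \<and> set ws1 \<subseteq> underlying R \<and> set ws2 \<subseteq> underlying R \<and>
             (\<forall>y. take i (us @ y # ws) = us @ y # ws1 \<and> drop i (us @ y # ws) = ws2)) \<or>
          (\<exists>us1 us2. us1 \<noteq> [] \<and> set us1 \<subseteq> underlying R \<and> set us2 \<subseteq> underlying R \<and>
             (\<forall>y. take i (us @ y # ws) = us1 \<and> drop i (us @ y # ws) = us2 @ y # ws))"
        if "i \<in> ?I" for i
      proof (cases "i \<le> length us")
        case True
        then show ?thesis using that tk by (intro disjI2 exI[of _ "take i us"] exI[of _ "drop i us"]) auto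
      next
        case False
        then obtain j where j: "i = length us + Suc j" by (metis add_Suc_right less_imp_Suc_add not_le)
        then show ?thesis using that tk by (intro disjI1 exI[of _ "take j ws"] exI[of _ "drop j ws"]) auto
      qed
      { fix c
        have "?g (scale R c x) i = c * ?g x i" if "i \<in> ?I" for i
          using cases[OF that]
        proof (elim disjE exE conjE)
          fix ws1 ws2 assume w: "ws2 \<noteq> []" "set ws1 \<subseteq> underlying R" "set ws2 \<subseteq> underlying R"
             "\<forall>y. take i (us @ y # ws) = us @ y # ws1 \<and> drop i (us @ y # ws) = ws2"
          show ?thesis using a w by (simp add: M S1[OF bw bw, unfolded bsc])
        next
          fix us1 us2 assume w: "us1 \<noteq> []" "set us1 \<subseteq> underlying R" "set us2 \<subseteq> underlying R"
             "\<forall>y. take i (us @ y # ws) = us1 \<and> drop i (us @ y # ws) = us2 @ y # ws"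
          show ?thesis using a w by (simp add: M S2[OF bw bw, unfolded bsc])
        qed
        then show "?f (us @ scale R c x # ws) = c * ?f (us @ x # ws)"
          by (simp add: sum_distrib_left del: take_append drop_append) }
      fix y assume y: "y \<in> underlying R"
      have "?g (x + y) i = ?g x i + ?g y i" if "i \<in> ?I" for i
        using cases[OF that]
      proof (elim disjE exE conjE)
        fix ws1 ws2 assume w: "ws2 \<noteq> []" "set ws1 \<subseteq> underlying R" "set ws2 \<subseteq> underlying R"
           "\<forall>y. take i (us @ y # ws) = us @ y # ws1 \<and> drop i (us @ y # ws) = ws2"
        show ?thesis using a w y by (simp add: M P1[OF bw bw bw])
      next
        fix us1 us2 assume w: "us1 \<noteq> []" "set us1 \<subseteq> underlying R" "set us2 \<subseteq> underlying R"
           "\<forall>y. take i (us @ y # ws) = us1 \<and> drop i (us @ y # ws) = us2 @ y # ws"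
        show ?thesis using a w y by (simp add: M P2[OF bw bw bw])
      qed
      then show "?f (us @ (x + y) # ws) = ?f (us @ x # ws) + ?f (us @ y # ws)"
        by (simp add: sum.distrib del: take_append drop_append)
    qed
    moreover have "(\<Sum>i\<in>I. F i) \<psi> = (\<Sum>i\<in>I. F i \<psi>)" for F :: "nat \<Rightarrow> ('k, ('k, 'v) tens) tens" and I
      by (induction I rule: infinite_finite_induct) auto
    ultimately show ?thesis using True by (simp add: deconcatenation_def pure_def)
  next
    case False
    moreover have "(\<Sum>i\<in>I. F i) \<psi> = (\<Sum>i\<in>I. F i \<psi>)" for F :: "nat \<Rightarrow> ('k, ('k, 'v) tens) tens" and I
      by (induction I rule: infinite_finite_induct) auto
    ultimately show ?thesis by (simp add: deconcatenation_def pure_def)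
  qed
qed

text \<open>
  The components of a coderivation \<open>b\<close> are the composites of \<open>b\<close> with the projection
  \<open>tpart _ 1\<close> onto words of length one, restricted to words of each given length.
\<close>

definition is_bar_differential ::
  "('k::field, 'v::ab_group_add, 'm) nudga_scheme \<Rightarrow> (('k, 'v) tens \<Rightarrow> ('k, 'v) tens) \<Rightarrow> bool" where
  "is_bar_differential R b \<longleftrightarrow>
     coderivation (bar_space R) (deconcatenation R) b \<and>
     (\<forall>x\<in>underlying R. tpart (shift 1 R) 1 (b (bar_word R [x])) = bar_word R [- diff R x]) \<and>
     (\<forall>m. \<forall>x\<in>homog R m. \<forall>y\<in>underlying R.
        tpart (shift 1 R) 1 (b (bar_word R [x, y])) = bar_word R [scale R ((-1) powi m) (mult R x y)]) \<and>
     (\<forall>xs. set xs \<subseteq> underlying R \<and> 3 \<le> length xs \<longrightarrow> tpart (shift 1 R) 1 (b (bar_word R xs)) = 0)"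

text \<open>
  Here and below, \<open>SOME\<close> selects a map which is uniquely determined on the underlying space
  \<open>underlying _\<close>; its values elsewhere in the ambient type are irrelevant.
\<close>

definition bar_differential ::
  "('k::field, 'v::ab_group_add, 'm) nudga_scheme \<Rightarrow> ('k, 'v) tens \<Rightarrow> ('k, 'v) tens" where
  "bar_differential R = (SOME b. is_bar_differential R b)"

definition Bar :: "('k::field, 'v::ab_group_add, 'm) nudga_scheme \<Rightarrow> ('k, ('k, 'v) tens) dgcoalg" where
  "Bar R = \<lparr>scale = scale (bar_space R), homog = homog (bar_space R),
     diff = bar_differential R, comult = deconcatenation R\<rparr>"


section \<open>The cobar construction\<close>

definition cobar_space ::
  "('k::field, 'b::ab_group_add, 'm) dgcoalg_scheme \<Rightarrow> ('k, ('k, 'b) tens) gvs" where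
  "cobar_space B = tensor_algebra (shift (-1) B)"

abbreviation cobar_mult ::
  "('k::field, 'b::ab_group_add, 'm) dgcoalg_scheme \<Rightarrow> ('k, 'b) tens \<Rightarrow> ('k, 'b) tens \<Rightarrow> ('k, 'b) tens" where
  "cobar_mult B \<equiv> tmult (shift (-1) B)"

abbreviation cobar_unit :: "('k::field, 'b::ab_group_add, 'm) dgcoalg_scheme \<Rightarrow> ('k, 'b) tens" where
  "cobar_unit B \<equiv> pure (shift (-1) B) []"

text \<open>The generator \<open>s\<^sup>-\<^sup>1c\<close>:\<close>

abbreviation gen :: "('k::field, 'b::ab_group_add, 'm) dgcoalg_scheme \<Rightarrow> 'b \<Rightarrow> ('k, 'b) tens" where
  "gen B c \<equiv> pure (shift (-1) B) [c]"

definition is_d_Bar ::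
  "('k::field, 'b::ab_group_add, 'm) dgcoalg_scheme \<Rightarrow> (('k, 'b) tens \<Rightarrow> ('k, 'b) tens) \<Rightarrow> bool" where
  "is_d_Bar B D \<longleftrightarrow> derivation (cobar_space B) (cobar_mult B) D \<and>
     (\<forall>c\<in>underlying B. D (gen B c) = - gen B (diff B c))"

definition is_d_Cobar ::
  "('k::field, 'b::ab_group_add, 'm) dgcoalg_scheme \<Rightarrow> (('k, 'b) tens \<Rightarrow> ('k, 'b) tens) \<Rightarrow> bool" where
  "is_d_Cobar B D \<longleftrightarrow> derivation (cobar_space B) (cobar_mult B) D \<and>
     (\<forall>c\<in>underlying B. \<forall>ts. sweedler B (comult B) c ts \<longrightarrow>
        D (gen B c) =
          - (\<Sum>(m, c', c'') \<leftarrow> ts. tscale ((-1) powi m) (cobar_mult B (gen B c') (gen B c''))))"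

definition d_Bar ::
  "('k::field, 'b::ab_group_add, 'm) dgcoalg_scheme \<Rightarrow> ('k, 'b) tens \<Rightarrow> ('k, 'b) tens" where
  "d_Bar B = (SOME D. is_d_Bar B D)"

definition d_Cobar ::
  "('k::field, 'b::ab_group_add, 'm) dgcoalg_scheme \<Rightarrow> ('k, 'b) tens \<Rightarrow> ('k, 'b) tens" where
  "d_Cobar B = (SOME D. is_d_Cobar B D)"


section \<open>The algebra \<open>A\<^sub>+\<close>, the derivation \<open>d\<^sub>\<xi>\<close> and \<open>C(A)\<close>\<close>

text \<open>The pair \<open>(a, c)\<close> stands for \<open>a + c\<xi>\<close>.\<close>

definition adjoin_xi :: "('k::field, 'v::ab_group_add, 'm) dga_scheme \<Rightarrow> ('k, 'v \<times> 'k) nudga" where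
  "adjoin_xi A = \<lparr>scale = (\<lambda>r (a, c). (scale A r a, r * c)),
     homog = (\<lambda>n. homog A n \<times> (if n = -1 then UNIV else {0})),
     diff = (\<lambda>(a, c). (diff A a, 0)),
     mult = (\<lambda>(a, c) (a', c'). (mult A a a', 0))\<rparr>"

definition incl :: "'v \<Rightarrow> 'v \<times> 'k::field" where
  "incl a = (a, 0)"

definition xi :: "'v::ab_group_add \<times> 'k::field" where
  "xi = (0, 1)"

type_synonym ('k, 'v) cobar_bar = "('k, ('k, 'v \<times> 'k) tens) tens"

text \<open>The generator \<open>s\<^sup>-\<^sup>1[x\<^sub>1|\<dots>|x\<^sub>n]\<close>:\<close>

abbreviation gen_word ::
  "('k::field, 'v::ab_group_add, 'm) dga_scheme \<Rightarrow> ('v \<times> 'k) list \<Rightarrow> ('k, 'v) cobar_bar" where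
  "gen_word A xs \<equiv> gen (Bar (adjoin_xi A)) (bar_word (adjoin_xi A) xs)"

definition is_d_xi ::
  "('k::field, 'v::ab_group_add, 'm) dga_scheme \<Rightarrow> (('k, 'v) cobar_bar \<Rightarrow> ('k, 'v) cobar_bar) \<Rightarrow> bool" where
  "is_d_xi A D \<longleftrightarrow>
     derivation (cobar_space (Bar (adjoin_xi A))) (cobar_mult (Bar (adjoin_xi A))) D \<and>
     D (gen_word A [xi]) = cobar_unit (Bar (adjoin_xi A)) - gen_word A [incl (unit A)] \<and>
     (\<forall>a\<in>underlying A. D (gen_word A [incl a]) = 0) \<and>
     (\<forall>xs ns. 2 \<le> length xs \<and>
        list_all2 (\<lambda>x n. x = xi \<and> n = -1 \<or> (\<exists>a\<in>homog A n. x = incl a)) xs ns \<longrightarrow>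
        D (gen_word A xs) =
          - (\<Sum>i | i < length xs \<and> xs ! i = xi.
               tscale ((-1) powi (\<Sum>j<i. ns ! j - 1)) (gen_word A (xs[i := incl (unit A)]))))"

definition d_xi :: "('k::field, 'v::ab_group_add, 'm) dga_scheme \<Rightarrow> ('k, 'v) cobar_bar \<Rightarrow> ('k, 'v) cobar_bar" where
  "d_xi A = (SOME D. is_d_xi A D)"

definition CobarBar :: "('k::field, 'v::ab_group_add, 'm) dga_scheme \<Rightarrow> ('k, ('k, 'v) cobar_bar) dga" where
  "CobarBar A = \<lparr>scale = scale (cobar_space (Bar (adjoin_xi A))), homog = homog (cobar_space (Bar (adjoin_xi A))),
     diff = (\<lambda>x. d_Bar (Bar (adjoin_xi A)) x + d_Cobar (Bar (adjoin_xi A)) x + d_xi A x),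
     mult = cobar_mult (Bar (adjoin_xi A)), unit = cobar_unit (Bar (adjoin_xi A))\<rparr>"

end

theory Submission
  imports Defs
begin

text \<open>
  The map \<open>p\<close> sends \<open>a\<close> to \<open>a\<close> and kills \<open>\<xi>\<close> and all words of length at least two. The bar differential
  together with the substitution \<open>\<xi> \<mapsto> 1\<^sub>A\<close> is a coderivation \<open>b\<close> which does not square to zero: \<open>b\<^sup>2\<close> strips
  a \<open>\<xi>\<close> from either end of a word, and this curvature is cancelled by the term \<open>\<xi> \<mapsto> 1\<close> of \<open>d\<^sub>\<xi>\<close>.
  Let \<open>h\<close> turn the first cobar product into a bar, \<open>[x] \<boxtimes> [w] \<boxtimes> y \<mapsto> \<plusminus> [x|w] \<boxtimes> y\<close>, with
  \<open>h(1) = \<xi>\<close> and \<open>h = 0\<close> on the other words. Then \<open>id - dh - hd\<close> lowers the number of letters, and on words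
  with at most one letter it is \<open>p\<close> followed by the inclusion of \<open>A\<close>. Hence a cocycle \<open>z\<close> with \<open>p(z)\<close> exact is
  exact, by induction on the number of letters.
\<close>

text \<open>The differentials of \<open>C(A)\<close> are choices by \<open>SOME\<close>, and tensors
  are functionals on multilinear forms. So every map is built by recursion on the first letter from
  the universal property, identities are checked along that recursion, and existence and uniqueness
  arguments identify the chosen differentials with one explicit derivation \<open>dC\<close>.
  Letters met in the recursion need not be homogeneous, so signs are carried by an operator instead
  of degrees. That \<open>dC\<close> squares to zero is proved, being part of
  \<open>dg_algebra_hom\<close>. The contraction works because the cobar part of d[x|w] contains the
  product of [x] and [w] up to sign, which h joins again, whereas the other terms begin with a word
  of at least two letters, cancel in pairs, or have lost a letter through a product or through the
  constant 1 in d_xi. The unit is the exception that forces h(1) = xi: it is linked to the letter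
  1_A by d(xi) = 1 - 1_A.\<close>

text \<open>
  Elements of the tensor algebra are functions; pointwise evaluation of sums is only wanted on demand.
\<close>

declare plus_fun_apply [simp del] zero_fun_apply [simp del] minus_apply [simp del] uminus_apply [simp del]

lemmas pointwise = plus_fun_apply zero_fun_apply minus_apply uminus_apply

section \<open>Linear maps defined on whole types\<close>

definition lin ::
  "('k \<Rightarrow> 'a::ab_group_add \<Rightarrow> 'a) \<Rightarrow> ('k \<Rightarrow> 'b::ab_group_add \<Rightarrow> 'b) \<Rightarrow> ('a \<Rightarrow> 'b) \<Rightarrow> bool" where
  "lin s t f \<longleftrightarrow> (\<forall>x y. f (x + y) = f x + f y) \<and> (\<forall>c x. f (s c x) = t c (f x))"

definition bilin ::
  "('k \<Rightarrow> 'a::ab_group_add \<Rightarrow> 'a) \<Rightarrow> ('k \<Rightarrow> 'b::ab_group_add \<Rightarrow> 'b) \<Rightarrow>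
    ('k \<Rightarrow> 'c::ab_group_add \<Rightarrow> 'c) \<Rightarrow> ('a \<Rightarrow> 'b \<Rightarrow> 'c) \<Rightarrow> bool" where
  "bilin s t u f \<longleftrightarrow> (\<forall>y. lin s u (\<lambda>x. f x y)) \<and> (\<forall>x. lin t u (f x))"

lemma lin_add: "lin s t f \<Longrightarrow> f (x + y) = f x + f y"
  and lin_scale: "lin s t f \<Longrightarrow> f (s c x) = t c (f x)"
  by (simp_all add: lin_def)

lemma lin_0: assumes "lin s t f" shows "f 0 = 0"
  using lin_add[OF assms, of 0 0] by simp

lemma lin_diff: assumes "lin s t f" shows "f (x - y) = f x - f y"
  using lin_add[OF assms, of "x - y" y] by (simp add: algebra_simps)

lemma lin_neg: assumes "lin s t f" shows "f (- x) = - f x"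
  using lin_diff[OF assms, of 0 x] lin_0[OF assms] by simp

lemma lin_sum: assumes "lin s t f" shows "f (\<Sum>i\<in>I. g i) = (\<Sum>i\<in>I. f (g i))"
  by (induction I rule: infinite_finite_induct) (simp_all add: lin_0[OF assms] lin_add[OF assms])

lemma lin_sum_list: assumes "lin s t f" shows "f (\<Sum>i\<leftarrow>is. g i) = (\<Sum>i\<leftarrow>is. f (g i))"
  by (induction "is") (simp_all add: lin_0[OF assms] lin_add[OF assms])

lemmas lin_simps = lin_add lin_scale lin_0 lin_diff lin_neg lin_sum

lemma bilin_left: "bilin s t u f \<Longrightarrow> lin s u (\<lambda>x. f x y)"
  and bilin_right: "bilin s t u f \<Longrightarrow> lin t u (f x)"
  by (simp_all add: bilin_def)

lemmas bilin_simps = lin_simps[OF bilin_left] lin_simps[OF bilin_right]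

lemma linear_iff_lin: "Vector_Spaces.linear s t f \<longleftrightarrow> vector_space s \<and> vector_space t \<and> lin s t f"
  unfolding Vector_Spaces.linear_iff lin_def by auto

lemma lin_eq_on_span:
  assumes "vector_space s" "lin s t f" "lin s t g" "\<And>x. x \<in> S \<Longrightarrow> f x = g x" "vector_space t"
    and "x \<in> module.span s S"
  shows "f x = g x"
proof -
  interpret S: vector_space s by fact
  interpret T: vector_space t by fact
  show ?thesis
    using assms(6)
    by (induction rule: S.span_induct_alt)
       (simp_all add: lin_simps[OF assms(2)] lin_simps[OF assms(3)] assms(4))
qed

lemma lin_compose: "lin s t f \<Longrightarrow> lin t u g \<Longrightarrow> lin s u (\<lambda>x. g (f x))"
  by (simp add: lin_def)

lemma vector_space_mult: "vector_space ((*) :: 'k::field \<Rightarrow> 'k \<Rightarrow> 'k)"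
  by unfold_locales (auto simp: algebra_simps)

definition lproj :: "('k::field \<Rightarrow> 'a::ab_group_add \<Rightarrow> 'a) \<Rightarrow> 'a set \<Rightarrow> 'a \<Rightarrow> 'a" where
  "lproj s U = (SOME p. lin s s p \<and> (\<forall>x\<in>U. p x = x) \<and> (\<forall>x. p x \<in> U))"

context vector_space
begin

text \<open>Over a field a basis \<open>B\<close> of \<open>U\<close> extends to the whole space, so
  the identity of \<open>B\<close> extends to a linear map with values in the span of
  \<open>B\<close>.\<close>

lemma lproj:
  assumes "subspace U"
  shows "lin scale scale (lproj scale U)" "x \<in> U \<Longrightarrow> lproj scale U x = x" "lproj scale U x \<in> U"
proof -
  interpret P: vector_space_pair scale scale ..
  obtain B where B: "B \<subseteq> U" "independent B" "U \<subseteq> span B"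
    using maximal_independent_subset by blast
  have sB: "span B = U" using B(1,3) assms span_minimal by blast
  let ?p = "P.construct B (\<lambda>b. b)"
  have l: "Vector_Spaces.linear scale scale ?p" by (rule P.linear_construct[OF B(2)])
  then have l': "lin scale scale ?p" by (simp add: linear_iff_lin)
  have "?p x = x" if "x \<in> U" for x
    by (rule lin_eq_on_span[OF vector_space_axioms l' _ _ vector_space_axioms, where g = "\<lambda>x. x" and S = B])
       (use that sB P.construct_basis[OF B(2)] in \<open>auto simp: lin_def\<close>)
  moreover have "?p x \<in> U" for x
    using P.construct_in_span[OF B(2), of "\<lambda>b. b" x] sB by simp
  ultimately have "\<exists>p. lin scale scale p \<and> (\<forall>x\<in>U. p x = x) \<and> (\<forall>x. p x \<in> U)"
    using l' by blast
  from someI_ex[OF this]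
  show "lin scale scale (lproj scale U)" "x \<in> U \<Longrightarrow> lproj scale U x = x" "lproj scale U x \<in> U"
    by (simp_all add: lproj_def)
qed

end

section \<open>The tensor algebra as a free algebra\<close>

lemma tens_neg [simp]: "tscale (- 1) F = - F"
  by (simp add: fun_eq_iff pointwise tscale_def)

text \<open>
  The product and the generators are precomposed with linear projections \<open>pt\<close>, \<open>pv\<close> onto the carriers,
  which makes them linear on whole types and removes membership conditions from calculations.
\<close>

locale tspace = vector_space "scale V" for V :: "('k::field, 'v::ab_group_add, 'm) gvs_scheme"
begin

abbreviation U :: "'v set" where "U \<equiv> underlying V"

definition T :: "('k, 'v) tens set" where
  "T = tens.span (pure V ` {xs. set xs \<subseteq> U})"

definition pv :: "'v \<Rightarrow> 'v" where "pv = lproj (scale V) U"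
definition pt :: "('k, 'v) tens \<Rightarrow> ('k, 'v) tens" where "pt = lproj tscale T"
definition sg :: "'v \<Rightarrow> ('k, 'v) tens" where "sg x = pure V [pv x]"
definition mul :: "('k, 'v) tens \<Rightarrow> ('k, 'v) tens \<Rightarrow> ('k, 'v) tens" (infixl \<open>\<odot>\<close> 70)
  where "F \<odot> G = tmult V (pt F) (pt G)"
abbreviation one :: "('k, 'v) tens" where "one \<equiv> pure V []"

lemma subspace_U: "subspace U"
  by (simp add: underlying_def)

lemma U_closed [simp]:
  "0 \<in> U" "x \<in> U \<Longrightarrow> y \<in> U \<Longrightarrow> x + y \<in> U" "x \<in> U \<Longrightarrow> y \<in> U \<Longrightarrow> x - y \<in> U"
  "x \<in> U \<Longrightarrow> scale V c x \<in> U" "x \<in> U \<Longrightarrow> - x \<in> U"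
  using subspace_U by (simp_all add: subspace_0 subspace_add subspace_diff subspace_scale subspace_neg)

lemma homog_U: "x \<in> homog V n \<Longrightarrow> x \<in> U"
  unfolding underlying_def by (rule span_base) auto

lemma subspace_T: "tens.subspace T"
  by (simp add: T_def)

lemma T_closed [simp]:
  "0 \<in> T" "F \<in> T \<Longrightarrow> G \<in> T \<Longrightarrow> F + G \<in> T" "F \<in> T \<Longrightarrow> G \<in> T \<Longrightarrow> F - G \<in> T"
  "F \<in> T \<Longrightarrow> tscale c F \<in> T" "F \<in> T \<Longrightarrow> - F \<in> T"
  using subspace_T by (simp_all add: tens.subspace_0 tens.subspace_add tens.subspace_diff
    tens.subspace_scale tens.subspace_neg)

lemma pure_T: "set xs \<subseteq> U \<Longrightarrow> pure V xs \<in> T"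
  unfolding T_def by (rule tens.span_base) auto

lemma one_T [simp]: "one \<in> T"
  by (rule pure_T) simp

lemma homog_word_set: "homog_word V xs ns \<Longrightarrow> set xs \<subseteq> U"
  unfolding homog_word_def by (induction rule: list_all2_induct) (auto intro: homog_U)

lemma T_eq: "underlying (tensor_algebra V) = T"
proof -
  have "tens.span {pure V xs |xs ns. homog_word V xs ns} = T"
    unfolding T_def
  proof (intro tens.span_eq[THEN iffD2] conjI)
    show "{pure V xs |xs ns. homog_word V xs ns} \<subseteq> tens.span (pure V ` {xs. set xs \<subseteq> U})"
      using homog_word_set by (auto intro!: tens.span_base)
    show "pure V ` {xs. set xs \<subseteq> U} \<subseteq> tens.span {pure V xs |xs ns. homog_word V xs ns}"
    proof safe
      fix xs assume "set xs \<subseteq> U"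
      from pure_in_span[OF vector_space_axioms this]
      show "pure V xs \<in> tens.span {pure V xs |xs ns. homog_word V xs ns}"
        by (rule tens.span_mono[THEN subsetD, rotated]) auto
    qed
  qed
  then show ?thesis by (simp add: underlying_tensor_algebra)
qed

lemma T_span_induct [consumes 1, case_names pure zero add scale]:
  assumes "F \<in> T" "\<And>xs. set xs \<subseteq> U \<Longrightarrow> P (pure V xs)" "P 0"
    "\<And>F G. F \<in> T \<Longrightarrow> G \<in> T \<Longrightarrow> P F \<Longrightarrow> P G \<Longrightarrow> P (F + G)"
    "\<And>c F. F \<in> T \<Longrightarrow> P F \<Longrightarrow> P (tscale c F)"
  shows "P F"
proof -
  have "F \<in> T \<and> P F"
    using assms(1) unfolding T_def[of]
  proof (induction rule: tens.span_induct_alt)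
    case base
    then show ?case using assms(3) T_closed(1) by (simp add: T_def)
  next
    case (step c x y)
    then obtain xs where xs: "set xs \<subseteq> U" "x = pure V xs" by auto
    have "x \<in> T" using xs pure_T by simp
    moreover have "y \<in> T" using step by (simp add: T_def)
    ultimately show ?case using assms(2,4,5) xs step by (simp add: T_def[symmetric])
  qed
  then show ?thesis by blast
qed

lemma pv_lin: "lin (scale V) (scale V) pv" and pv_U [simp]: "pv x \<in> U" and pv_id [simp]: "x \<in> U \<Longrightarrow> pv x = x"
  unfolding pv_def using lproj[OF subspace_U] by auto

lemma pt_lin: "lin tscale tscale pt" and pt_T [simp]: "pt F \<in> T" and pt_id [simp]: "F \<in> T \<Longrightarrow> pt F = F"
  unfolding pt_def using tens.lproj[OF subspace_T] by auto

lemmas pt_simps [simp] = lin_simps[OF pt_lin]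

lemma sg_lin: "lin (scale V) tscale sg"
  using multilinearD[OF multilinear_pure[of V], of "[]" "[]"]
  by (simp add: lin_def sg_def lin_simps[OF pv_lin])

lemmas sg_simps [simp] = lin_simps[OF sg_lin]

lemma sg_T [simp]: "sg x \<in> T"
  by (simp add: sg_def pure_T)

lemma sg_eq: "x \<in> U \<Longrightarrow> sg x = pure V [x]"
  by (simp add: sg_def)

text \<open>\<open>pure\<close> returns 0 on functions that are not multilinear, so evaluating a
  product requires the inner function to be a form again.\<close>

lemma multilinear_form_append:
  assumes "G \<in> T" "multilinear_form V \<phi>"
  shows "multilinear_form V (\<lambda>xs. G (\<lambda>ys. \<phi> (xs @ ys)))"
  using assms(1)
proof (induction rule: T_span_induct)
  case (pure ys)
  show ?case
  proof (rule multilinear_cong[OF vector_space_axioms multilinear_append(2)[OF assms(2) pure]])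
    show "pure V ys (\<lambda>ys. \<phi> (us @ ys)) = \<phi> (us @ ys)" if "set us \<subseteq> U" for us
      using multilinear_append(1)[OF assms(2) that] by (simp add: pure_def)
  qed
qed (auto simp: multilinear_def tscale_def pointwise algebra_simps)

lemma tmult_pure_left:
  assumes "set xs \<subseteq> U" "G \<in> T"
  shows "tmult V (pure V xs) G = (\<lambda>\<phi>. if multilinear_form V \<phi> then G (\<lambda>ys. \<phi> (xs @ ys)) else 0)"
  using multilinear_form_append[OF assms(2)] by (simp add: tmult_def pure_def fun_eq_iff pointwise)

lemma tmult_left: "lin tscale tscale (\<lambda>F. tmult V F G)"
  by (simp add: lin_def tmult_def fun_eq_iff pointwise tscale_def)

lemmas tmult_left_simps = lin_simps[OF tmult_left]

lemma tmult_right_add: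
  assumes "F \<in> T" "G \<in> T" "H \<in> T"
  shows "tmult V F (G + H) = tmult V F G + tmult V F H"
  using assms(1)
proof (induction rule: T_span_induct)
  case (pure xs)
  have "tmult V (pure V xs) (G + H) \<phi> = (tmult V (pure V xs) G + tmult V (pure V xs) H) \<phi>" for \<phi>
    using tmult_pure_left[OF pure] assms by (simp add: pointwise)
  then show ?case by (rule ext)
qed (simp_all add: tmult_left_simps tens.scale_right_distrib)

lemma tmult_right_scale:
  assumes "F \<in> T" "G \<in> T"
  shows "tmult V F (tscale c G) = tscale c (tmult V F G)"
  using assms(1)
proof (induction rule: T_span_induct)
  case (pure xs)
  have "tmult V (pure V xs) (tscale c G) \<phi> = tscale c (tmult V (pure V xs) G) \<phi>" for \<phi>
    using tmult_pure_left[OF pure] assms(2) T_closed(4)[OF assms(2), of c] by (simp add: tscale_def)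
  then show ?case by (rule ext)
qed (simp_all add: tmult_left_simps tens.scale_right_distrib mult.commute)

lemma mul_bilin: "bilin tscale tscale tscale (\<odot>)"
  by (simp add: bilin_def lin_def mul_def tmult_right_add tmult_right_scale tmult_left_simps)

lemmas mul_simps [simp] = bilin_simps[OF mul_bilin]

lemma mul_pure: "set xs \<subseteq> U \<Longrightarrow> set ys \<subseteq> U \<Longrightarrow> pure V xs \<odot> pure V ys = pure V (xs @ ys)"
  by (simp add: mul_def pure_T tmult_pure[OF vector_space_axioms])

lemma mul_eq: "F \<in> T \<Longrightarrow> G \<in> T \<Longrightarrow> tmult V F G = F \<odot> G"
  by (simp add: mul_def)

lemma mul_pt [simp]: "pt F \<odot> G = F \<odot> G" "F \<odot> pt G = F \<odot> G"
  by (simp_all add: mul_def)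

lemma mul_T' : "F \<in> T \<Longrightarrow> G \<in> T \<Longrightarrow> F \<odot> G \<in> T"
proof (induction F rule: T_span_induct)
  case (pure xs)
  from pure(2,1) show ?case
    by (induction G rule: T_span_induct) (simp_all add: mul_pure pure_T)
qed simp_all

lemma mul_T [simp]: "F \<odot> G \<in> T"
  using mul_T'[of "pt F" "pt G"] by simp

lemma mul_assoc': "F \<in> T \<Longrightarrow> G \<in> T \<Longrightarrow> H \<in> T \<Longrightarrow> F \<odot> G \<odot> H = F \<odot> (G \<odot> H)"
proof (induction F rule: T_span_induct)
  case (pure xs)
  from pure(2,1,3) show ?case
  proof (induction G rule: T_span_induct)
    case (pure ys)
    from pure(3,1,2) show ?case
      by (induction H rule: T_span_induct) (simp_all add: mul_pure)
  qed simp_all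
qed simp_all

lemma mul_assoc: "F \<odot> G \<odot> H = F \<odot> (G \<odot> H)"
  using mul_assoc'[of "pt F" "pt G" "pt H"] by (metis mul_pt pt_T)

lemma one_mul [simp]: "one \<odot> F = pt F" and mul_one [simp]: "F \<odot> one = pt F"
proof -
  have "one \<odot> G = G \<and> G \<odot> one = G" if "G \<in> T" for G
    using that by (induction rule: T_span_induct) (simp_all add: mul_pure)
  from this[OF pt_T[of F]] show "one \<odot> F = pt F" "F \<odot> one = pt F" by simp_all
qed

lemma pure_Cons: "x \<in> U \<Longrightarrow> set xs \<subseteq> U \<Longrightarrow> pure V (x # xs) = sg x \<odot> pure V xs"
  by (simp add: sg_eq mul_pure)

lemma T_induct [consumes 1, case_names one Cons zero add scale]:
  assumes "F \<in> T" "P one" "\<And>x F. x \<in> U \<Longrightarrow> F \<in> T \<Longrightarrow> P F \<Longrightarrow> P (sg x \<odot> F)" "P 0"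
    "\<And>F G. F \<in> T \<Longrightarrow> G \<in> T \<Longrightarrow> P F \<Longrightarrow> P G \<Longrightarrow> P (F + G)"
    "\<And>c F. F \<in> T \<Longrightarrow> P F \<Longrightarrow> P (tscale c F)"
  shows "P F"
  using assms(1)
proof (induction rule: T_span_induct)
  case (pure xs)
  then show ?case by (induction xs) (use assms(2,3) pure_T in \<open>auto simp: pure_Cons\<close>)
qed (use assms(4-6) in auto)

lemma lin_eq:
  assumes "vector_space s" "lin tscale s f" "lin tscale s g" "f one = g one"
    "\<And>x F. x \<in> U \<Longrightarrow> F \<in> T \<Longrightarrow> f F = g F \<Longrightarrow> f (sg x \<odot> F) = g (sg x \<odot> F)" "F \<in> T"
  shows "f F = g F"
  using assms(6)
  by (induction rule: T_induct)
     (simp_all add: lin_simps[OF assms(2)] lin_simps[OF assms(3)] assms(4,5))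

text \<open>Primitive recursion along \<open>T = k \<oplus> U \<otimes> T\<close>.\<close>

definition trec ::
  "('k \<Rightarrow> 'w::ab_group_add \<Rightarrow> 'w) \<Rightarrow> 'w \<Rightarrow> ('v \<Rightarrow> ('k, 'v) tens \<Rightarrow> 'w) \<Rightarrow> ('v \<Rightarrow> 'w \<Rightarrow> 'w) \<Rightarrow> ('k, 'v) tens \<Rightarrow> 'w"
  where
  "trec s w f g = (SOME L. lin tscale s L \<and> L one = w \<and> (\<forall>F. L (pt F) = L F) \<and>
     (\<forall>x\<in>U. \<forall>F\<in>T. L (sg x \<odot> F) = f x F + g x (L F)))"

lemma foldr_lin: "bilin (scale V) s s g \<Longrightarrow> lin s s (foldr g xs)"
  by (induction xs) (simp_all add: lin_def bilin_simps)

text \<open>\<open>foldr g xs w\<close> is multilinear in the letters because \<open>g\<close> is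
  bilinear, so the universal property applies; the recursion equation is then read off on
  words.\<close>

lemma fold_exists:
  fixes s :: "'k \<Rightarrow> 'w::ab_group_add \<Rightarrow> 'w"
  assumes "vector_space s" "bilin (scale V) s s g"
  shows "\<exists>L. lin tscale s L \<and> L one = w \<and> (\<forall>x\<in>U. \<forall>F\<in>T. L (sg x \<odot> F) = g x (L F))"
proof -
  have "multilinear V s (\<lambda>xs. foldr g xs w)"
    by (simp add: multilinear_def bilin_simps[OF assms(2)] lin_simps[OF foldr_lin[OF assms(2)]])
  from tensor_universal[OF assms(1) this] obtain L where
    L: "lin tscale s L" "\<And>xs. set xs \<subseteq> U \<Longrightarrow> L (pure V xs) = foldr g xs w"
    by (auto simp: linear_iff_lin)
  have "L (sg x \<odot> F) = g x (L F)" if "x \<in> U" "F \<in> T" for x F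
    using that(2)
  proof (induction rule: T_span_induct)
    case (pure xs)
    then show ?case using that by (simp add: pure_Cons[symmetric] L(2))
  qed (simp_all add: lin_simps[OF L(1)] bilin_simps[OF assms(2)])
  with L show ?thesis by force
qed

text \<open>Primitive recursion from iteration: the fold runs on pairs whose first component
  rebuilds the tensor itself. Composing with \<open>pt\<close> fixes the values off
  \<open>T\<close>, so that equations proved on \<open>T\<close> extend to all arguments.\<close>

lemma trec_exists:
  fixes s :: "'k \<Rightarrow> 'w::ab_group_add \<Rightarrow> 'w"
  assumes "vector_space s" "bilin (scale V) tscale s f" "bilin (scale V) s s g"
  shows "\<exists>L. lin tscale s L \<and> L one = w \<and> (\<forall>F. L (pt F) = L F) \<and>
     (\<forall>x\<in>U. \<forall>F\<in>T. L (sg x \<odot> F) = f x F + g x (L F))"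
proof -
  interpret W: vector_space s by fact
  define ps where "ps c z = (tscale c (fst z), s c (snd z))" for c and z :: "('k, 'v) tens \<times> 'w"
  have vs: "vector_space ps"
    by unfold_locales (auto simp: ps_def W.scale_right_distrib W.scale_left_distrib
      tens.scale_right_distrib tens.scale_left_distrib)
  have "bilin (scale V) ps ps (\<lambda>x z. (sg x \<odot> fst z, f x (fst z) + g x (snd z)))"
    by (auto simp: bilin_def lin_def ps_def bilin_simps[OF assms(2)] bilin_simps[OF assms(3)] W.scale_right_distrib)
  from fold_exists[OF vs this, of "(one, w)"] obtain L where
    L: "lin tscale ps L" "L one = (one, w)"
      "\<And>x F. x \<in> U \<Longrightarrow> F \<in> T \<Longrightarrow> L (sg x \<odot> F) = (sg x \<odot> fst (L F), f x (fst (L F)) + g x (snd (L F)))"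
    by blast
  have fst: "fst (L F) = F" if "F \<in> T" for F
    using that by (induction rule: T_induct) (simp_all add: L(2,3) lin_simps[OF L(1)], simp_all add: ps_def)
  have "lin tscale s (\<lambda>F. snd (L (pt F)))"
    by (simp add: lin_def lin_simps[OF L(1)]) (simp add: ps_def)
  then show ?thesis
    by (intro exI[of _ "\<lambda>F. snd (L (pt F))"]) (simp add: L fst)
qed

lemma trec:
  assumes "vector_space s" "bilin (scale V) tscale s f" "bilin (scale V) s s g"
  shows "lin tscale s (trec s w f g)" "trec s w f g one = w" "trec s w f g (pt F) = trec s w f g F"
    "x \<in> U \<Longrightarrow> F \<in> T \<Longrightarrow> trec s w f g (sg x \<odot> F) = f x F + g x (trec s w f g F)"
  using someI_ex[OF trec_exists[OF assms, of w]] unfolding trec_def[symmetric] by auto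

text \<open>Case distinction on the first letter. The parameter \<open>p\<close> is an argument of
  the resulting map so that linearity in it can be stated and a \<open>tcase\<close> can serve as
  the step of another recursion.\<close>

definition tcase ::
  "('k \<Rightarrow> 'w::ab_group_add \<Rightarrow> 'w) \<Rightarrow> ('p \<Rightarrow> 'v \<Rightarrow> ('k, 'v) tens \<Rightarrow> 'w) \<Rightarrow> 'p \<Rightarrow> ('k, 'v) tens \<Rightarrow> 'w"
  where "tcase s f p = trec s 0 (f p) (\<lambda>_ _. 0)"

lemma tcase:
  assumes "vector_space s" "\<And>p. bilin (scale V) tscale s (f p)" "\<And>x F. lin r s (\<lambda>p. f p x F)"
  shows "bilin r tscale s (tcase s f)" "tcase s f p one = 0"
    "x \<in> U \<Longrightarrow> F \<in> T \<Longrightarrow> tcase s f p (sg x \<odot> F) = f p x F"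
proof -
  interpret W: vector_space s by fact
  have z: "bilin (scale V) s s (\<lambda>_ _. 0)" by (simp add: bilin_def lin_def)
  note R = trec[OF assms(1,2) z, where w = 0, folded tcase_def]
  show "tcase s f p one = 0" "x \<in> U \<Longrightarrow> F \<in> T \<Longrightarrow> tcase s f p (sg x \<odot> F) = f p x F" for x F p
    using R by simp_all
  have "tcase s f (p + q) F = tcase s f p F + tcase s f q F" if "F \<in> T" for p q F
    using assms(1) R(1) _ _ _ that
    by (rule lin_eq) (simp_all add: R lin_def lin_simps[OF R(1)] lin_simps[OF assms(3)] algebra_simps W.scale_right_distrib)
  from this[OF pt_T] have add: "tcase s f (p + q) F = tcase s f p F + tcase s f q F" for p q F
    by (simp add: R)
  have "tcase s f (r c p) F = s c (tcase s f p F)" if "F \<in> T" for c p F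
    using assms(1) R(1) _ _ _ that
    by (rule lin_eq) (simp_all add: R lin_def lin_simps[OF R(1)] lin_simps[OF assms(3)] W.scale_right_distrib mult.commute)
  from this[OF pt_T] have "tcase s f (r c p) F = s c (tcase s f p F)" for c p F
    by (simp add: R)
  with add R(1) show "bilin r tscale s (tcase s f)" by (simp add: bilin_def lin_def)
qed

lemma bilin_mul: "lin r tscale h \<Longrightarrow> bilin r tscale tscale (\<lambda>x F. h x \<odot> F)"
  by (simp add: bilin_def lin_def)

lemma bilin_sg: "lin r (scale V) h \<Longrightarrow> bilin r tscale tscale (\<lambda>x F. sg (h x) \<odot> F)"
  by (rule bilin_mul) (rule lin_compose[OF _ sg_lin])

lemma bilin_zero: "vector_space u \<Longrightarrow> bilin r t u (\<lambda>_ _. 0)"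
  by (simp add: bilin_def lin_def module.scale_zero_right[OF module_iff_vector_space[THEN iffD2]])

lemma sg_pv [simp]: "sg (pv x) = sg x"
  by (simp add: sg_def)

section \<open>Endomorphisms and sign-twisted derivations of the tensor algebra\<close>

definition stt :: "('v \<Rightarrow> 'v) \<Rightarrow> ('k, 'v) tens \<Rightarrow> ('k, 'v) tens" where
  "stt \<sigma> = trec tscale one (\<lambda>_ _. 0) (\<lambda>x F. sg (\<sigma> x) \<odot> F)"

text \<open>The derivation with value \<open>g\<close> on letters whose Leibniz sign is the
  endomorphism \<open>stt \<sigma>\<close>. With \<open>\<sigma>\<close> the sign operator of the
  grading this is the graded Leibniz rule, in a form valid for inhomogeneous tensors as
  well.\<close>

definition der :: "('v \<Rightarrow> 'v) \<Rightarrow> ('v \<Rightarrow> ('k, 'v) tens) \<Rightarrow> ('k, 'v) tens \<Rightarrow> ('k, 'v) tens" where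
  "der \<sigma> g = trec tscale 0 (\<lambda>x F. g x \<odot> F) (\<lambda>x F. sg (\<sigma> x) \<odot> F)"

lemma stt:
  assumes "lin (scale V) (scale V) \<sigma>"
  shows "lin tscale tscale (stt \<sigma>)" "stt \<sigma> one = one" "stt \<sigma> (pt F) = stt \<sigma> F"
    "x \<in> U \<Longrightarrow> F \<in> T \<Longrightarrow> stt \<sigma> (sg x \<odot> F) = sg (\<sigma> x) \<odot> stt \<sigma> F"
  using trec[OF vector_space_tscale bilin_zero[OF vector_space_tscale] bilin_sg[OF assms]]
  by (simp_all add: stt_def)

lemma stt_sg: "lin (scale V) (scale V) \<sigma> \<Longrightarrow> x \<in> U \<Longrightarrow> stt \<sigma> (sg x) = sg (\<sigma> x)"
  using stt(4)[of \<sigma> x one] by (simp add: stt(2))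

lemma stt_T:
  assumes "lin (scale V) (scale V) \<sigma>" "F \<in> T"
  shows "stt \<sigma> F \<in> T"
  using assms(2) by (induction rule: T_induct) (simp_all add: stt[OF assms(1)] lin_simps[OF stt(1)[OF assms(1)]])

lemma der:
  assumes "lin (scale V) (scale V) \<sigma>" "lin (scale V) tscale g"
  shows "lin tscale tscale (der \<sigma> g)" "der \<sigma> g one = 0" "der \<sigma> g (pt F) = der \<sigma> g F"
    "x \<in> U \<Longrightarrow> F \<in> T \<Longrightarrow> der \<sigma> g (sg x \<odot> F) = g x \<odot> F + sg (\<sigma> x) \<odot> der \<sigma> g F"
  using trec[OF vector_space_tscale bilin_mul[OF assms(2)] bilin_sg[OF assms(1)]]
  by (simp_all add: der_def)

lemma der_sg:
  "lin (scale V) (scale V) \<sigma> \<Longrightarrow> lin (scale V) tscale g \<Longrightarrow> x \<in> U \<Longrightarrow> g x \<in> T \<Longrightarrow> der \<sigma> g (sg x) = g x"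
  using der(4)[of \<sigma> g x one] by (simp add: der(2))

lemma der_T:
  assumes "lin (scale V) (scale V) \<sigma>" "lin (scale V) tscale g" "F \<in> T"
  shows "der \<sigma> g F \<in> T"
  using assms(3)
  by (induction rule: T_induct) (simp_all add: der[OF assms(1,2)] lin_simps[OF der(1)[OF assms(1,2)]])

lemma stt_mul:
  assumes "lin (scale V) (scale V) \<sigma>"
  shows "stt \<sigma> (F \<odot> G) = stt \<sigma> F \<odot> stt \<sigma> G"
proof -
  have "stt \<sigma> (pt F \<odot> pt G) = stt \<sigma> (pt F) \<odot> stt \<sigma> (pt G)"
  proof (rule lin_eq[of tscale "\<lambda>F. stt \<sigma> (F \<odot> pt G)" "\<lambda>F. stt \<sigma> F \<odot> stt \<sigma> (pt G)" "pt F"])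
    show "stt \<sigma> (one \<odot> pt G) = stt \<sigma> one \<odot> stt \<sigma> (pt G)"
      using stt_T[OF assms, of "pt G"] by (simp add: stt[OF assms])
  qed (simp_all add: vector_space_tscale stt[OF assms] mul_assoc lin_def lin_simps[OF stt(1)[OF assms]])
  then show ?thesis by (simp add: stt[OF assms])
qed

lemma der_mul:
  assumes "lin (scale V) (scale V) \<sigma>" "lin (scale V) tscale g"
  shows "der \<sigma> g (F \<odot> G) = der \<sigma> g F \<odot> G + stt \<sigma> F \<odot> der \<sigma> g G"
proof -
  have "der \<sigma> g (pt F \<odot> pt G) = der \<sigma> g (pt F) \<odot> pt G + stt \<sigma> (pt F) \<odot> der \<sigma> g (pt G)"
  proof (rule lin_eq[of tscale "\<lambda>F. der \<sigma> g (F \<odot> pt G)"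
        "\<lambda>F. der \<sigma> g F \<odot> pt G + stt \<sigma> F \<odot> der \<sigma> g (pt G)" "pt F"])
    show "der \<sigma> g (one \<odot> pt G) = der \<sigma> g one \<odot> pt G + stt \<sigma> one \<odot> der \<sigma> g (pt G)"
      using der_T[OF assms, of "pt G"] by (simp add: der[OF assms] stt[OF assms(1)])
  qed (simp_all add: vector_space_tscale stt[OF assms(1)] der[OF assms] mul_assoc lin_def
      lin_simps[OF stt(1)[OF assms(1)]] lin_simps[OF der(1)[OF assms]] tens.scale_right_distrib)
  then show ?thesis by (simp add: stt[OF assms(1)] der[OF assms])
qed

subsection \<open>Words of a given length and reduced tensors\<close>

lemma tpart_lin: "lin tscale tscale (tpart V n)"
  by (simp add: lin_def tpart_def fun_eq_iff pointwise tscale_def)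

lemma tpart_one: "tpart V n one = (if n = 0 then one else 0)"
  by (simp add: tpart_pure)

lemma tpart_Cons:
  assumes "x \<in> U" "F \<in> T"
  shows "tpart V 0 (sg x \<odot> F) = 0" "tpart V (Suc n) (sg x \<odot> F) = sg x \<odot> tpart V n F"
proof -
  show "tpart V 0 (sg x \<odot> F) = 0"
    using assms(2)
  proof (induction rule: T_span_induct)
    case (pure xs)
    then show ?case using assms(1) by (simp add: pure_Cons[symmetric] tpart_pure)
  qed (simp_all add: lin_simps[OF tpart_lin])
  show "tpart V (Suc n) (sg x \<odot> F) = sg x \<odot> tpart V n F"
    using assms(2)
  proof (induction rule: T_span_induct)
    case (pure xs)
    then show ?case using assms(1) by (simp add: pure_Cons[symmetric] tpart_pure)
  qed (simp_all add: lin_simps[OF tpart_lin])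
qed

text \<open>The augmentation: the coefficient of the empty word.\<close>

definition ctr :: "('k, 'v) tens \<Rightarrow> 'k" where
  "ctr = trec (*) 1 (\<lambda>_ _. 0) (\<lambda>_ _. 0)"

lemmas ctr_trec = trec[OF vector_space_mult bilin_zero[OF vector_space_mult] bilin_zero[OF vector_space_mult],
  where w = 1, folded ctr_def]

lemma ctr_lin: "lin tscale (*) ctr" and ctr_one [simp]: "ctr one = 1" and ctr_pt [simp]: "ctr (pt F) = ctr F"
  by (rule ctr_trec)+

lemmas ctr_simps [simp] = lin_simps[OF ctr_lin]

lemma ctr_Cons [simp]: "ctr (sg x \<odot> F) = 0"
  using ctr_trec(4)[of "pv x" "pt F"] by simp

lemma ctr_sg [simp]: "ctr (sg x) = 0"
  using ctr_Cons[of x one] by simp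

definition red :: "('k, 'v) tens \<Rightarrow> ('k, 'v) tens" where
  "red F = pt F - tscale (ctr F) one"

lemma red_lin: "lin tscale tscale red"
  by (simp add: lin_def red_def tens.scale_left_distrib tens.scale_right_diff_distrib)

lemmas red_simps [simp] = lin_simps[OF red_lin]

lemma red_one [simp]: "red one = 0" and red_Cons [simp]: "red (sg x \<odot> F) = sg x \<odot> F"
  and red_sg [simp]: "red (sg x) = sg x" and red_T [simp]: "red F \<in> T" and ctr_red [simp]: "ctr (red F) = 0"
  by (simp_all add: red_def)

definition Tr :: "('k, 'v) tens set" where "Tr = {F \<in> T. ctr F = 0}"

lemma Tr_T: "F \<in> Tr \<Longrightarrow> F \<in> T" and Tr_ctr [simp]: "F \<in> Tr \<Longrightarrow> ctr F = 0"
  and red_Tr [simp]: "red F \<in> Tr" and red_id [simp]: "F \<in> Tr \<Longrightarrow> red F = F"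
  and Cons_Tr [simp]: "sg x \<odot> F \<in> Tr" and sg_Tr [simp]: "sg x \<in> Tr"
  by (simp_all add: Tr_def) (simp add: red_def)

lemma pure_Tr: "xs \<noteq> [] \<Longrightarrow> set xs \<subseteq> U \<Longrightarrow> pure V xs \<in> Tr"
  by (cases xs) (simp_all add: pure_Cons)

lemma Tr_closed [simp]:
  "0 \<in> Tr" "F \<in> Tr \<Longrightarrow> G \<in> Tr \<Longrightarrow> F + G \<in> Tr" "F \<in> Tr \<Longrightarrow> G \<in> Tr \<Longrightarrow> F - G \<in> Tr"
  "F \<in> Tr \<Longrightarrow> tscale c F \<in> Tr" "F \<in> Tr \<Longrightarrow> - F \<in> Tr"
  by (simp_all add: Tr_def del: Tr_ctr)

text \<open>A reduced tensor has no empty-word part, so after composing with \<open>red\<close> the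
  base case of the recursion becomes 0 = 0.\<close>

lemma red_eq:
  assumes "vector_space s" "lin tscale s f" "lin tscale s g"
    "\<And>x F. x \<in> U \<Longrightarrow> F \<in> T \<Longrightarrow> f (sg x \<odot> F) = g (sg x \<odot> F)" "F \<in> Tr"
  shows "f F = g F"
proof -
  have "f (red F) = g (red F)"
  proof (rule lin_eq[OF assms(1) lin_compose[OF red_lin assms(2)] lin_compose[OF red_lin assms(3)]])
    show "f (red one) = g (red one)" by (simp add: lin_0[OF assms(2)] lin_0[OF assms(3)])
    show "F \<in> T" using assms(5) by (rule Tr_T)
    show "f (red (sg x \<odot> F)) = g (red (sg x \<odot> F))" if "x \<in> U" "F \<in> T" for x F
      using assms(4)[OF that] by simp
  qed
  then show ?thesis using assms(5) by simp
qed

lemma Tr_eq: "underlying (reduced_tensors V) = Tr"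
proof
  let ?S = "{pure V xs |xs ns. xs \<noteq> [] \<and> homog_word V xs ns}"
  have "?S \<subseteq> Tr"
  proof safe
    fix xs ns assume "xs \<noteq> []" "homog_word V xs ns"
    then show "pure V xs \<in> Tr"
      using homog_word_set[of xs ns] by (cases xs) (simp_all add: pure_Cons)
  qed
  moreover have "tens.subspace Tr" by (simp add: tens.subspace_def)
  ultimately show "underlying (reduced_tensors V) \<subseteq> Tr"
    unfolding underlying_reduced_tensors by (rule tens.span_minimal)
  have C: "sg x \<odot> F \<in> underlying (reduced_tensors V)" if "x \<in> U" "F \<in> T" for x F
    using that(2)
  proof (induction rule: T_span_induct)
    case (pure xs)
    then show ?case
      using that(1) pure_in_reduced_tensors[OF vector_space_axioms, of "x # xs"] by (simp add: pure_Cons)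
  qed (simp_all add: underlying_reduced_tensors tens.span_zero tens.span_add tens.span_scale)
  have "red F \<in> underlying (reduced_tensors V)" if "F \<in> T" for F
    using that
    by (induction rule: T_induct)
       (simp_all add: C, simp_all add: underlying_reduced_tensors tens.span_zero tens.span_add tens.span_scale)
  then show "Tr \<subseteq> underlying (reduced_tensors V)" using Tr_T red_id by (metis subsetI)
qed

end

section \<open>Bar and cobar constructions on letters with a sign operator\<close>

text \<open>
  In the application \<open>V\<close> is \<open>A\<^sub>+[1]\<close> and \<open>W\<close> is \<open>Bar(A\<^sub>+)[-1]\<close>. All Koszul signs are expressed through the
  operator \<open>\<sigma>\<close>, which is \<open>x \<mapsto> (-1)\<^bsup>|x|\<^esup> x\<close> on \<open>V\<close>, and its multiplicative extensions \<open>st\<close> and, with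
  the degree shift of \<open>W\<close>, \<open>s2\<close>.
\<close>

locale bar_cobar = I: tspace V + J: tspace W
  for V :: "('k::field, 'v::ab_group_add, 'm) gvs_scheme"
    and W :: "('k, ('k, 'v) tens, 'n) gvs_scheme" +
  fixes \<sigma> :: "'v \<Rightarrow> 'v"
  assumes scale_W: "scale W = tscale"
    and under_W: "underlying W = underlying (reduced_tensors V)"
    and \<sigma>_lin: "lin (scale V) (scale V) \<sigma>"
    and \<sigma>_U [simp]: "x \<in> underlying V \<Longrightarrow> \<sigma> x \<in> underlying V"
    and \<sigma>_\<sigma> [simp]: "x \<in> underlying V \<Longrightarrow> \<sigma> (\<sigma> x) = x"
begin

no_notation I.mul (infixl \<open>\<odot>\<close> 70)
no_notation J.mul (infixl \<open>\<odot>\<close> 70)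
notation I.mul (infixl \<open>\<odot>\<close> 70)
notation J.mul (infixl \<open>\<boxtimes>\<close> 70)

lemma JU [simp]: "c \<in> J.U \<longleftrightarrow> c \<in> I.Tr"
  by (simp add: under_W I.Tr_eq)

lemmas \<sigma>_simps [simp] = lin_simps[OF \<sigma>_lin]

lemma Jsg_lin: "lin tscale tscale J.sg"
  using J.sg_lin by (simp add: scale_W)

lemmas Jsg_simps [simp] = lin_simps[OF Jsg_lin]

definition st :: "('k, 'v) tens \<Rightarrow> ('k, 'v) tens" where "st = I.stt \<sigma>"

lemma st_lin: "lin tscale tscale st" and st_one [simp]: "st I.one = I.one"
  and st_pt [simp]: "st (I.pt F) = st F"
  and st_Cons [simp]: "x \<in> I.U \<Longrightarrow> F \<in> I.T \<Longrightarrow> st (I.sg x \<odot> F) = I.sg (\<sigma> x) \<odot> st F"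
  and st_sg [simp]: "x \<in> I.U \<Longrightarrow> st (I.sg x) = I.sg (\<sigma> x)"
  and st_T [simp]: "F \<in> I.T \<Longrightarrow> st F \<in> I.T"
  by (simp_all add: st_def I.stt I.stt_sg I.stt_T \<sigma>_lin)

lemmas st_simps [simp] = lin_simps[OF st_lin]

lemma st_st [simp]: "F \<in> I.T \<Longrightarrow> st (st F) = F"
  by (induction rule: I.T_induct) simp_all

lemma ctr_st [simp]: "F \<in> I.T \<Longrightarrow> I.ctr (st F) = I.ctr F"
  by (induction rule: I.T_induct) simp_all

lemma st_Tr [simp]: "F \<in> I.Tr \<Longrightarrow> st F \<in> I.Tr"
  by (simp add: I.Tr_def del: I.Tr_ctr)

definition mu :: "('v \<Rightarrow> 'v \<Rightarrow> 'v) \<Rightarrow> 'v \<Rightarrow> ('k, 'v) tens \<Rightarrow> ('k, 'v) tens" where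
  "mu m = I.tcase tscale (\<lambda>x y F. I.sg (m x y) \<odot> F)"

text \<open>The coderivation with components \<open>d\<close> and \<open>m\<close>: the operation
  takes place at the first letter, alone or multiplied with the next one, or it takes place later,
  where moving past \<open>x\<close> costs the sign \<open>\<sigma>\<close>.\<close>

definition coder :: "('v \<Rightarrow> 'v) \<Rightarrow> ('v \<Rightarrow> 'v \<Rightarrow> 'v) \<Rightarrow> ('k, 'v) tens \<Rightarrow> ('k, 'v) tens" where
  "coder d m = I.trec tscale 0 (\<lambda>x F. I.sg (d x) \<odot> F + mu m x F) (\<lambda>x F. I.sg (\<sigma> x) \<odot> F)"

definition ext :: "'v \<Rightarrow> ('k, ('k, 'v) tens) tens \<Rightarrow> ('k, ('k, 'v) tens) tens" where
  "ext = J.tcase tscale (\<lambda>x c G. J.sg (I.sg x \<odot> c) \<boxtimes> G)"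

text \<open>The cut is either right after the first letter or later, where \<open>ext\<close> puts
  \<open>x\<close> back into the left factor. \<open>red\<close> discards the cut with empty right
  factor, since the coproduct has no counit. The tensor square is modelled by length-two words of
  the cobar algebra, so that coproduct and cobar product live in the same space.\<close>

definition deconc :: "('k, 'v) tens \<Rightarrow> ('k, ('k, 'v) tens) tens" where
  "deconc = I.trec tscale 0 (\<lambda>x F. J.sg (I.sg x) \<boxtimes> J.sg (I.red F)) ext"

text \<open>The sign (-1)^|c'| of the cobar differential, acting on the left tensor factor.\<close>

definition ksig :: "('k, ('k, 'v) tens) tens \<Rightarrow> ('k, ('k, 'v) tens) tens" where
  "ksig = J.tcase tscale (\<lambda>_ c G. J.sg (st c) \<boxtimes> G) ()"

lemma ext_bilin: "bilin (scale V) tscale tscale ext"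
  and ext_one [simp]: "ext x J.one = 0"
  and ext_Cons [simp]: "c \<in> I.Tr \<Longrightarrow> G \<in> J.T \<Longrightarrow> ext x (J.sg c \<boxtimes> G) = J.sg (I.sg x \<odot> c) \<boxtimes> G"
proof -
  have 1: "bilin (scale W) tscale tscale (\<lambda>c G. J.sg (I.sg x \<odot> c) \<boxtimes> G)" for x
    by (simp add: scale_W bilin_def lin_def)
  have 2: "lin (scale V) tscale (\<lambda>x. J.sg (I.sg x \<odot> c) \<boxtimes> G)" for c G
    by (simp add: lin_def)
  note R = J.tcase[OF vector_space_tscale, where f = "\<lambda>x c G. J.sg (I.sg x \<odot> c) \<boxtimes> G", OF 1 2, folded ext_def]
  show "bilin (scale V) tscale tscale ext" "ext x J.one = 0"
    "c \<in> I.Tr \<Longrightarrow> G \<in> J.T \<Longrightarrow> ext x (J.sg c \<boxtimes> G) = J.sg (I.sg x \<odot> c) \<boxtimes> G"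
    by (rule R | simp add: R)+
qed

lemmas ext_simps [simp] = bilin_simps[OF ext_bilin]

lemma ext_sg [simp]: "c \<in> I.Tr \<Longrightarrow> ext x (J.sg c) = J.sg (I.sg x \<odot> c)"
  using ext_Cons[of c J.one x] by simp

lemma ksig_lin: "lin tscale tscale ksig"
  and ksig_one [simp]: "ksig J.one = 0"
  and ksig_Cons [simp]: "c \<in> I.Tr \<Longrightarrow> G \<in> J.T \<Longrightarrow> ksig (J.sg c \<boxtimes> G) = J.sg (st c) \<boxtimes> G"
proof -
  have 1: "bilin (scale W) tscale tscale (\<lambda>c G. J.sg (st c) \<boxtimes> G)"
    by (simp add: scale_W bilin_def lin_def)
  note R = J.trec[OF vector_space_tscale 1 J.bilin_zero[OF vector_space_tscale], where w = 0]
  show "lin tscale tscale ksig" "ksig J.one = 0"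
    "c \<in> I.Tr \<Longrightarrow> G \<in> J.T \<Longrightarrow> ksig (J.sg c \<boxtimes> G) = J.sg (st c) \<boxtimes> G"
    using R unfolding ksig_def J.tcase_def by simp_all
qed

lemmas ksig_simps [simp] = lin_simps[OF ksig_lin]

lemma deconc_lin: "lin tscale tscale deconc"
  and deconc_one [simp]: "deconc I.one = 0" and deconc_pt [simp]: "deconc (I.pt F) = deconc F"
  and deconc_Cons [simp]: "x \<in> I.U \<Longrightarrow> F \<in> I.T \<Longrightarrow> deconc (I.sg x \<odot> F) = J.sg (I.sg x) \<boxtimes> J.sg (I.red F) + ext x (deconc F)"
proof -
  have 1: "bilin (scale V) tscale tscale (\<lambda>x F. J.sg (I.sg x) \<boxtimes> J.sg (I.red F))"
    by (simp add: bilin_def lin_def)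
  note R = I.trec[OF vector_space_tscale 1 ext_bilin, where w = 0, folded deconc_def]
  show "lin tscale tscale deconc" "deconc I.one = 0" "deconc (I.pt F) = deconc F"
    "x \<in> I.U \<Longrightarrow> F \<in> I.T \<Longrightarrow> deconc (I.sg x \<odot> F) = J.sg (I.sg x) \<boxtimes> J.sg (I.red F) + ext x (deconc F)"
    by (rule R | simp add: R)+
qed

lemmas deconc_simps [simp] = lin_simps[OF deconc_lin]

lemma deconc_sg [simp]: "x \<in> I.U \<Longrightarrow> deconc (I.sg x) = 0"
  using deconc_Cons[of x I.one] by simp

text \<open>The tensor square of the bar construction inside the cobar algebra; identities between
  maps of coproducts are checked on its generators.\<close>

definition C2 :: "('k, ('k, 'v) tens) tens set" where
  "C2 = tens.span {J.sg c \<boxtimes> J.sg c' |c c'. c \<in> I.Tr \<and> c' \<in> I.Tr}"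

lemma C2_induct [consumes 1, case_names base zero add scale]:
  assumes "G \<in> C2" "\<And>c c'. c \<in> I.Tr \<Longrightarrow> c' \<in> I.Tr \<Longrightarrow> P (J.sg c \<boxtimes> J.sg c')" "P 0"
    "\<And>F G. P F \<Longrightarrow> P G \<Longrightarrow> P (F + G)" "\<And>c F. P F \<Longrightarrow> P (tscale c F)"
  shows "P G"
  using assms(1) unfolding C2_def by (induction rule: tens.span_induct_alt) (use assms(2-) in auto)

lemma C2_closed [simp]:
  "0 \<in> C2" "F \<in> C2 \<Longrightarrow> G \<in> C2 \<Longrightarrow> F + G \<in> C2" "F \<in> C2 \<Longrightarrow> tscale r F \<in> C2"
  "c \<in> I.Tr \<Longrightarrow> c' \<in> I.Tr \<Longrightarrow> J.sg c \<boxtimes> J.sg c' \<in> C2"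
  unfolding C2_def by (auto intro: tens.span_zero tens.span_add tens.span_scale tens.span_base)

lemma ext_C2 [simp]: "G \<in> C2 \<Longrightarrow> ext x G \<in> C2"
  by (induction rule: C2_induct) simp_all

lemma deconc_C2 [simp]: "F \<in> I.T \<Longrightarrow> deconc F \<in> C2"
  by (induction rule: I.T_induct) simp_all

lemma C2_T: "G \<in> C2 \<Longrightarrow> G \<in> J.T"
  by (induction rule: C2_induct) simp_all

end

section \<open>Coderivations of the bar construction with given components\<close>

locale bar_maps = bar_cobar V W \<sigma>
  for V :: "('k::field, 'v::ab_group_add, 'm) gvs_scheme"
    and W :: "('k, ('k, 'v) tens, 'n) gvs_scheme" and \<sigma> +
  fixes m1 :: "'v \<Rightarrow> 'v" and m2 :: "'v \<Rightarrow> 'v \<Rightarrow> 'v"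
  assumes m1_lin: "lin (scale V) (scale V) m1" and m2_bilin: "bilin (scale V) (scale V) (scale V) m2"
    and m1_U [simp]: "x \<in> underlying V \<Longrightarrow> m1 x \<in> underlying V"
    and m2_U [simp]: "x \<in> underlying V \<Longrightarrow> y \<in> underlying V \<Longrightarrow> m2 x y \<in> underlying V"
begin

lemmas m1_simps [simp] = lin_simps[OF m1_lin]
lemmas m2_simps [simp] = bilin_simps[OF m2_bilin]

abbreviation \<mu> :: "'v \<Rightarrow> ('k, 'v) tens \<Rightarrow> ('k, 'v) tens" where "\<mu> \<equiv> mu m2"
abbreviation b :: "('k, 'v) tens \<Rightarrow> ('k, 'v) tens" where "b \<equiv> coder m1 m2"

lemma \<mu>_bilin: "bilin (scale V) tscale tscale \<mu>"
  and \<mu>_one [simp]: "\<mu> x I.one = 0"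
  and \<mu>_Cons [simp]: "y \<in> I.U \<Longrightarrow> F \<in> I.T \<Longrightarrow> \<mu> x (I.sg y \<odot> F) = I.sg (m2 x y) \<odot> F"
proof -
  have 1: "bilin (scale V) tscale tscale (\<lambda>y F. I.sg (m2 x y) \<odot> F)" for x
    by (simp add: bilin_def lin_def)
  have 2: "lin (scale V) tscale (\<lambda>x. I.sg (m2 x y) \<odot> F)" for y F
    by (simp add: lin_def)
  note R = I.tcase[OF vector_space_tscale, where f = "\<lambda>x y F. I.sg (m2 x y) \<odot> F", OF 1 2, folded mu_def]
  show "bilin (scale V) tscale tscale \<mu>" "\<mu> x I.one = 0"
    "y \<in> I.U \<Longrightarrow> F \<in> I.T \<Longrightarrow> \<mu> x (I.sg y \<odot> F) = I.sg (m2 x y) \<odot> F"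
    by (rule R | simp add: R)+
qed

lemmas \<mu>_simps [simp] = bilin_simps[OF \<mu>_bilin]

lemma \<mu>_sg [simp]: "y \<in> I.U \<Longrightarrow> \<mu> x (I.sg y) = I.sg (m2 x y)"
  using \<mu>_Cons[of y I.one x] by simp

lemma \<mu>_Tr [simp]: "F \<in> I.T \<Longrightarrow> \<mu> x F \<in> I.Tr"
  by (induction rule: I.T_induct) simp_all

lemma \<mu>_T [simp]: "F \<in> I.T \<Longrightarrow> \<mu> x F \<in> I.T"
  by (rule I.Tr_T) simp

lemma b_lin: "lin tscale tscale b"
  and b_one [simp]: "b I.one = 0" and b_pt [simp]: "b (I.pt F) = b F"
  and b_Cons [simp]: "x \<in> I.U \<Longrightarrow> F \<in> I.T \<Longrightarrow> b (I.sg x \<odot> F) = I.sg (m1 x) \<odot> F + \<mu> x F + I.sg (\<sigma> x) \<odot> b F"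
proof -
  have 1: "bilin (scale V) tscale tscale (\<lambda>x F. I.sg (m1 x) \<odot> F + \<mu> x F)"
    by (simp add: bilin_def lin_def tens.scale_right_distrib algebra_simps)
  note R = I.trec[OF vector_space_tscale 1 I.bilin_sg[OF \<sigma>_lin], where w = 0, folded coder_def]
  show "lin tscale tscale b" "b I.one = 0" "b (I.pt F) = b F"
    "x \<in> I.U \<Longrightarrow> F \<in> I.T \<Longrightarrow> b (I.sg x \<odot> F) = I.sg (m1 x) \<odot> F + \<mu> x F + I.sg (\<sigma> x) \<odot> b F"
    by (rule R | simp add: R)+
qed

lemmas b_simps [simp] = lin_simps[OF b_lin]

lemma b_sg [simp]: "x \<in> I.U \<Longrightarrow> b (I.sg x) = I.sg (m1 x)"
  using b_Cons[of x I.one] by simp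

lemma b_Tr [simp]: "F \<in> I.T \<Longrightarrow> b F \<in> I.Tr"
  by (induction rule: I.T_induct) simp_all

lemma b_T [simp]: "F \<in> I.T \<Longrightarrow> b F \<in> I.T"
  by (rule I.Tr_T) simp

lemma b_red [simp]: "b (I.red F) = b F"
  by (simp add: I.red_def)

lemma \<mu>_red [simp]: "F \<in> I.T \<Longrightarrow> \<mu> x (I.red F) = \<mu> x F"
  by (simp add: I.red_def)

text \<open>On length two this is b tensor 1 plus 1 tensor b; the Koszul sign is that of the bar
  grading, hence \<open>st\<close> and not the sign of the desuspended generators.\<close>

definition cobar_b :: "('k, ('k, 'v) tens) tens \<Rightarrow> ('k, ('k, 'v) tens) tens" where
  "cobar_b = J.der st (\<lambda>c. J.sg (b c))"

lemma cobar_b_lin: "lin tscale tscale cobar_b"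
  and cobar_b_one [simp]: "cobar_b J.one = 0"
  and cobar_b_Cons [simp]: "c \<in> I.Tr \<Longrightarrow> G \<in> J.T \<Longrightarrow>
      cobar_b (J.sg c \<boxtimes> G) = J.sg (b c) \<boxtimes> G + J.sg (st c) \<boxtimes> cobar_b G"
  and cobar_b_sg [simp]: "c \<in> I.Tr \<Longrightarrow> cobar_b (J.sg c) = J.sg (b c)"
proof -
  have s: "lin (scale W) (scale W) st" using st_lin by (simp add: scale_W)
  have g: "lin (scale W) tscale (\<lambda>c. J.sg (b c))" by (simp add: scale_W lin_def)
  note R = J.der[OF s g, folded cobar_b_def] J.der_sg[OF s g, folded cobar_b_def]
  show "lin tscale tscale cobar_b" "cobar_b J.one = 0" 
    "c \<in> I.Tr \<Longrightarrow> G \<in> J.T \<Longrightarrow> cobar_b (J.sg c \<boxtimes> G) = J.sg (b c) \<boxtimes> G + J.sg (st c) \<boxtimes> cobar_b G"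
    "c \<in> I.Tr \<Longrightarrow> cobar_b (J.sg c) = J.sg (b c)"
    by (rule R | simp add: R)+
qed

lemmas cobar_b_simps [simp] = lin_simps[OF cobar_b_lin]

definition ext_mu :: "'v \<Rightarrow> ('k, ('k, 'v) tens) tens \<Rightarrow> ('k, ('k, 'v) tens) tens" where
  "ext_mu x = J.tcase tscale (\<lambda>_ c G. J.sg (\<mu> x c) \<boxtimes> G) ()"

lemma ext_mu_lin: "lin tscale tscale (ext_mu x)"
  and ext_mu_Cons [simp]: "c \<in> I.Tr \<Longrightarrow> G \<in> J.T \<Longrightarrow> ext_mu x (J.sg c \<boxtimes> G) = J.sg (\<mu> x c) \<boxtimes> G"
proof -
  have 1: "bilin (scale W) tscale tscale (\<lambda>c G. J.sg (\<mu> x c) \<boxtimes> G)"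
    by (simp add: scale_W bilin_def lin_def)
  note R = J.trec[OF vector_space_tscale 1 J.bilin_zero[OF vector_space_tscale], where w = 0]
  show "lin tscale tscale (ext_mu x)"
    "c \<in> I.Tr \<Longrightarrow> G \<in> J.T \<Longrightarrow> ext_mu x (J.sg c \<boxtimes> G) = J.sg (\<mu> x c) \<boxtimes> G"
    using R unfolding ext_mu_def J.tcase_def by simp_all
qed

lemmas ext_mu_simps [simp] = lin_simps[OF ext_mu_lin]

lemma ext_mu_ext: "G \<in> C2 \<Longrightarrow> y \<in> I.U \<Longrightarrow> ext_mu x (ext y G) = ext (m2 x y) G"
  by (induction rule: C2_induct) (simp_all add: I.Tr_T)

text \<open>All cuts lie behind the first letter, so multiplying \<open>x\<close> into it happens
  inside the left factor.\<close>

lemma ext_mu_deconc: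
  assumes "F \<in> I.T" "x \<in> I.U"
  shows "ext_mu x (deconc F) = deconc (\<mu> x F)"
  using assms(1)
proof (induction rule: I.T_induct)
  case (Cons y F)
  then show ?case using assms(2) by (simp add: ext_mu_ext)
qed simp_all

lemma cobar_b_ext:
  "G \<in> C2 \<Longrightarrow> x \<in> I.U \<Longrightarrow> cobar_b (ext x G) = ext (m1 x) G + ext_mu x G + ext (\<sigma> x) (cobar_b G)"
  by (induction rule: C2_induct) (simp_all add: I.Tr_T add_ac tens.scale_right_distrib)

text \<open>The coderivation property. In \<open>cobar_b_ext\<close> the only term that is not of
  recursive shape is the product of \<open>x\<close> with the left factor, and
  \<open>ext_mu_deconc\<close> matches it.\<close>

lemma deconc_b:
  assumes "F \<in> I.T"
  shows "deconc (b F) = cobar_b (deconc F)"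
  using assms
proof (induction rule: I.T_induct)
  case (Cons x F)
  then show ?case by (simp add: cobar_b_ext ext_mu_deconc add_ac I.Tr_T)
qed simp_all

end

section \<open>Signs on the cobar algebra and coassociativity\<close>

context bar_cobar
begin

text \<open>Turns a formula in \<open>c\<close> and \<open>c'\<close> into a well-defined linear map
  on length-two tensors. For a word, \<open>ctr\<close> of the remainder is 1 when nothing follows
  the second factor and 0 otherwise.\<close>

definition pairing ::
  "('k \<Rightarrow> 'w::ab_group_add \<Rightarrow> 'w) \<Rightarrow> (('k, 'v) tens \<Rightarrow> ('k, 'v) tens \<Rightarrow> 'w) \<Rightarrow> ('k, ('k, 'v) tens) tens \<Rightarrow> 'w"
  where "pairing s f = J.trec s 0 (J.tcase s (\<lambda>c c' G. s (J.ctr G) (f c c'))) (\<lambda>_ _. 0)"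

lemma pairing:
  assumes "vector_space s" "bilin tscale tscale s f"
  shows "lin tscale s (pairing s f)"
    and "c \<in> I.Tr \<Longrightarrow> c' \<in> I.Tr \<Longrightarrow> pairing s f (J.sg c \<boxtimes> J.sg c') = f c c'"
proof -
  interpret S: vector_space s by fact
  let ?g = "\<lambda>c c' G. s (J.ctr G) (f c c')"
  have 1: "bilin (scale W) tscale s (?g c)" for c
    by (simp add: scale_W bilin_def lin_def bilin_simps[OF assms(2)] S.scale_right_distrib S.scale_left_distrib mult.commute)
  have 2: "lin tscale s (\<lambda>c. ?g c c' G)" for c' G
    by (simp add: lin_def bilin_simps[OF assms(2)] S.scale_right_distrib mult.commute)
  note R = J.tcase[OF assms(1), where f = ?g, OF 1 2]
  have 3: "bilin (scale W) tscale s (J.tcase s ?g)" using R(1) by (simp add: scale_W)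
  note Q = J.trec[OF assms(1) 3 J.bilin_zero[OF assms(1)], where w = 0]
  have "J.tcase s ?g c (J.sg c') = f c c'" if "c' \<in> I.Tr" for c c'
    using R(3)[of c' J.one c] that by simp
  then show "lin tscale s (pairing s f)"
    "c \<in> I.Tr \<Longrightarrow> c' \<in> I.Tr \<Longrightarrow> pairing s f (J.sg c \<boxtimes> J.sg c') = f c c'"
    by (simp_all add: Q pairing_def)
qed

lemma ksig_T [simp]: "G \<in> C2 \<Longrightarrow> ksig G \<in> C2"
  by (induction rule: C2_induct) (simp_all add: I.Tr_T)

lemma ksig_ext: "G \<in> C2 \<Longrightarrow> x \<in> I.U \<Longrightarrow> ksig (ext x G) = ext (\<sigma> x) (ksig G)"
  by (induction rule: C2_induct) (simp_all add: I.Tr_T)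

text \<open>The sign operator of the grading of the cobar algebra; the minus comes from the degree
  shift of the generators.\<close>

definition s2 :: "('k, ('k, 'v) tens) tens \<Rightarrow> ('k, ('k, 'v) tens) tens" where
  "s2 = J.stt (\<lambda>c. - st c)"

lemma nst_lin: "lin (scale W) (scale W) (\<lambda>c. - st c)"
  by (simp add: scale_W lin_def)

lemma s2_lin: "lin tscale tscale s2" and s2_one [simp]: "s2 J.one = J.one"
  and s2_Cons [simp]: "c \<in> I.Tr \<Longrightarrow> G \<in> J.T \<Longrightarrow> s2 (J.sg c \<boxtimes> G) = - J.sg (st c) \<boxtimes> s2 G"
  and s2_sg [simp]: "c \<in> I.Tr \<Longrightarrow> s2 (J.sg c) = - J.sg (st c)"
  and s2_T [simp]: "G \<in> J.T \<Longrightarrow> s2 G \<in> J.T"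
  by (simp_all add: s2_def J.stt J.stt_sg J.stt_T nst_lin)

lemmas s2_simps [simp] = lin_simps[OF s2_lin]

lemma s2_ext: "G \<in> C2 \<Longrightarrow> x \<in> I.U \<Longrightarrow> s2 (ext x G) = ext (\<sigma> x) (s2 G)"
  by (induction rule: C2_induct) (simp_all add: I.Tr_T)

lemma s2_ksig: "G \<in> C2 \<Longrightarrow> s2 (ksig G) = ksig (s2 G)"
  by (induction rule: C2_induct) (simp_all add: I.Tr_T)

lemma st_red: "F \<in> I.T \<Longrightarrow> st (I.red F) = I.red (st F)"
  by (simp add: I.red_def)

lemma deconc_st:
  assumes "F \<in> I.T"
  shows "deconc (st F) = s2 (deconc F)"
  using assms
  by (induction rule: I.T_induct) (simp_all add: s2_ext st_red I.Tr_T)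

text \<open>Coassociativity, in the signed form in which it enters the square of the cobar differential.\<close>

lemma coassoc:
  assumes "lin tscale tscale Z"
    and Z: "\<And>c c'. c \<in> I.Tr \<Longrightarrow> c' \<in> I.Tr \<Longrightarrow>
      Z (J.sg c \<boxtimes> J.sg c') = J.sg c \<boxtimes> ksig (deconc c') - ksig (deconc (st c)) \<boxtimes> J.sg c'"
    and "F \<in> I.T"
  shows "Z (deconc F) = 0"
proof -
  note [simp] = lin_simps[OF assms(1)]
  have ext_mul: "ext x (G \<boxtimes> H) = ext x G \<boxtimes> H" if "G \<in> C2" "H \<in> J.T" for x G H
    using that by (induction rule: C2_induct) (simp_all add: J.mul_assoc)
  \<comment> \<open>Lengthening the left factor by \<open>x\<close> creates one new cut, right after
    \<open>x\<close>. This is the correction term; in the induction below it cancels the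
    contribution of the first summand of \<open>deconc\<close>.\<close>
  have Z_ext: "Z (ext x G) = ext x (Z G) - J.sg (I.sg x) \<boxtimes> ksig G" if "G \<in> C2" "x \<in> I.U" for x G
    using that
  proof (induction rule: C2_induct)
    case (base c c')
    then show ?case
      by (simp add: Z I.Tr_T ksig_ext ext_mul J.mul_assoc C2_T algebra_simps)
  qed (simp_all add: tens.scale_right_diff_distrib)
  show ?thesis
    using assms(3)
  proof (induction rule: I.T_induct)
    case (Cons x F)
    then have "deconc (I.red F) = deconc F" by (simp add: I.red_def)
    with Cons show ?case by (simp add: Z_ext Z)
  qed simp_all
qed

end

text \<open>
  In the application \<open>lam\<close> is the coefficient of \<open>\<xi>\<close>, \<open>m1 = b\<^sub>1 + lam(\<cdot>) 1\<^sub>A\<close> and \<open>m2 = b\<^sub>2\<close>; the product of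
  \<open>\<xi>\<close> with \<open>1\<^sub>A\<close> being zero does no harm, as \<open>lam x y - lam y x\<close> has no \<open>\<xi>\<close>-component.
\<close>

locale curved = bar_maps V W \<sigma> m1 m2
  for V :: "('k::field, 'v::ab_group_add, 'm) gvs_scheme"
    and W :: "('k, ('k, 'v) tens, 'n) gvs_scheme" and \<sigma> m1 m2 +
  fixes lam :: "'v \<Rightarrow> 'k"
  assumes lam_lin: "lin (scale V) (*) lam"
    and \<sigma>_m1: "x \<in> underlying V \<Longrightarrow> \<sigma> (m1 x) = - m1 (\<sigma> x)"
    and \<sigma>_m2: "x \<in> underlying V \<Longrightarrow> y \<in> underlying V \<Longrightarrow> \<sigma> (m2 x y) = - m2 (\<sigma> x) (\<sigma> y)"
    and m1_m1: "x \<in> underlying V \<Longrightarrow> m1 (m1 x) = 0"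
    and m1_m2: "x \<in> underlying V \<Longrightarrow> y \<in> underlying V \<Longrightarrow>
      m1 (m2 x y) = scale V (lam x) y - scale V (lam y) x - m2 (m1 x) y - m2 (\<sigma> x) (m1 y)"
    and m2_m2: "x \<in> underlying V \<Longrightarrow> y \<in> underlying V \<Longrightarrow> z \<in> underlying V \<Longrightarrow>
      m2 (\<sigma> x) (m2 y z) = - m2 (m2 x y) z"
    and lam_\<sigma> [simp]: "x \<in> underlying V \<Longrightarrow> lam (\<sigma> x) = lam x"
    and lam_m1 [simp]: "x \<in> underlying V \<Longrightarrow> lam (m1 x) = 0"
    and lam_m2 [simp]: "x \<in> underlying V \<Longrightarrow> y \<in> underlying V \<Longrightarrow> lam (m2 x y) = 0"
begin

section \<open>The curvature of the coderivation \<open>b\<close>\<close>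

lemmas lam_simps [simp] = lin_simps[OF lam_lin]

text \<open>\<open>lam\<close> on one-letter words and zero on all other lengths; in the application
  this is the constant 1 in the value of d_xi on xi.\<close>

definition eps :: "('k, 'v) tens \<Rightarrow> 'k" where
  "eps = I.trec (*) 0 (\<lambda>x F. lam x * I.ctr F) (\<lambda>_ _. 0)"

lemma eps_lin: "lin tscale (*) eps" and eps_one [simp]: "eps I.one = 0"
  and eps_Cons [simp]: "x \<in> I.U \<Longrightarrow> F \<in> I.T \<Longrightarrow> eps (I.sg x \<odot> F) = lam x * I.ctr F"
proof -
  have 1: "bilin (scale V) tscale (*) (\<lambda>x F. lam x * I.ctr F)"
    by (simp add: bilin_def lin_def algebra_simps)
  note R = I.trec[OF vector_space_mult 1 I.bilin_zero[OF vector_space_mult], where w = 0, folded eps_def]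
  show "lin tscale (*) eps" "eps I.one = 0"
    "x \<in> I.U \<Longrightarrow> F \<in> I.T \<Longrightarrow> eps (I.sg x \<odot> F) = lam x * I.ctr F"
    by (rule R | simp add: R)+
qed

lemmas eps_simps [simp] = lin_simps[OF eps_lin]

lemma eps_sg [simp]: "x \<in> I.U \<Longrightarrow> eps (I.sg x) = lam x"
  using eps_Cons[of x I.one] by simp

lemma eps_red [simp]: "F \<in> I.T \<Longrightarrow> eps (I.red F) = eps F"
  by (simp add: I.red_def)

lemma eps_st [simp]: "F \<in> I.T \<Longrightarrow> eps (st F) = eps F"
  by (induction rule: I.T_induct) simp_all

lemma eps_\<mu> [simp]: "F \<in> I.T \<Longrightarrow> x \<in> I.U \<Longrightarrow> eps (\<mu> x F) = 0"
  by (induction rule: I.T_induct) simp_all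

lemma ctr_b [simp]: "F \<in> I.T \<Longrightarrow> I.ctr (b F) = 0"
  by simp

lemma eps_b [simp]: "F \<in> I.T \<Longrightarrow> eps (b F) = 0"
  by (induction rule: I.T_induct) simp_all

definition strip_first :: "('k, 'v) tens \<Rightarrow> ('k, 'v) tens" where
  "strip_first = I.trec tscale 0 (\<lambda>x F. tscale (lam x) F) (\<lambda>_ _. 0)"

definition strip_last :: "('k, 'v) tens \<Rightarrow> ('k, 'v) tens" where
  "strip_last = I.trec tscale 0 (\<lambda>x F. tscale (I.ctr F * lam x) I.one) (\<lambda>x F. I.sg x \<odot> F)"

lemma strip_first_lin: "lin tscale tscale strip_first" and strip_first_one [simp]: "strip_first I.one = 0"
  and strip_first_Cons [simp]: "x \<in> I.U \<Longrightarrow> F \<in> I.T \<Longrightarrow> strip_first (I.sg x \<odot> F) = tscale (lam x) F"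
proof -
  have 1: "bilin (scale V) tscale tscale (\<lambda>x F. tscale (lam x) F)"
    by (simp add: bilin_def lin_def tens.scale_left_distrib tens.scale_right_distrib mult.commute)
  note R = I.trec[OF vector_space_tscale 1 I.bilin_zero[OF vector_space_tscale], where w = 0, folded strip_first_def]
  show "lin tscale tscale strip_first" "strip_first I.one = 0"
    "x \<in> I.U \<Longrightarrow> F \<in> I.T \<Longrightarrow> strip_first (I.sg x \<odot> F) = tscale (lam x) F"
    by (rule R | simp add: R)+
qed

lemma strip_last_lin: "lin tscale tscale strip_last" and strip_last_one [simp]: "strip_last I.one = 0"
  and strip_last_Cons [simp]: "x \<in> I.U \<Longrightarrow> F \<in> I.T \<Longrightarrow>
    strip_last (I.sg x \<odot> F) = tscale (I.ctr F * lam x) I.one + I.sg x \<odot> strip_last F"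
proof -
  have 1: "bilin (scale V) tscale tscale (\<lambda>x F. tscale (I.ctr F * lam x) I.one)"
    by (simp add: bilin_def lin_def tens.scale_left_distrib algebra_simps)
  have 2: "bilin (scale V) tscale tscale (\<lambda>x F. I.sg x \<odot> F)"
    by (simp add: bilin_def lin_def)
  note R = I.trec[OF vector_space_tscale 1 2, where w = 0, folded strip_last_def]
  show "lin tscale tscale strip_last" "strip_last I.one = 0"
    "x \<in> I.U \<Longrightarrow> F \<in> I.T \<Longrightarrow> strip_last (I.sg x \<odot> F) = tscale (I.ctr F * lam x) I.one + I.sg x \<odot> strip_last F"
    by (rule R | simp add: R)+
qed

lemmas strip_first_strip_last_simps [simp] = lin_simps[OF strip_first_lin] lin_simps[OF strip_last_lin]

lemma strip_first_T [simp]: "F \<in> I.T \<Longrightarrow> strip_first F \<in> I.T" and strip_last_T [simp]: "F \<in> I.T \<Longrightarrow> strip_last F \<in> I.T"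
  and ctr_strip_first [simp]: "F \<in> I.T \<Longrightarrow> I.ctr (strip_first F) = eps F"
  and ctr_strip_last [simp]: "F \<in> I.T \<Longrightarrow> I.ctr (strip_last F) = eps F"
  by (induction rule: I.T_induct; simp)+

lemma st_\<mu>: "F \<in> I.T \<Longrightarrow> x \<in> I.U \<Longrightarrow> st (\<mu> x F) = - \<mu> (\<sigma> x) (st F)"
  by (induction rule: I.T_induct) (simp_all add: \<sigma>_m2)

lemma st_b: "F \<in> I.T \<Longrightarrow> st (b F) = - b (st F)"
  by (induction rule: I.T_induct) (simp_all add: \<sigma>_m1 st_\<mu>)

lemma \<mu>_\<mu>: "F \<in> I.T \<Longrightarrow> x \<in> I.U \<Longrightarrow> y \<in> I.U \<Longrightarrow> \<mu> (\<sigma> x) (\<mu> y F) = - \<mu> (m2 x y) F"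
  by (induction rule: I.T_induct) (simp_all add: m2_m2)

text \<open>By \<open>m1_m2\<close>, \<open>b\<close> anticommutes with multiplication by
  \<open>x\<close> up to the components \<open>m1\<close> and \<open>\<sigma>\<close> and the
  curvature of \<open>x\<close> with the first letter of \<open>F\<close>. \<open>red\<close> keeps
  out the empty word, on which \<open>\<mu> x\<close> vanishes.\<close>

lemma b_\<mu>:
  "F \<in> I.T \<Longrightarrow> x \<in> I.U \<Longrightarrow>
    b (\<mu> x F) = tscale (lam x) (I.red F) - I.sg x \<odot> strip_first F - \<mu> (m1 x) F - \<mu> (\<sigma> x) (b F)"
  by (induction rule: I.T_induct)
     (simp_all add: m1_m2 \<sigma>_m2 \<mu>_\<mu> tens.scale_right_distrib tens.scale_right_diff_distrib mult.commute,
      (simp_all add: algebra_simps)?)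

text \<open>The square of \<open>b\<close> is the commutator with the curvature \<open>lam\<close>; the terms telescope.\<close>

lemma b_b:
  assumes "F \<in> I.T"
  shows "b (b F) = strip_first F - strip_last F"
  using assms
  by (induction rule: I.T_induct)
     (simp_all add: b_\<mu> m1_m1 \<sigma>_m1 I.red_def tens.scale_right_diff_distrib mult.commute)

text \<open>All three derivations on a generator at once: the substitution of 1_A for xi in d_xi
  carries the same minus sign as d_Bar, so both are absorbed in \<open>b\<close>, and only the
  constant 1 in d_xi(xi) remains, as \<open>eps\<close>.\<close>

definition dC_gen :: "('k, 'v) tens \<Rightarrow> ('k, ('k, 'v) tens) tens" where
  "dC_gen c = tscale (eps c) J.one - J.sg (b c) - ksig (deconc c)"

lemma dC_gen_lin: "lin tscale tscale dC_gen"
  by (simp add: lin_def dC_gen_def tens.scale_left_distrib tens.scale_right_diff_distrib algebra_simps)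

lemma dC_gen_T [simp]: "F \<in> I.T \<Longrightarrow> dC_gen F \<in> J.T"
  by (simp add: dC_gen_def C2_T)

lemmas dC_gen_simps [simp] = lin_simps[OF dC_gen_lin]

definition dC :: "('k, ('k, 'v) tens) tens \<Rightarrow> ('k, ('k, 'v) tens) tens" where
  "dC = J.der (\<lambda>c. - st c) dC_gen"

lemma dC_gen_lin': "lin (scale W) tscale dC_gen"
  using dC_gen_lin by (simp add: scale_W)

lemma dC_lin: "lin tscale tscale dC" and dC_one [simp]: "dC J.one = 0"
  and dC_Cons [simp]: "c \<in> I.Tr \<Longrightarrow> G \<in> J.T \<Longrightarrow> dC (J.sg c \<boxtimes> G) = dC_gen c \<boxtimes> G - J.sg (st c) \<boxtimes> dC G"
  and dC_sg [simp]: "c \<in> I.Tr \<Longrightarrow> dC (J.sg c) = dC_gen c"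
  and dC_T [simp]: "G \<in> J.T \<Longrightarrow> dC G \<in> J.T"
  by (simp_all add: dC_def J.der J.der_sg J.der_T nst_lin dC_gen_lin' I.Tr_T)

lemma dC_mul: "dC (F \<boxtimes> G) = dC F \<boxtimes> G + s2 F \<boxtimes> dC G"
  by (simp add: dC_def s2_def J.der_mul nst_lin dC_gen_lin')

lemmas dC_simps [simp] = lin_simps[OF dC_lin]

text \<open>\<open>eps\<close> sees only cuts that split off a single letter, so \<open>Yl\<close>
  strips the first and \<open>Yr\<close> the last letter of the word, and \<open>b_b\<close> is the
  difference. On one-letter words both strips give a multiple of the empty word, which no cut
  produces; the two multiples agree, so \<open>red\<close> does not change the difference.\<close>

lemma curvature:
  assumes "lin tscale tscale Yl" "lin tscale tscale Yr"
    and Yl: "\<And>c c'. c \<in> I.Tr \<Longrightarrow> c' \<in> I.Tr \<Longrightarrow> Yl (J.sg c \<boxtimes> J.sg c') = tscale (eps c) (J.sg c')"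
    and Yr: "\<And>c c'. c \<in> I.Tr \<Longrightarrow> c' \<in> I.Tr \<Longrightarrow> Yr (J.sg c \<boxtimes> J.sg c') = tscale (eps c') (J.sg c)"
    and "F \<in> I.T"
  shows "Yl (deconc F) - Yr (deconc F) = J.sg (b (b F))"
proof -
  note [simp] = lin_simps[OF assms(1)] lin_simps[OF assms(2)]
  have l: "Yl (ext x G) = 0" if "G \<in> C2" "x \<in> I.U" for x G
    using that by (induction rule: C2_induct) (simp_all add: Yl I.Tr_T)
  have r: "Yr (ext x G) = ext x (Yr G)" if "G \<in> C2" "x \<in> I.U" for x G
    using that by (induction rule: C2_induct) (simp_all add: Yr I.Tr_T)
  have "Yl (deconc F) = J.sg (I.red (strip_first F))"
    using assms(5) by (induction rule: I.T_induct) (simp_all add: Yl l)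
  moreover have "Yr (deconc F) = J.sg (I.red (strip_last F))"
    using assms(5)
  proof (induction rule: I.T_induct)
    case (Cons x F)
    then show ?case by (simp add: Yr r) (simp add: I.red_def)
  qed simp_all
  moreover have "I.red (strip_first F) - I.red (strip_last F) = b (b F)"
    using assms(5) by (simp add: b_b I.red_def)
  ultimately show ?thesis by (simp flip: Jsg_simps)
qed

text \<open>The terms of \<open>dC\<close> on a product of two generators, sorted by origin:
  \<open>cobar_b\<close> from the linear part of \<open>dC_gen\<close>, \<open>Z\<close> from the
  quadratic part, \<open>Yl\<close> and \<open>Yr\<close> from the constant part.\<close>

lemma dC_ksig:
  assumes "lin tscale tscale Z" "lin tscale tscale Yl" "lin tscale tscale Yr"
    and "\<And>c c'. c \<in> I.Tr \<Longrightarrow> c' \<in> I.Tr \<Longrightarrow>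
      Z (J.sg c \<boxtimes> J.sg c') = J.sg c \<boxtimes> ksig (deconc c') - ksig (deconc (st c)) \<boxtimes> J.sg c'"
    and "\<And>c c'. c \<in> I.Tr \<Longrightarrow> c' \<in> I.Tr \<Longrightarrow> Yl (J.sg c \<boxtimes> J.sg c') = tscale (eps c) (J.sg c')"
    and "\<And>c c'. c \<in> I.Tr \<Longrightarrow> c' \<in> I.Tr \<Longrightarrow> Yr (J.sg c \<boxtimes> J.sg c') = tscale (eps c') (J.sg c)"
    and "G \<in> C2"
  shows "dC (ksig G) = ksig (cobar_b G) + Z G + Yl G - Yr G"
  using assms(7)
proof (induction rule: C2_induct)
  case (base c c')
  then show ?case
    by (simp add: assms(4-6) dC_gen_def st_b I.Tr_T algebra_simps)
qed (simp_all add: assms(4-6) lin_simps[OF assms(1)] lin_simps[OF assms(2)] lin_simps[OF assms(3)]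
      tens.scale_right_distrib tens.scale_right_diff_distrib)

text \<open>The cancellations are sorted by cobar length: cubic terms vanish by
  \<open>coassoc\<close>, quadratic ones by \<open>deconc_b\<close>, linear ones because the
  constant part of \<open>dC_gen\<close> reproduces \<open>b (b F)\<close> by
  \<open>curvature\<close>, and constants by \<open>eps_b\<close>.\<close>

lemma dC_dC_gen:
  assumes "F \<in> I.T"
  shows "dC (dC_gen F) = 0"
proof -
  have Z: "bilin tscale tscale tscale (\<lambda>c c'. J.sg c \<boxtimes> ksig (deconc c') - ksig (deconc (st c)) \<boxtimes> J.sg c')"
    by (simp add: bilin_def lin_def tens.scale_right_diff_distrib)
  have Yl: "bilin tscale tscale tscale (\<lambda>c c'. tscale (eps c) (J.sg c'))"
    and Yr: "bilin tscale tscale tscale (\<lambda>c c'. tscale (eps c') (J.sg c))"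
    by (simp_all add: bilin_def lin_def tens.scale_left_distrib tens.scale_right_distrib mult.commute)
  note Z = pairing[OF vector_space_tscale Z] and Yl = pairing[OF vector_space_tscale Yl]
    and Yr = pairing[OF vector_space_tscale Yr]
  let ?Z = "pairing tscale (\<lambda>c c'. J.sg c \<boxtimes> ksig (deconc c') - ksig (deconc (st c)) \<boxtimes> J.sg c')"
  let ?Yl = "pairing tscale (\<lambda>c c'. tscale (eps c) (J.sg c'))"
  let ?Yr = "pairing tscale (\<lambda>c c'. tscale (eps c') (J.sg c))"
  have "dC (ksig (deconc F)) = ksig (cobar_b (deconc F)) + ?Z (deconc F) + ?Yl (deconc F) - ?Yr (deconc F)"
    by (rule dC_ksig[OF Z(1) Yl(1) Yr(1) Z(2) Yl(2) Yr(2) deconc_C2[OF assms]])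
  also have "\<dots> = ksig (deconc (b F)) + (?Yl (deconc F) - ?Yr (deconc F))"
    by (simp only: coassoc[OF Z assms] deconc_b[OF assms] add_0_right add_diff_eq)
  also have "\<dots> = ksig (deconc (b F)) + J.sg (b (b F))"
    by (simp only: curvature[OF Yl(1) Yr(1) Yl(2) Yr(2) assms])
  finally have "dC (ksig (deconc F)) = ksig (deconc (b F)) + J.sg (b (b F))" .
  moreover have "dC (J.sg (b F)) = - J.sg (b (b F)) - ksig (deconc (b F))"
    using assms by (simp add: dC_gen_def)
  moreover have "dC (dC_gen F) = - dC (J.sg (b F)) - dC (ksig (deconc F))"
    by (simp add: dC_gen_def[of F] del: dC_sg)
  ultimately show ?thesis by (simp del: dC_sg)
qed

text \<open>\<open>dC_gen\<close> is odd and the sign on generators is minus \<open>st\<close>, so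
  the two minus signs cancel.\<close>

lemma s2_dC_gen: "F \<in> I.T \<Longrightarrow> s2 (dC_gen F) = dC_gen (st F)"
  by (simp add: dC_gen_def deconc_st s2_ksig st_b)

lemma dC_dC:
  assumes "G \<in> J.T"
  shows "dC (dC G) = 0"
  using assms
proof (induction rule: J.T_induct)
  case (Cons c G)
  then have c: "c \<in> I.Tr" by simp
  with Cons show ?case
    by (simp add: dC_mul dC_dC_gen s2_dC_gen I.Tr_T)
qed simp_all

end

section \<open>The homotopy\<close>

locale curved_homotopy = curved V W \<sigma> m1 m2 lam
  for V :: "('k::field, 'v::ab_group_add, 'm) gvs_scheme"
    and W :: "('k, ('k, 'v) tens, 'n) gvs_scheme" and \<sigma> m1 m2 lam +
  fixes \<xi> :: 'v
  assumes \<xi>_U [simp]: "\<xi> \<in> underlying V" and lam_\<xi> [simp]: "lam \<xi> = 1"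
begin

text \<open>\<open>tpart V 1\<close> makes the map vanish on first factors with more than one
  letter. The minus and \<open>st\<close> are chosen so that it undoes the leading term
  \<open>- [\<sigma> x] \<boxtimes> [w]\<close> of the cobar differential of
  \<open>[x|w]\<close>.\<close>

definition homotopy_at :: "('k, 'v) tens \<Rightarrow> ('k, ('k, 'v) tens) tens \<Rightarrow> ('k, ('k, 'v) tens) tens" where
  "homotopy_at = J.tcase tscale (\<lambda>c c' G. - (J.sg (st (tpart V 1 c) \<odot> c') \<boxtimes> G))"

definition homotopy :: "('k, ('k, 'v) tens) tens \<Rightarrow> ('k, ('k, 'v) tens) tens" where
  "homotopy = J.trec tscale (J.sg (I.sg \<xi>)) homotopy_at (\<lambda>_ _. 0)"

lemmas tpart_simps [simp] = lin_simps[OF I.tpart_lin]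

lemma homotopy_at_bilin: "bilin tscale tscale tscale homotopy_at"
  and homotopy_at_one [simp]: "homotopy_at c J.one = 0"
  and homotopy_at_Cons [simp]: "c' \<in> I.Tr \<Longrightarrow> G \<in> J.T \<Longrightarrow>
    homotopy_at c (J.sg c' \<boxtimes> G) = - (J.sg (st (tpart V 1 c) \<odot> c') \<boxtimes> G)"
proof -
  have 1: "bilin (scale W) tscale tscale (\<lambda>c' G. - (J.sg (st (tpart V 1 c) \<odot> c') \<boxtimes> G))" for c
    by (simp add: scale_W bilin_def lin_def)
  have 2: "lin tscale tscale (\<lambda>c. - (J.sg (st (tpart V 1 c) \<odot> c') \<boxtimes> G))" for c' G
    by (simp add: lin_def)
  note R = J.tcase[OF vector_space_tscale,
      where f = "\<lambda>c c' G. - (J.sg (st (tpart V 1 c) \<odot> c') \<boxtimes> G)", OF 1 2, folded homotopy_at_def]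
  show "bilin tscale tscale tscale homotopy_at" "homotopy_at c J.one = 0"
    "c' \<in> I.Tr \<Longrightarrow> G \<in> J.T \<Longrightarrow> homotopy_at c (J.sg c' \<boxtimes> G) = - (J.sg (st (tpart V 1 c) \<odot> c') \<boxtimes> G)"
    by (rule R | simp add: R)+
qed

lemmas homotopy_at_simps [simp] = bilin_simps[OF homotopy_at_bilin]

lemma homotopy_at_sg [simp]: "c' \<in> I.Tr \<Longrightarrow> homotopy_at c (J.sg c') = - J.sg (st (tpart V 1 c) \<odot> c')"
  using homotopy_at_Cons[of c' J.one c] by simp

lemma homotopy_lin: "lin tscale tscale homotopy"
  and homotopy_one [simp]: "homotopy J.one = J.sg (I.sg \<xi>)"
  and homotopy_Cons [simp]: "c \<in> I.Tr \<Longrightarrow> G \<in> J.T \<Longrightarrow> homotopy (J.sg c \<boxtimes> G) = homotopy_at c G"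
proof -
  have 1: "bilin (scale W) tscale tscale homotopy_at" using homotopy_at_bilin by (simp add: scale_W)
  note R = J.trec[OF vector_space_tscale 1 J.bilin_zero[OF vector_space_tscale],
      where w = "J.sg (I.sg \<xi>)", folded homotopy_def]
  show "lin tscale tscale homotopy" "homotopy J.one = J.sg (I.sg \<xi>)"
    "c \<in> I.Tr \<Longrightarrow> G \<in> J.T \<Longrightarrow> homotopy (J.sg c \<boxtimes> G) = homotopy_at c G"
    by (rule R | simp add: R)+
qed

lemmas homotopy_simps [simp] = lin_simps[OF homotopy_lin]

lemma homotopy_sg [simp]: "c \<in> I.Tr \<Longrightarrow> homotopy (J.sg c) = 0"
  using homotopy_Cons[of c J.one] by simp

lemma homotopy_at_T [simp]: "G \<in> J.T \<Longrightarrow> homotopy_at c G \<in> J.T"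
  by (induction rule: J.T_induct) simp_all

lemma homotopy_T [simp]: "G \<in> J.T \<Longrightarrow> homotopy G \<in> J.T"
  by (induction rule: J.T_induct) simp_all

lemma homotopy_at_eq_0: "tpart V 1 c = 0 \<Longrightarrow> G \<in> J.T \<Longrightarrow> homotopy_at c G = 0"
  by (rotate_tac, induction rule: J.T_induct) simp_all

lemma tpart_sg [simp]: "x \<in> I.U \<Longrightarrow> tpart V (Suc 0) (I.sg x) = I.sg x"
  using I.tpart_Cons(2)[of x I.one 0] I.tpart_one[of 0] by simp

lemma tpart_0_Tr: "F \<in> I.Tr \<Longrightarrow> tpart V 0 F = 0"
  using I.red_eq[OF vector_space_tscale I.tpart_lin[of 0], of "\<lambda>_. 0" F]
  by (simp add: I.tpart_Cons lin_def)

lemma tpart_long [simp]: "x \<in> I.U \<Longrightarrow> F \<in> I.Tr \<Longrightarrow> tpart V (Suc 0) (I.sg x \<odot> F) = 0"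
  by (simp add: I.tpart_Cons I.Tr_T tpart_0_Tr)

lemma homotopy_at_long [simp]: "x \<in> I.U \<Longrightarrow> F \<in> I.Tr \<Longrightarrow> G \<in> J.T \<Longrightarrow> homotopy_at (I.sg x \<odot> F) G = 0"
  by (simp add: homotopy_at_eq_0)

text \<open>The first factor of \<open>ext x G\<close> has at least two letters.\<close>

lemma homotopy_at_ext:
  assumes "G \<in> C2" "x \<in> I.U" "H \<in> J.T"
  shows "homotopy (ext x G \<boxtimes> H) = 0"
  using assms by (induction rule: C2_induct) (simp_all add: J.mul_assoc)

lemma homotopy_at_sg_mul:
  assumes "G \<in> C2" "x \<in> I.U" "H \<in> J.T"
  shows "homotopy_at (I.sg x) (G \<boxtimes> H) = - (ext (\<sigma> x) G \<boxtimes> H)"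
  using assms by (induction rule: C2_induct) (simp_all add: J.mul_assoc)

definition defect :: "('k, ('k, 'v) tens) tens \<Rightarrow> ('k, ('k, 'v) tens) tens" where
  "defect z = z - dC (homotopy z) - homotopy (dC z)"

lemma defect_lin: "lin tscale tscale defect"
  by (simp add: defect_def lin_def tens.scale_right_diff_distrib algebra_simps)

lemmas defect_simps [simp] = lin_simps[OF defect_lin]

lemma dC_gen_sg [simp]: "x \<in> I.U \<Longrightarrow> dC_gen (I.sg x) = tscale (lam x) J.one - J.sg (I.sg (m1 x))"
  by (simp add: dC_gen_def)

lemma defect_one: "defect J.one = J.sg (I.sg (m1 \<xi>))"
  by (simp add: defect_def)

lemma defect_letter: "x \<in> I.U \<Longrightarrow> defect (J.sg (I.sg x)) = J.sg (I.sg (x - scale V (lam x) \<xi>))"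
  by (simp add: defect_def)

lemma dC_gen_Cons: "x \<in> I.U \<Longrightarrow> c \<in> I.Tr \<Longrightarrow>
  dC_gen (I.sg x \<odot> c) = - J.sg (I.sg (m1 x) \<odot> c) - J.sg (\<mu> x c) - J.sg (I.sg (\<sigma> x) \<odot> b c)
    - J.sg (I.sg (\<sigma> x)) \<boxtimes> J.sg c - ext (\<sigma> x) (ksig (deconc c))"
  by (simp add: dC_gen_def I.Tr_T ksig_ext)

text \<open>\<open>homotopy\<close> kills the argument itself, and \<open>homotopy\<close> of its
  differential reproduces it through the cut after \<open>x\<close>. The other terms of the
  differential begin with a long word, except for the product \<open>\<mu> x c\<close>, which may be
  a single letter.\<close>

lemma defect_long:
  assumes "x \<in> I.U" "c \<in> I.Tr" "G \<in> J.T"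
  shows "defect (J.sg (I.sg x \<odot> c) \<boxtimes> G) = homotopy (J.sg (\<mu> x c) \<boxtimes> G)"
  using assms by (simp add: defect_def dC_gen_Cons I.Tr_T J.mul_assoc homotopy_at_ext)

text \<open>Here it is \<open>dC\<close> of \<open>homotopy\<close> that reproduces the argument, by
  cutting the joined word again. The terms inside \<open>c\<close> and \<open>G\<close> cancel in
  pairs, and so do those with \<open>m1 x\<close>, by \<open>\<sigma>_m1\<close>. What survives has
  lost a letter through a product, or through \<open>lam x\<close> or \<open>eps c\<close>.\<close>

lemma defect_short:
  assumes "x \<in> I.U" "c \<in> I.Tr" "G \<in> J.T"
  shows "defect (J.sg (I.sg x) \<boxtimes> (J.sg c \<boxtimes> G)) =
    - (J.sg (\<mu> (\<sigma> x) c) \<boxtimes> G) - tscale (lam x) (homotopy (J.sg c \<boxtimes> G)) + tscale (eps c) (homotopy (J.sg (I.sg (\<sigma> x)) \<boxtimes> G))"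
  using assms
  apply (simp add: defect_def dC_gen_Cons I.Tr_T J.mul_assoc homotopy_at_ext \<sigma>_m1)
  apply (simp add: dC_gen_def I.Tr_T homotopy_at_sg_mul J.mul_assoc)
  done

subsection \<open>Filtration by the number of letters\<close>

definition tword :: "'v list list \<Rightarrow> ('k, ('k, 'v) tens) tens" where
  "tword ws = foldr (\<lambda>w G. J.sg (pure V w) \<boxtimes> G) ws J.one"

definition valid :: "'v list list \<Rightarrow> bool" where
  "valid ws \<longleftrightarrow> (\<forall>w\<in>set ws. w \<noteq> [] \<and> set w \<subseteq> I.U)"

definition letters :: "'v list list \<Rightarrow> nat" where
  "letters ws = sum_list (map length ws)"

definition Fil :: "nat \<Rightarrow> ('k, ('k, 'v) tens) tens set" where
  "Fil N = tens.span {tword ws |ws. valid ws \<and> letters ws \<le> N}"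

lemma tword_simps [simp]: "tword [] = J.one" "tword (w # ws) = J.sg (pure V w) \<boxtimes> tword ws"
  and letters_simps [simp]: "letters [] = 0" "letters (w # ws) = length w + letters ws"
  and valid_simps [simp]: "valid []" "valid (w # ws) \<longleftrightarrow> w \<noteq> [] \<and> set w \<subseteq> I.U \<and> valid ws"
  by (auto simp: tword_def letters_def valid_def)

declare I.pure_Tr [simp]

lemma tword_T [simp]: "valid ws \<Longrightarrow> tword ws \<in> J.T"
  by (cases ws) simp_all

lemma Fil_closed [simp]:
  "0 \<in> Fil N" "F \<in> Fil N \<Longrightarrow> G \<in> Fil N \<Longrightarrow> F + G \<in> Fil N" "F \<in> Fil N \<Longrightarrow> G \<in> Fil N \<Longrightarrow> F - G \<in> Fil N"
  "F \<in> Fil N \<Longrightarrow> tscale r F \<in> Fil N" "F \<in> Fil N \<Longrightarrow> - F \<in> Fil N"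
  unfolding Fil_def
  by (auto intro: tens.span_zero tens.span_add tens.span_diff tens.span_scale tens.span_neg)

lemma tword_Fil: "valid ws \<Longrightarrow> letters ws \<le> N \<Longrightarrow> tword ws \<in> Fil N"
  unfolding Fil_def by (rule tens.span_base) auto

lemma Fil_mono: "M \<le> N \<Longrightarrow> F \<in> Fil M \<Longrightarrow> F \<in> Fil N"
  unfolding Fil_def by (rule tens.span_mono[THEN subsetD]) auto

lemma Fil_induct [consumes 1, case_names tword zero add scale]:
  assumes "F \<in> Fil N" "\<And>ws. valid ws \<Longrightarrow> letters ws \<le> N \<Longrightarrow> P (tword ws)" "P 0"
    "\<And>F G. P F \<Longrightarrow> P G \<Longrightarrow> P (F + G)" "\<And>c F. P F \<Longrightarrow> P (tscale c F)"
  shows "P F"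
  using assms(1) unfolding Fil_def by (induction rule: tens.span_induct_alt) (use assms(2-) in auto)

lemma letters_le_1: "valid ws \<Longrightarrow> letters ws \<le> Suc 0 \<Longrightarrow> ws = [] \<or> (\<exists>x\<in>I.U. ws = [[x]])"
  by (cases ws; cases "hd ws"; cases "tl ws") (auto simp: neq_Nil_conv)

text \<open>Joining two words keeps the number of letters. The empty product is excluded because its
  image has one letter more.\<close>

lemma homotopy_tword:
  assumes "valid ws" "ws \<noteq> []"
  shows "homotopy (tword ws) \<in> Fil (letters ws)"
proof -
  obtain x w ws' where ws: "ws = (x # w) # ws'" using assms by (metis neq_Nil_conv valid_simps(2))
  show ?thesis
  proof (cases "w = []")
    case False
    then show ?thesis using assms by (simp add: ws I.pure_Cons)
  next
    case True
    show ?thesis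
    proof (cases ws')
      case (Cons w' ws'')
      have "- tword ((\<sigma> x # w') # ws'') \<in> Fil (letters ws)"
        using assms by (intro Fil_closed tword_Fil) (auto simp: ws Cons True)
      then show ?thesis using assms by (simp add: ws Cons True I.pure_Cons)
    qed (use assms True in \<open>simp add: ws I.pure_Cons\<close>)
  qed
qed

text \<open>Each term in \<open>defect_long\<close> and \<open>defect_short\<close> has merged two
  letters or replaced one by a scalar, and \<open>homotopy\<close> adds none because it is applied
  to nonempty products.\<close>

lemma defect_tword:
  assumes "valid ws" "2 \<le> letters ws"
  shows "defect (tword ws) \<in> Fil (letters ws - 1)"
proof -
  obtain x w ws' where ws: "ws = (x # w) # ws'"
    using assms by (cases ws; cases "hd ws") simp_all
  have x: "x \<in> I.U" "set w \<subseteq> I.U" "valid ws'" using assms by (auto simp: ws)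
  show ?thesis
  proof (cases w)
    case (Cons y w')
    have "defect (tword ws) = homotopy (J.sg (\<mu> x (pure V w)) \<boxtimes> tword ws')"
      using x by (simp add: ws Cons I.pure_Cons defect_long)
    also have "\<mu> x (pure V w) = pure V (m2 x y # w')"
      using x by (simp add: Cons I.pure_Cons I.pure_T)
    also have "homotopy (J.sg (pure V (m2 x y # w')) \<boxtimes> tword ws') \<in> Fil (letters ws - 1)"
      using homotopy_tword[of "(m2 x y # w') # ws'"] x by (simp add: ws Cons)
    finally show ?thesis .
  next
    case Nil
    then obtain y w' ws'' where ws': "ws' = (y # w') # ws''"
      using assms by (cases ws'; cases "hd ws'") (simp_all add: ws)
    have y: "y \<in> I.U" "set w' \<subseteq> I.U" "valid ws''" using x by (auto simp: ws')
    let ?c = "pure V (y # w')"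
    have "defect (tword ws) = - (J.sg (\<mu> (\<sigma> x) ?c) \<boxtimes> tword ws'') - tscale (lam x) (homotopy (tword ws'))
        + tscale (eps ?c) (homotopy (J.sg (I.sg (\<sigma> x)) \<boxtimes> tword ws''))"
    proof -
      have "tword ws = J.sg (I.sg x) \<boxtimes> (J.sg ?c \<boxtimes> tword ws'')" "tword ws' = J.sg ?c \<boxtimes> tword ws''"
        using x(1) by (simp_all add: ws ws' Nil I.sg_eq)
      moreover have "?c \<in> I.Tr" "tword ws'' \<in> J.T" using y by simp_all
      ultimately show ?thesis by (simp only: defect_short[OF x(1)])
    qed
    moreover have "J.sg (\<mu> (\<sigma> x) ?c) \<boxtimes> tword ws'' \<in> Fil (letters ws - 1)"
      using tword_Fil[of "(m2 (\<sigma> x) y # w') # ws''" "letters ws - 1"] x y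
      by (simp add: ws ws' Nil I.pure_Cons I.pure_T)
    moreover have "homotopy (tword ws') \<in> Fil (letters ws - 1)"
      using homotopy_tword[of ws'] x by (simp add: ws ws' Nil)
    moreover have "homotopy (J.sg (I.sg (\<sigma> x)) \<boxtimes> tword ws'') \<in> Fil (letters ws - 1)"
      by (rule Fil_mono[of "Suc (letters ws'')"])
         (use homotopy_tword[of "[\<sigma> x] # ws''"] x y in \<open>simp_all add: ws ws' Nil I.pure_Cons\<close>)
    ultimately show ?thesis by simp
  qed
qed

text \<open>\<open>f\<close> stands for \<open>p\<close> followed by the inclusion of
  \<open>A\<close>, which cannot be formed in this locale; the two prescribed values turn the unit
  into the letter 1_A and drop the xi-component of a letter.\<close>

lemma defect_Fil_1:
  assumes "lin tscale tscale f" "f J.one = J.sg (I.sg (m1 \<xi>))"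
    "\<And>x. x \<in> I.U \<Longrightarrow> f (J.sg (I.sg x)) = J.sg (I.sg (x - scale V (lam x) \<xi>))"
    "z \<in> Fil (Suc 0)"
  shows "defect z = f z"
  using assms(4)
proof (induction rule: Fil_induct)
  case (tword ws)
  with letters_le_1[of ws] show ?case
    by (auto simp: defect_one defect_letter assms(2,3) simp flip: I.sg_eq)
qed (simp_all add: lin_simps[OF assms(1)])

text \<open>The empty product goes to the one-letter word \<open>[m1 \<xi>]\<close>, so the descent
  stops at one letter; hence the bound \<open>Suc N\<close>.\<close>

lemma defect_Fil:
  assumes "z \<in> Fil (Suc (Suc N))"
  shows "defect z \<in> Fil (Suc N)"
  using assms
proof (induction rule: Fil_induct)
  case (tword ws)
  show ?case
  proof (cases "2 \<le> letters ws")
    case True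
    from tword(2) show ?thesis by (intro Fil_mono[OF _ defect_tword[OF tword(1) True]]) auto
  next
    case False
    then consider "ws = []" | x where "x \<in> I.U" "ws = [[x]]"
      using letters_le_1[OF tword(1)] by force
    then have "defect (tword ws) \<in> Fil (Suc 0)"
    proof cases
      case 1
      then show ?thesis using tword_Fil[of "[[m1 \<xi>]]" "Suc 0"] by (simp add: defect_one I.sg_eq)
    next
      case (2 x)
      then have "defect (tword ws) = tword [[x - scale V (lam x) \<xi>]]"
        using defect_letter[OF 2(1)] by (simp only: tword_simps) (simp add: I.sg_eq del: I.sg_simps)
      with 2 show ?thesis by (simp only:) (rule tword_Fil, simp_all)
    qed
    then show ?thesis by (rule Fil_mono[rotated]) simp
  qed
qed simp_all

lemma Fil_Cons: "G \<in> Fil N \<Longrightarrow> w \<noteq> [] \<Longrightarrow> set w \<subseteq> I.U \<Longrightarrow> J.sg (pure V w) \<boxtimes> G \<in> Fil (length w + N)"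
proof (induction rule: Fil_induct)
  case (tword ws)
  then show ?case using tword_Fil[of "w # ws" "length w + N"] by simp
qed simp_all

lemma Fil_exists: "G \<in> J.T \<Longrightarrow> \<exists>N. G \<in> Fil N"
proof (induction rule: J.T_induct)
  case one
  then show ?case using tword_Fil[of "[]" 0] by auto
next
  case (Cons c G)
  then obtain N where N: "G \<in> Fil N" by blast
  \<comment> \<open>The induction runs over all words, including the empty one, which
    \<open>red\<close> sends to 0.\<close>
  have "\<exists>M. J.sg (I.red F) \<boxtimes> G \<in> Fil M" if "F \<in> I.T" for F
    using that
  proof (induction rule: I.T_span_induct)
    case (pure w)
    show ?case
    proof (cases "w = []")
      case False
      then show ?thesis using Fil_Cons[OF N False pure] pure by auto
    qed (auto intro: exI[of _ 0])
  next
    case (add F F')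
    then obtain M M' where "J.sg (I.red F) \<boxtimes> G \<in> Fil M" "J.sg (I.red F') \<boxtimes> G \<in> Fil M'" by blast
    then have "J.sg (I.red F) \<boxtimes> G \<in> Fil (max M M')" "J.sg (I.red F') \<boxtimes> G \<in> Fil (max M M')"
      by (auto intro: Fil_mono[rotated])
    then show ?case by (intro exI[of _ "max M M'"]) simp
  next
    case (scale r F)
    then show ?case by (auto intro: Fil_closed)
  qed (auto intro: exI[of _ 0])
  from this[of c] Cons show ?case by (simp add: I.Tr_T)
next
  case (add F F')
  then obtain M M' where "F \<in> Fil M" "F' \<in> Fil M'" by blast
  then have "F \<in> Fil (max M M')" "F' \<in> Fil (max M M')" by (auto intro: Fil_mono[rotated])
  then show ?case by (intro exI[of _ "max M M'"]) simp
next
  case (scale r F)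
  then show ?case by (auto intro: Fil_closed)
qed (auto intro: exI[of _ 0])

end

section \<open>Gradings\<close>

context graded_space
begin

lemma homog_closed [simp]:
  "0 \<in> homog V n" "x \<in> homog V n \<Longrightarrow> y \<in> homog V n \<Longrightarrow> x + y \<in> homog V n"
  "x \<in> homog V n \<Longrightarrow> y \<in> homog V n \<Longrightarrow> x - y \<in> homog V n"
  "x \<in> homog V n \<Longrightarrow> scale V c x \<in> homog V n" "x \<in> homog V n \<Longrightarrow> - x \<in> homog V n"
  using subspace_homog[of n]
  by (simp_all add: subspace_0 subspace_add subspace_diff subspace_scale subspace_neg)

text \<open>Bases of the homogeneous parts are jointly independent because the parts are, so the
  maps \<open>f n\<close> can be prescribed on them separately.\<close>

lemma graded_extend:
  assumes "vector_space t" "\<And>n. lin (scale V) t (f n)"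
  shows "\<exists>L. lin (scale V) t L \<and> (\<forall>n. \<forall>x\<in>homog V n. L x = f n x)"
proof -
  interpret W: vector_space t by fact
  interpret P: vector_space_pair "scale V" t ..
  have "\<forall>n. \<exists>B. B \<subseteq> homog V n \<and> independent B \<and> homog V n \<subseteq> span B"
    by (meson maximal_independent_subset)
  then obtain B where B: "\<And>n. B n \<subseteq> homog V n" "\<And>n. independent (B n)" "\<And>n. homog V n \<subseteq> span (B n)"
    by metis
  define dg where "dg v = (SOME n. v \<in> B n)" for v
  have dg: "v \<in> B (dg v)" if "v \<in> (\<Union>n. B n)" for v
    using that unfolding dg_def by (metis UN_iff someI_ex)
  have indep: "independent (\<Union>n. B n)"
    unfolding dependent_explicit
  proof safe
    fix S u v assume S: "finite S" "S \<subseteq> (\<Union>n. B n)" "(\<Sum>v\<in>S. scale V (u v) v) = 0" "v \<in> S" "u v \<noteq> 0"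
    define F where "F n = (\<Sum>v\<in>{v \<in> S. dg v = n}. scale V (u v) v)" for n
    have sub: "{v \<in> S. dg v = n} \<subseteq> B n" for n using dg S(2) by blast
    have "F n \<in> homog V n" for n
      unfolding F_def using sub B(1)
      by (intro subspace_sum[OF subspace_homog] subspace_scale[OF subspace_homog]) blast
    moreover have "(\<Sum>n\<in>dg ` S. F n) = 0"
      unfolding F_def using sum.group[OF S(1) finite_imageI[OF S(1)], where g = dg and h = "\<lambda>v. scale V (u v) v"] S(3) by auto
    ultimately have "F (dg v) = 0"
      using S(1,4) by (intro independent_homog[of "dg ` S" F]) auto
    then have "dependent (B (dg v))"
      unfolding dependent_explicit F_def using S(1,4,5) sub
      by (intro exI[of _ "{w \<in> S. dg w = dg v}"] exI[of _ u]) auto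
    then show False using B(2) by blast
  qed
  define L where "L = P.construct (\<Union>n. B n) (\<lambda>v. f (dg v) v)"
  have L: "lin (scale V) t L"
    unfolding L_def using P.linear_construct[OF indep] by (simp add: linear_iff_lin)
  have LB: "L v = f n v" if "v \<in> B n" for v n
  proof (cases "v = 0")
    case True
    then show ?thesis by (simp add: lin_0[OF L] lin_0[OF assms(2)])
  next
    case False
    have "dg v = n"
    proof (rule ccontr)
      assume ne: "dg v \<noteq> n"
      have v: "v \<in> homog V n" "v \<in> homog V (dg v)" using that dg[of v] B(1) by blast+
      have "(if n = n then v else - v) = 0"
        using ne v by (intro independent_homog[of "{n, dg v}" "\<lambda>i. if i = n then v else - v" n]) auto
      with False show False by simp
    qed
    then show ?thesis unfolding L_def using P.construct_basis[OF indep, of v] that by auto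
  qed
  have "L x = f n x" if "x \<in> homog V n" for x n
    by (rule lin_eq_on_span[OF vector_space_axioms L assms(2) LB assms(1)]) (use that B(3) in auto)
  with L show ?thesis by blast
qed

end

section \<open>The grading of the tensor algebra\<close>

locale graded_tspace = graded_space V + tspace V for V :: "('k::field, 'v::ab_group_add, 'm) gvs_scheme"
begin

abbreviation TH :: "int \<Rightarrow> ('k, 'v) tens set" where
  "TH \<equiv> homog (tensor_algebra V)"

lemma TH_def: "TH m = tens.span {pure V xs |xs ns. homog_word V xs ns \<and> sum_list ns = m}"
  by (simp add: tensor_algebra_def)

lemma TH_closed [simp]:
  "0 \<in> TH n" "F \<in> TH n \<Longrightarrow> G \<in> TH n \<Longrightarrow> F + G \<in> TH n" "F \<in> TH n \<Longrightarrow> G \<in> TH n \<Longrightarrow> F - G \<in> TH n"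
  "F \<in> TH n \<Longrightarrow> tscale c F \<in> TH n" "F \<in> TH n \<Longrightarrow> - F \<in> TH n"
  unfolding TH_def
  by (auto intro: tens.span_zero tens.span_add tens.span_diff tens.span_scale tens.span_neg)

lemma pure_TH: "homog_word V xs ns \<Longrightarrow> pure V xs \<in> TH (sum_list ns)"
  unfolding TH_def by (rule tens.span_base) auto

lemma one_TH [simp]: "one \<in> TH 0"
  using pure_TH[of "[]" "[]"] by (simp add: homog_word_def)

lemma TH_span_induct [consumes 1, case_names pure zero add scale]:
  assumes "F \<in> TH m" "\<And>xs ns. homog_word V xs ns \<Longrightarrow> sum_list ns = m \<Longrightarrow> P (pure V xs)" "P 0"
    "\<And>F G. P F \<Longrightarrow> P G \<Longrightarrow> P (F + G)" "\<And>c F. P F \<Longrightarrow> P (tscale c F)"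
  shows "P F"
  using assms(1) unfolding TH_def by (induction rule: tens.span_induct_alt) (use assms(2-) in auto)

lemma TH_T: "F \<in> TH m \<Longrightarrow> F \<in> T"
  by (induction rule: TH_span_induct) (simp_all add: pure_T homog_word_set)

lemma mul_TH: "F \<in> TH m \<Longrightarrow> G \<in> TH n \<Longrightarrow> F \<odot> G \<in> TH (m + n)"
proof (induction F rule: TH_span_induct)
  case (pure xs ns)
  from pure(3,1,2) show ?case
  proof (induction G rule: TH_span_induct)
    case (pure ys ns')
    then have "homog_word V (xs @ ys) (ns @ ns')" by (simp add: homog_word_def list_all2_appendI)
    from pure_TH[OF this] pure show ?case by (simp add: mul_pure homog_word_set)
  qed simp_all
qed simp_all

lemma sg_TH: "x \<in> homog V n \<Longrightarrow> sg x \<in> TH n"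
  using pure_TH[of "[x]" "[n]"] by (simp add: homog_word_def sg_eq homog_U)

lemma TH_induct [consumes 1, case_names one Cons zero add scale]:
  assumes "F \<in> TH m" "P 0 one"
    "\<And>x n F m. x \<in> homog V n \<Longrightarrow> F \<in> TH m \<Longrightarrow> P m F \<Longrightarrow> P (n + m) (sg x \<odot> F)"
    "\<And>m. P m 0" "\<And>m F G. P m F \<Longrightarrow> P m G \<Longrightarrow> P m (F + G)" "\<And>m c F. P m F \<Longrightarrow> P m (tscale c F)"
  shows "P m F"
  using assms(1)
proof (induction rule: TH_span_induct)
  case (pure xs ns)
  then show ?case
  proof (induction xs arbitrary: ns m)
    case Nil
    then show ?case using assms(2) by (simp add: homog_word_def)
  next
    case (Cons x xs)
    then obtain n ns' where ns: "ns = n # ns'" "x \<in> homog V n" "homog_word V xs ns'"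
      by (auto simp: homog_word_def list_all2_Cons1)
    have "P (n + sum_list ns') (sg x \<odot> pure V xs)"
      using assms(3)[OF ns(2) pure_TH[OF ns(3)]] Cons.IH[OF ns(3) refl] by blast
    then show ?case using Cons ns by (simp add: pure_Cons homog_U homog_word_set)
  qed
qed (use assms(4-6) in auto)

lemma stt_TH:
  assumes "lin (scale V) (scale V) \<sigma>" "\<And>n x. x \<in> homog V n \<Longrightarrow> \<sigma> x = scale V ((-1) powi n) x" "F \<in> TH m"
  shows "stt \<sigma> F = tscale ((-1) powi m) F"
  using assms(3)
proof (induction rule: TH_induct)
  case (Cons x n F m)
  then show ?case
    by (simp add: stt(4)[OF assms(1)] homog_U TH_T assms(2) power_int_add)
qed (simp_all add: stt[OF assms(1)] lin_simps[OF stt(1)[OF assms(1)]] tens.scale_right_distrib mult.commute)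

lemma der_TH:
  assumes "lin (scale V) (scale V) \<sigma>" "lin (scale V) tscale g"
    and "\<And>n x. x \<in> homog V n \<Longrightarrow> \<sigma> x \<in> homog V n" "\<And>n x. x \<in> homog V n \<Longrightarrow> g x \<in> TH (n + 1)"
    and "F \<in> TH m"
  shows "der \<sigma> g F \<in> TH (m + 1)"
  using assms(5)
proof (induction rule: TH_induct)
  case (Cons x n F m)
  then have "g x \<odot> F \<in> TH (n + 1 + m)" "sg (\<sigma> x) \<odot> der \<sigma> g F \<in> TH (n + (m + 1))"
    using assms(3,4) by (auto intro!: mul_TH sg_TH)
  then show ?case using Cons by (simp add: der(4)[OF assms(1,2)] homog_U TH_T add_ac)
qed (simp_all add: der[OF assms(1,2)] lin_simps[OF der(1)[OF assms(1,2)]])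

text \<open>
  The degree components are separated by a map from \<open>T\<close> to \<open>T\<close>-valued functions of the degree.
\<close>

lemma TH_separate: "\<exists>L. lin tscale (\<lambda>c g (n::int). tscale c (g n)) L \<and>
    (\<forall>m. \<forall>F\<in>TH m. L F = (\<lambda>n. if n = m then F else 0))"
proof -
  let ?s = "\<lambda>c (g :: int \<Rightarrow> ('k, 'v) tens) n. tscale c (g n)"
  let ?t = "\<lambda>c (h :: (int \<Rightarrow> ('k, 'v) tens) \<Rightarrow> int \<Rightarrow> ('k, 'v) tens) g n. tscale c (h g n)"
  \<comment> \<open>Tensors are functions too; fixing the argument types keeps the simplifier from
    evaluating them on forms.\<close>
  note pw = fun_eq_iff[of "_ :: int \<Rightarrow> _"] fun_eq_iff[of "_ :: (int \<Rightarrow> _) \<Rightarrow> _"]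
    plus_fun_apply[of _ _ "_ :: int"] plus_fun_apply[of _ _ "_ :: int \<Rightarrow> _"]
    zero_fun_apply[of "_ :: int"] zero_fun_apply[of "_ :: int \<Rightarrow> _"]
  have vs: "vector_space ?s" and vt: "vector_space ?t"
    by unfold_locales (auto simp: pw tens.scale_right_distrib tens.scale_left_distrib)
  \<comment> \<open>A letter of degree \<open>n\<close> multiplies every component and moves it from
    index \<open>m - n\<close> to index \<open>m\<close>.\<close>
  have "lin (scale V) ?t (\<lambda>x g m. sg x \<odot> g (m - n))" for n
    by (simp add: lin_def pw)
  from graded_extend[OF vt, where f = "\<lambda>n x g m. sg x \<odot> g (m - n)", OF this] obtain r where r: "lin (scale V) ?t r"
    "\<And>n x. x \<in> homog V n \<Longrightarrow> r x = (\<lambda>g m. sg x \<odot> g (m - n))" by blast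
  note r_simps = lin_simps[OF r(1)]
  have r_lin: "lin ?s ?s (r x)" if "x \<in> U" for x
    using that unfolding underlying_def
  proof (induction rule: span_induct_alt)
    case base
    show ?case by (simp add: r_simps lin_def pw)
  next
    case (step c x y)
    then obtain n where "x \<in> homog V n" by auto
    with step(2) show ?case
      by (simp add: r_simps lin_def r(2) pw
          tens.scale_right_distrib mult.commute add_ac)
  qed
  have "bilin (scale V) ?s ?s (\<lambda>x. r (pv x))"
    unfolding bilin_def
  proof (intro conjI allI)
    show "lin ?s ?s (r (pv x))" for x by (rule r_lin) simp
    show "lin (scale V) ?s (\<lambda>x. r (pv x) g)" for g
      by (simp add: lin_def lin_simps[OF pv_lin] r_simps pw)
  qed
  from fold_exists[OF vs this, of "\<lambda>n. if n = 0 then one else 0"] obtain L where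
    L: "lin tscale ?s L" "L one = (\<lambda>n. if n = 0 then one else 0)"
      "\<And>x F. x \<in> U \<Longrightarrow> F \<in> T \<Longrightarrow> L (sg x \<odot> F) = r (pv x) (L F)" by blast
  have "L F = (\<lambda>n. if n = m then F else 0)" if "F \<in> TH m" for F m
    using that
  proof (induction rule: TH_induct)
    case (Cons x n F m)
    then show ?case by (auto simp: L(3) homog_U TH_T r(2) pw)
  qed (auto simp: L lin_simps[OF L(1)] pw)
  with L(1) show ?thesis by blast
qed

text \<open>Evaluating the separating map at \<open>n\<close> extracts the summand of degree
  \<open>n\<close> from a vanishing sum.\<close>

lemma graded_tensor_algebra: "graded_space (tensor_algebra V)"
proof -
  obtain L where L: "lin tscale (\<lambda>c g (n::int). tscale c (g n)) L"
    "\<And>m F. F \<in> TH m \<Longrightarrow> L F = (\<lambda>n. if n = m then F else 0)"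
    using TH_separate by blast
  have sc: "scale (tensor_algebra V) = tscale" by (simp add: tensor_algebra_def)
  show ?thesis
  proof (unfold_locales, unfold sc)
    show "tens.subspace (TH n)" for n by (simp add: TH_def)
    fix S f n assume S: "finite S" "\<And>n. n \<in> S \<Longrightarrow> f n \<in> TH n" "(\<Sum>n\<in>S. f n) = 0" "n \<in> S"
    have "0 = L (\<Sum>n\<in>S. f n) n" by (simp add: S(3) lin_0[OF L(1)] pointwise)
    also have "\<dots> = (\<Sum>m\<in>S. L (f m) n)"
      using S(1) by (subst lin_sum[OF L(1)]) (induction S rule: finite_induct, simp_all add: pointwise)
    also have "\<dots> = (\<Sum>m\<in>S. if m = n then f m else 0)"
      by (intro sum.cong) (simp_all add: L(2)[OF S(2)])
    also have "\<dots> = f n" using S(1,4) by (simp add: sum.delta)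
    finally show "f n = 0" by simp
  qed (simp_all add: tens.scale_right_distrib tens.scale_left_distrib)
qed

lemma reduced_TH: "homog (reduced_tensors V) m = TH m \<inter> Tr"
proof
  let ?S = "{pure V xs |xs ns. xs \<noteq> [] \<and> homog_word V xs ns \<and> sum_list ns = m}"
  have hr: "homog (reduced_tensors V) m = tens.span ?S" by (simp add: reduced_tensors_def)
  have "?S \<subseteq> TH m \<inter> Tr"
  proof safe
    fix xs ns assume "xs \<noteq> []" "homog_word V xs ns" "m = sum_list ns"
    then show "pure V xs \<in> TH (sum_list ns)" "pure V xs \<in> Tr"
      using pure_TH[of xs ns] homog_word_set[of xs ns] by (cases xs; simp add: pure_Cons)+
  qed
  moreover have "tens.subspace (TH m \<inter> Tr)" by (simp add: tens.subspace_def)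
  ultimately show "homog (reduced_tensors V) m \<subseteq> TH m \<inter> Tr"
    unfolding hr by (rule tens.span_minimal)
  have "red F \<in> tens.span ?S" if "F \<in> TH m" for F
    using that
  proof (induction rule: TH_span_induct)
    case (pure xs ns)
    show ?case
    proof (cases "xs = []")
      case False
      then have red: "red (pure V xs) = pure V xs"
        using homog_word_set[OF pure(1)] by (cases xs) (simp_all add: pure_Cons)
      show ?thesis unfolding red using False pure by (intro tens.span_base) blast
    next
      case True
      then show ?thesis by (simp only: red_one tens.span_zero)
    qed
  qed (simp_all only: red_simps tens.span_zero tens.span_add tens.span_scale)
  note S = this
  show "TH m \<inter> Tr \<subseteq> homog (reduced_tensors V) m"
  proof
    fix F assume "F \<in> TH m \<inter> Tr"
    then show "F \<in> homog (reduced_tensors V) m" unfolding hr using S[of F] by simp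
  qed
qed

lemma graded_reduced_tensors: "graded_space (reduced_tensors V)"
proof -
  interpret TA: graded_space "tensor_algebra V" by (rule graded_tensor_algebra)
  have sc: "scale (reduced_tensors V) = tscale" by (simp add: reduced_tensors_def)
  show ?thesis
  proof (unfold_locales, unfold sc)
    show "tens.subspace (homog (reduced_tensors V) n)" for n by (simp add: reduced_tensors_def)
    fix S f n assume "finite S" "\<And>n. n \<in> S \<Longrightarrow> f n \<in> homog (reduced_tensors V) n" "(\<Sum>n\<in>S. f n) = 0" "n \<in> S"
    then show "f n = 0" by (intro TA.independent_homog[of S f]) (auto simp: reduced_TH)
  qed (simp_all add: tens.scale_right_distrib tens.scale_left_distrib)
qed

end

lemma graded_shift:
  assumes "graded_space V"
  shows "graded_space (shift r V)"
proof -
  interpret graded_space V by fact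
  have sc: "scale (shift r V) = scale V" and hm: "homog (shift r V) n = homog V (n + r)" for n
    by (simp_all add: shift_def)
  show ?thesis
  proof (unfold_locales, unfold sc hm)
    show "subspace (homog V (n + r))" for n by (rule subspace_homog)
    fix S f n assume "finite S" "\<And>n. n \<in> S \<Longrightarrow> f n \<in> homog V (n + r)" "(\<Sum>n\<in>S. f n) = 0" "n \<in> S"
    then have "f (n + r - r) = 0"
      by (intro independent_homog[of "(\<lambda>n. n + r) ` S" "\<lambda>n. f (n - r)"])
         (auto simp: sum.reindex inj_on_def)
    then show "f n = 0" by simp
  qed (simp_all add: scale_right_distrib scale_left_distrib)
qed

section \<open>Words in a spanning set of letters\<close>

context tspace
begin

text \<open>Multilinearity in each letter. It lets a map be tested on words whose letters are
  homogeneous, or are xi or homogeneous in \<open>A\<close>, as the definitions of the differentials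
  require.\<close>

lemma T_span_letters:
  assumes "U \<subseteq> span S" "S \<subseteq> U"
  shows "F \<in> T \<Longrightarrow> F \<in> tens.span (pure V ` {xs. set xs \<subseteq> S})"
proof (induction rule: T_induct)
  case one
  show ?case by (rule tens.span_base) auto
next
  case (Cons x F)
  have S: "sg y \<odot> F \<in> tens.span (pure V ` {xs. set xs \<subseteq> S})" if "y \<in> S" for y
    using Cons(3)
  proof (induction rule: tens.span_induct_alt)
    case (step c G H)
    then obtain xs where xs: "G = pure V xs" "set xs \<subseteq> S" by auto
    then have "sg y \<odot> G = pure V (y # xs)" using that assms(2) by (simp add: pure_Cons subset_eq)
    then have "sg y \<odot> G \<in> tens.span (pure V ` {xs. set xs \<subseteq> S})"
      using xs that by (auto intro: tens.span_base)
    with step show ?case by (simp only: mul_simps tens.span_add tens.span_scale)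
  qed (simp add: tens.span_zero)
  have "x \<in> span S" using Cons(1) assms(1) by blast
  then show ?case
  proof (induction rule: span_induct_alt)
    case (step c x y)
    then show ?case by (simp only: sg_simps mul_simps tens.span_add tens.span_scale S)
  qed (simp add: tens.span_zero)
qed (auto intro: tens.span_zero tens.span_add tens.span_scale)

lemma Tr_span_letters:
  assumes "U \<subseteq> span S" "S \<subseteq> U" "F \<in> Tr"
  shows "F \<in> tens.span (pure V ` {xs. xs \<noteq> [] \<and> set xs \<subseteq> S})"
proof -
  have "red F \<in> tens.span (pure V ` {xs. xs \<noteq> [] \<and> set xs \<subseteq> S})"
    using T_span_letters[OF assms(1,2) Tr_T[OF assms(3)]]
  proof (induction rule: tens.span_induct_alt)
    case (step c G H)
    then obtain xs where xs: "G = pure V xs" "set xs \<subseteq> S" by auto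
    have "red G \<in> tens.span (pure V ` {xs. xs \<noteq> [] \<and> set xs \<subseteq> S})"
    proof (cases "xs = []")
      case False
      then have "red G = pure V xs" using xs assms(2) by (simp add: pure_Tr)
      with False xs show ?thesis by (auto intro: tens.span_base)
    qed (simp add: xs tens.span_zero)
    with step show ?case by (simp only: red_simps tens.span_add tens.span_scale)
  qed (simp add: tens.span_zero)
  then show ?thesis using assms(3) by simp
qed

lemma tpart_0: "F \<in> T \<Longrightarrow> tpart V 0 F = tscale (ctr F) one"
  by (induction rule: T_induct)
     (simp_all add: tpart_one tpart_Cons lin_simps[OF tpart_lin] tens.scale_left_distrib)

end

context graded_tspace
begin

lemma tensor_algebra_scale [simp]: "scale (tensor_algebra V) = tscale"
  by (simp add: tensor_algebra_def)

lemma derivation_der: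
  assumes "lin (scale V) (scale V) \<sigma>" "\<And>n x. x \<in> homog V n \<Longrightarrow> \<sigma> x = scale V ((-1) powi n) x"
    and "lin (scale V) tscale g" "\<And>n x. x \<in> homog V n \<Longrightarrow> g x \<in> TH (n + 1)"
  shows "derivation (tensor_algebra V) (tmult V) (der \<sigma> g)"
  unfolding derivation_def linear_map_of_degree_def linear_map_def T_eq
proof (intro conjI allI ballI)
  show "der \<sigma> g x \<in> TH (m + 1)" if "x \<in> TH m" for m x
    using that by (intro der_TH assms) (simp_all add: assms(2))
  show "der \<sigma> g (tmult V x y) =
      tmult V (der \<sigma> g x) y + scale (tensor_algebra V) ((-1) powi m) (tmult V x (der \<sigma> g y))"
    if "x \<in> TH m" "y \<in> T" for m x y
    using that by (simp add: mul_eq TH_T der_T assms der_mul stt_TH)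
qed (simp_all add: der_T assms lin_simps[OF der(1)[OF assms(1,3)]])

text \<open>\<open>derivation\<close> gives the Leibniz rule for homogeneous left factors only, so a
  letter is first split into homogeneous parts. The value on \<open>one\<close> vanishes because
  \<open>one\<close> is idempotent of degree 0.\<close>

lemma derivation_eq_der:
  assumes "lin (scale V) (scale V) \<sigma>" "\<And>n x. x \<in> homog V n \<Longrightarrow> \<sigma> x = scale V ((-1) powi n) x"
    and "lin (scale V) tscale g"
    and "derivation (tensor_algebra V) (tmult V) D" "\<And>x. x \<in> U \<Longrightarrow> D (sg x) = g x"
    and "F \<in> T"
  shows "D F = der \<sigma> g F"
proof -
  have D: "D x \<in> T" "y \<in> T \<Longrightarrow> D (x + y) = D x + D y" "D (tscale c x) = tscale c (D x)"
    if "x \<in> T" for x y c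
    using that assms(4) unfolding derivation_def linear_map_of_degree_def linear_map_def T_eq by auto
  have D0: "D 0 = 0" using D(3)[of 0 0] by simp
  have Leibniz: "D (x \<odot> y) = D x \<odot> y + tscale ((-1) powi m) (x \<odot> D y)" if "x \<in> TH m" "y \<in> T" for x y m
    using that assms(4) D(1) unfolding derivation_def T_eq by (simp add: mul_eq TH_T)
  have one: "D one = 0" using Leibniz[OF one_TH one_T] D(1)[of one] by simp
  show ?thesis
    using assms(6)
  proof (induction rule: T_induct)
    case (Cons x F)
    have "D (sg x \<odot> F) = D (sg x) \<odot> F + sg (\<sigma> x) \<odot> D F"
      using Cons(1) unfolding underlying_def
    proof (induction rule: span_induct_alt)
      case (step c x y)
      then obtain n where n: "x \<in> homog V n" by auto
      have "D (sg (scale V c x + y) \<odot> F) = tscale c (D (sg x \<odot> F)) + D (sg y \<odot> F)"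
        by (simp add: D)
      also have "D (sg x \<odot> F) = D (sg x) \<odot> F + sg (\<sigma> x) \<odot> D F"
        using Leibniz[OF sg_TH[OF n] Cons(2)] by (simp add: assms(2)[OF n])
      finally show ?case
        by (simp add: step D lin_simps[OF assms(1)] tens.scale_right_distrib add_ac)
    qed (simp add: D0 lin_0[OF assms(1)])
    then show ?case using Cons assms(5) by (simp add: der(4)[OF assms(1,3)])
  qed (simp_all add: D D0 one der[OF assms(1,3)] lin_simps[OF der(1)[OF assms(1,3)]])
qed

end

lemma neg_one_powi_sq [simp]: "(-1) powi n * (-1) powi n = (1 :: 'k::field)"
  by (simp flip: power_int_mult_distrib)

lemma neg_one_powi_Suc: "(-1) powi (n + 1) = - ((-1) powi n :: 'k::field)"
  by (simp add: power_int_add)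

lemma neg_one_powi_pred: "(-1) powi (n - 1) = - ((-1) powi n :: 'k::field)"
  by (simp add: power_int_diff)

section \<open>The letters of \<open>Bar(A\<^sub>+)\<close>\<close>

locale cobar_bar_algebra = dg_algebra A for A :: "('k::field, 'a::ab_group_add) dga"
begin

abbreviation UA :: "'a set" where "UA \<equiv> underlying A"

lemma UA_closed [simp]:
  "0 \<in> UA" "x \<in> UA \<Longrightarrow> y \<in> UA \<Longrightarrow> x + y \<in> UA" "x \<in> UA \<Longrightarrow> y \<in> UA \<Longrightarrow> x - y \<in> UA"
  "x \<in> UA \<Longrightarrow> scale A c x \<in> UA" "x \<in> UA \<Longrightarrow> - x \<in> UA"
  by (simp_all add: underlying_def span_zero span_add span_diff span_scale span_neg)

lemma homog_UA: "x \<in> homog A n \<Longrightarrow> x \<in> UA"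
  unfolding underlying_def by (rule span_base) auto

text \<open>The structure maps of \<open>A\<close> are linear only on its carrier; composed with
  this projection they become linear on the whole type, as was done for tensors.\<close>

definition pA :: "'a \<Rightarrow> 'a" where "pA = lproj (scale A) UA"

lemma pA_lin: "lin (scale A) (scale A) pA" and pA_UA [simp]: "pA x \<in> UA" and pA_id [simp]: "x \<in> UA \<Longrightarrow> pA x = x"
  unfolding pA_def using lproj[of UA] by (auto simp: underlying_def)

definition dA :: "'a \<Rightarrow> 'a" where "dA x = diff A (pA x)"
definition mA :: "'a \<Rightarrow> 'a \<Rightarrow> 'a" where "mA x y = mult A (pA x) (pA y)"

lemma dA_eq: "x \<in> UA \<Longrightarrow> diff A x = dA x"
  and mA_eq: "x \<in> UA \<Longrightarrow> y \<in> UA \<Longrightarrow> mult A x y = mA x y"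
  by (simp_all add: dA_def mA_def)

lemma dA_lin: "lin (scale A) (scale A) dA"
  using diff_degree
  by (simp add: lin_def dA_def lin_simps[OF pA_lin] linear_map_of_degree_def linear_map_def)

lemma mA_bilin: "bilin (scale A) (scale A) (scale A) mA"
  using mult_linear_left mult_linear_right
  by (simp add: bilin_def lin_def mA_def lin_simps[OF pA_lin] linear_map_def)

lemmas dA_simps [simp] = lin_simps[OF dA_lin]
lemmas mA_simps [simp] = bilin_simps[OF mA_bilin]

lemma dA_homog: "x \<in> homog A n \<Longrightarrow> dA x \<in> homog A (n + 1)"
  and dA_UA [simp]: "dA x \<in> UA"
  and mA_homog: "x \<in> homog A m \<Longrightarrow> y \<in> homog A n \<Longrightarrow> mA x y \<in> homog A (m + n)"
  and mA_UA [simp]: "mA x y \<in> UA"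
proof -
  show "x \<in> homog A n \<Longrightarrow> dA x \<in> homog A (n + 1)"
    using diff_degree by (simp add: dA_def homog_UA linear_map_of_degree_def)
  show "dA x \<in> UA"
    using diff_degree by (simp add: dA_def linear_map_of_degree_def linear_map_def)
  show "x \<in> homog A m \<Longrightarrow> y \<in> homog A n \<Longrightarrow> mA x y \<in> homog A (m + n)"
    by (simp add: mA_def homog_UA mult_degree)
  show "mA x y \<in> UA"
    using mult_linear_left[of "pA y"] by (simp add: mA_def linear_map_def)
qed

lemma dA_dA [simp]: "dA (dA x) = 0"
proof -
  have "dA (dA x) = diff A (dA x)" by (simp only: dA_eq dA_UA)
  then show ?thesis using diff_diff[of "pA x"] by (simp add: dA_def)
qed

lemma mA_assoc: "mA (mA x y) z = mA x (mA y z)"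
proof -
  have "mA (mA x y) z = mult A (mA x y) (pA z)" "mA x (mA y z) = mult A (pA x) (mA y z)"
    by (simp_all add: mA_def[of "mA x y" z] mA_def[of x "mA y z"])
  then show ?thesis using mult_assoc[of "pA x" "pA y" "pA z"] by (simp add: mA_def)
qed

lemma unit_UA [simp]: "unit A \<in> UA"
  using unit_degree by (rule homog_UA)

lemma mA_unit [simp]: "x \<in> UA \<Longrightarrow> mA (unit A) x = x" "x \<in> UA \<Longrightarrow> mA x (unit A) = x"
  using mult_unit_left mult_unit_right by (simp_all add: mA_def)

lemma dA_mA: "x \<in> homog A m \<Longrightarrow> y \<in> UA \<Longrightarrow> dA (mA x y) = mA (dA x) y + scale A ((-1) powi m) (mA x (dA y))"
  using diff_derivation unfolding derivation_def by (simp add: dA_eq mA_eq homog_UA)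

lemma dA_unit [simp]: "dA (unit A) = 0"
  using dA_mA[OF unit_degree unit_UA] by simp

abbreviation R :: "('k, 'a \<times> 'k) nudga" where "R \<equiv> adjoin_xi A"
abbreviation V :: "('k, 'a \<times> 'k) nudga" where "V \<equiv> shift 1 R"
abbreviation W :: "('k, ('k, 'a \<times> 'k) tens) dgcoalg" where "W \<equiv> shift (-1) (Bar R)"

lemma R_simps [simp]:
  "scale R c x = (scale A c (fst x), c * snd x)"
  "homog R n = homog A n \<times> (if n = -1 then UNIV else {0})"
  "diff R x = (diff A (fst x), 0)" "mult R x y = (mult A (fst x) (fst y), 0)"
  by (simp_all add: adjoin_xi_def case_prod_unfold)

lemma V_simps [simp]: "scale V c x = (scale A c (fst x), c * snd x)" "homog V n = homog R (n + 1)"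
  by (simp_all add: shift_def adjoin_xi_def case_prod_unfold)

lemma graded_R: "graded_space R"
proof
  fix f :: "int \<Rightarrow> 'a \<times> 'k" and S n
  assume S: "finite S" "\<And>n. n \<in> S \<Longrightarrow> f n \<in> homog R n" "(\<Sum>n\<in>S. f n) = 0" "n \<in> S"
  have fA: "fst (f n) \<in> homog A n" "n \<noteq> -1 \<Longrightarrow> snd (f n) = 0" if "n \<in> S" for n
    using S(2)[OF that] by (auto simp: mem_Times_iff split: if_splits)
  have "(\<Sum>n\<in>S. fst (f n)) = 0" "(\<Sum>n\<in>S. snd (f n)) = 0"
    using S(3) by (simp_all flip: fst_sum snd_sum)
  note sums = this
  have "fst (f n) = 0"
    by (rule independent_homog[OF S(1) fA(1) sums(1) S(4)])
  moreover have "snd (f n) = 0"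
  proof (cases "n = -1")
    case True
    have "(\<Sum>m\<in>S. snd (f m)) = (\<Sum>m\<in>S. if m = -1 then snd (f m) else 0)"
      using fA(2) by (intro sum.cong) auto
    also have "\<dots> = snd (f n)" using S(1,4) True by (simp add: sum.delta)
    finally show ?thesis using sums(2) by simp
  qed (use fA(2) S(4) in simp)
  ultimately show "f n = 0" by (simp add: prod_eq_iff)
next
  have "module (scale R)"
    by unfold_locales (simp_all add: scale_right_distrib scale_left_distrib algebra_simps)
  then show "module.subspace (scale R) (homog R n)" for n
    by (auto simp: module.subspace_def zero_prod_def)
qed (simp_all add: scale_right_distrib scale_left_distrib algebra_simps)

end

sublocale cobar_bar_algebra \<subseteq> VV: graded_tspace V
proof -
  interpret G: graded_space V by (rule graded_shift[OF graded_R])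
  show "graded_tspace V"
    by (intro graded_tspace.intro tspace.intro G.graded_space_axioms G.vector_space_axioms)
qed

context cobar_bar_algebra
begin

lemma UV: "VV.U = UA \<times> UNIV"
proof
  have "UA \<times> UNIV \<subseteq> VV.span (\<Union>n. homog V n)"
  proof
    fix x :: "'a \<times> 'k" assume "x \<in> UA \<times> UNIV"
    then obtain a c where x: "x = (a, c)" "a \<in> UA" by auto
    have "(0, c) \<in> homog V (-2)" by (simp add: mem_Times_iff)
    then have c: "(0, c) \<in> VV.span (\<Union>n. homog V n)" by (intro VV.span_base) blast
    have "(a, 0) \<in> VV.span (\<Union>n. homog V n)"
      using x(2) unfolding underlying_def
    proof (induction rule: span_induct_alt)
      case base
      show ?case using VV.span_zero[of "\<Union>n. homog V n"] by (simp only: zero_prod_def)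
    next
      case (step r x y)
      then obtain n where "x \<in> homog A n" by auto
      then have "(x, 0) \<in> homog V (n - 1)" by (simp add: mem_Times_iff)
      then have "(x, 0) \<in> VV.span (\<Union>n. homog V n)" by (intro VV.span_base) blast
      moreover have e: "(scale A r x + y, 0) = scale V r (x, 0) + (y, 0)" by simp
      ultimately show ?case unfolding e using step(2) by (intro VV.span_add VV.span_scale)
    qed
    moreover have e: "x = (a, 0) + (0, c)" by (simp add: x)
    ultimately show "x \<in> VV.span (\<Union>n. homog V n)" unfolding e using c by (intro VV.span_add)
  qed
  then show "UA \<times> UNIV \<subseteq> VV.U" by (simp only: underlying_def)
  have "VV.subspace (UA \<times> UNIV)"
    unfolding VV.subspace_def by (auto simp: mem_Times_iff zero_prod_def)
  moreover have "(\<Union>n. homog V n) \<subseteq> UA \<times> UNIV" by (auto simp: homog_UA)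
  ultimately have "VV.span (\<Union>n. homog V n) \<subseteq> UA \<times> UNIV" by (rule VV.span_minimal[rotated])
  then show "VV.U \<subseteq> UA \<times> UNIV" by (simp only: underlying_def)
qed

lemma UR [simp]: "x \<in> underlying R \<longleftrightarrow> fst x \<in> UA"
  using UV by (simp add: mem_Times_iff)

lemma homog_V_U: "x \<in> homog V n \<Longrightarrow> fst x \<in> UA"
  by (auto simp: homog_UA)

lemma V_eq_on_homog:
  assumes "vector_space t" "lin (scale V) t f" "lin (scale V) t g"
    "\<And>n x. x \<in> homog V n \<Longrightarrow> f x = g x" "fst x \<in> UA"
  shows "f x = g x"
proof (rule lin_eq_on_span[OF VV.vector_space_axioms assms(2,3) _ assms(1)])
  show "f x = g x" if "x \<in> (\<Union>n. homog V n)" for x using that assms(4) by blast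
  show "x \<in> VV.span (\<Union>n. homog V n)"
    using assms(5) UR[of x] underlying_shift[of 1 R] unfolding underlying_def[of V] by (simp only:)
qed

definition \<sigma> :: "'a \<times> 'k \<Rightarrow> 'a \<times> 'k" where
  "\<sigma> = (SOME L. lin (scale V) (scale V) L \<and> (\<forall>n. \<forall>x\<in>homog V n. L x = scale V ((-1) powi n) x))"

lemma \<sigma>_lin: "lin (scale V) (scale V) \<sigma>"
  and \<sigma>_homog: "x \<in> homog V n \<Longrightarrow> \<sigma> x = scale V ((-1) powi n) x"
proof -
  have "lin (scale V) (scale V) (scale V ((-1) powi n))" for n
    unfolding lin_def by (simp add: scale_right_distrib mult.commute distrib_right)
  from someI_ex[OF VV.graded_extend[OF VV.vector_space_axioms, where f = "\<lambda>n. scale V ((-1) powi n)", OF this],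
      folded \<sigma>_def]
  show "lin (scale V) (scale V) \<sigma>" "x \<in> homog V n \<Longrightarrow> \<sigma> x = scale V ((-1) powi n) x" by blast+
qed

lemmas \<sigma>_simps' = lin_simps[OF \<sigma>_lin]

lemma \<sigma>_U: "fst x \<in> UA \<Longrightarrow> fst (\<sigma> x) \<in> UA"
proof -
  assume "fst x \<in> UA"
  then have "x \<in> VV.span (\<Union>n. homog V n)"
    using UR[of x] underlying_shift[of 1 R] unfolding underlying_def[of V] by (simp only:)
  then show ?thesis
  proof (induction rule: VV.span_induct_alt)
    case base
    show ?case by (simp add: \<sigma>_simps')
  next
    case (step c x y)
    then obtain n where n: "x \<in> homog V n" by blast
    have "\<sigma> (scale V c x + y) = scale V c (scale V ((-1) powi n) x) + \<sigma> y"
      by (simp only: \<sigma>_simps' \<sigma>_homog[OF n])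
    then show ?case using step homog_V_U[OF n] by simp
  qed
qed

text \<open>\<open>md\<close> is the bar component b_1, \<open>mb\<close> the substitution of 1_A
  for xi, and \<open>m1\<close> is their sum.\<close>

definition m1 :: "'a \<times> 'k \<Rightarrow> 'a \<times> 'k" where "m1 x = (scale A (snd x) (unit A) - dA (fst x), 0)"
definition md :: "'a \<times> 'k \<Rightarrow> 'a \<times> 'k" where "md x = (- dA (fst x), 0)"
definition mb :: "'a \<times> 'k \<Rightarrow> 'a \<times> 'k" where "mb x = (scale A (snd x) (unit A), 0)"
text \<open>The bar component b_2: its sign (-1)^|x| equals - (-1)^|sx| because of the suspension,
  hence the minus together with \<open>\<sigma>\<close>.\<close>

definition m2 :: "'a \<times> 'k \<Rightarrow> 'a \<times> 'k \<Rightarrow> 'a \<times> 'k" where "m2 x y = (- mA (fst (\<sigma> x)) (fst y), 0)"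

lemma lin_V_iff: "lin (scale V) (scale V) f \<longleftrightarrow>
    (\<forall>x y. f (x + y) = f x + f y) \<and> (\<forall>c x. f (scale A c (fst x), c * snd x) = (scale A c (fst (f x)), c * snd (f x)))"
  by (simp add: lin_def)

lemma m_lin: "lin (scale V) (scale V) m1" "lin (scale V) (scale V) md" "lin (scale V) (scale V) mb"
  unfolding lin_V_iff
  by (simp_all add: m1_def md_def mb_def scale_left_distrib scale_right_diff_distrib algebra_simps)

lemma m2_bilin: "bilin (scale V) (scale V) (scale V) m2"
  using \<sigma>_lin unfolding bilin_def lin_V_iff by (simp add: m2_def)

lemma snd_lin: "lin (scale V) (*) snd"
  by (simp add: lin_def)

end

sublocale cobar_bar_algebra \<subseteq> WW: tspace W
proof
qed (simp_all add: shift_def Bar_def bar_space_def reduced_tensors_def tens.scale_right_distrib tens.scale_left_distrib)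

context cobar_bar_algebra
begin

lemma W_simps [simp]: "scale W = tscale" "homog W n = VV.TH (n - 1) \<inter> VV.Tr"
proof -
  show "scale W = tscale" by (simp add: shift_def Bar_def bar_space_def reduced_tensors_def)
  have "homog W n = homog (reduced_tensors V) (n - 1)"
    by (simp add: shift_def[of "-1"] Bar_def bar_space_def)
  then show "homog W n = VV.TH (n - 1) \<inter> VV.Tr" by (simp only: VV.reduced_TH)
qed

lemma UBar [simp]: "underlying (Bar R) = VV.Tr"
  unfolding VV.Tr_eq[symmetric] by (simp add: underlying_def Bar_def bar_space_def)

lemma bar_cobar_VW: "bar_cobar V W \<sigma>"
proof
  show "scale W = tscale" by simp
  show "underlying W = underlying (reduced_tensors V)" by (simp add: VV.Tr_eq)
  show "lin (scale V) (scale V) \<sigma>" by (rule \<sigma>_lin)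
  show "\<sigma> x \<in> underlying V" if "x \<in> underlying V" for x using that by (simp add: \<sigma>_U)
  show "\<sigma> (\<sigma> x) = x" if "x \<in> underlying V" for x
  proof (rule V_eq_on_homog[OF VV.vector_space_axioms])
    show "lin (scale V) (scale V) (\<lambda>x. \<sigma> (\<sigma> x))" by (rule lin_compose[OF \<sigma>_lin \<sigma>_lin])
    show "\<sigma> (\<sigma> x) = x" if "x \<in> homog V n" for n x
      by (simp only: \<sigma>_homog[OF that] \<sigma>_simps') (simp only: VV.scale_scale neg_one_powi_sq VV.scale_one)
  qed (use that in \<open>simp_all add: lin_def\<close>)
qed

lemma bar_maps_d: "bar_maps V W \<sigma> md m2"
  by (intro bar_maps.intro bar_cobar_VW bar_maps_axioms.intro m_lin m2_bilin) (simp_all add: md_def m2_def)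

text \<open>A constant, since instances of linearity rules for \<open>\<lambda>_ _. 0\<close> would loop.\<close>

definition mz :: "'a \<times> 'k \<Rightarrow> 'a \<times> 'k \<Rightarrow> 'a \<times> 'k" where "mz x y = 0"

lemma bar_maps_b: "bar_maps V W \<sigma> mb mz"
  by (intro bar_maps.intro bar_cobar_VW bar_maps_axioms.intro m_lin)
     (simp_all add: mb_def mz_def bilin_def lin_def zero_prod_def)

lemma bar_maps_m: "bar_maps V W \<sigma> m1 m2"
  by (intro bar_maps.intro bar_cobar_VW bar_maps_axioms.intro m_lin m2_bilin) (simp_all add: m1_def m2_def)

text \<open>The letter xi has degree -1, hence -2 after the shift.\<close>

lemma homog_cases:
  assumes "x \<in> homog V n"
  shows "\<exists>a c. x = (a, c) \<and> a \<in> homog A (n + 1) \<and> (n = -2 \<or> c = 0)"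
  using assms by (cases x) (auto simp: mem_Times_iff split: if_splits)

lemma m_homog:
  assumes "x \<in> homog V n" "y \<in> homog V m"
  shows "m1 x \<in> homog V (n + 1)" "md x \<in> homog V (n + 1)" "mb x \<in> homog V (n + 1)" "m2 x y \<in> homog V (n + m + 1)"
proof -
  obtain a c where x: "x = (a, c)" "a \<in> homog A (n + 1)" "n = -2 \<or> c = 0"
    using homog_cases[OF assms(1)] by blast
  obtain a' c' where y: "y = (a', c')" "a' \<in> homog A (m + 1)" using homog_cases[OF assms(2)] by blast
  have u: "scale A c (unit A) \<in> homog A (n + 1 + 1)"
  proof (cases "n = -2")
    case True
    then show ?thesis using unit_degree by simp
  qed (use x(3) in simp)
  moreover have "dA a \<in> homog A (n + 1 + 1)" by (rule dA_homog[OF x(2)])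
  moreover have "mA a a' \<in> homog A (n + 1 + (m + 1))" by (rule mA_homog[OF x(2) y(2)])
  moreover have "m2 x y = (- scale A ((-1) powi n) (mA a a'), 0)"
    unfolding m2_def \<sigma>_homog[OF assms(1)] by (simp add: x y)
  ultimately show "m1 x \<in> homog V (n + 1)" "md x \<in> homog V (n + 1)" "mb x \<in> homog V (n + 1)"
    "m2 x y \<in> homog V (n + m + 1)"
    using x y by (simp_all add: m1_def md_def mb_def mem_Times_iff add_ac)
qed

lemma V_eq_on_homog2:
  assumes "bilin (scale V) (scale V) (scale V) f" "bilin (scale V) (scale V) (scale V) g"
    "\<And>n m x y. x \<in> homog V n \<Longrightarrow> y \<in> homog V m \<Longrightarrow> f x y = g x y" "fst x \<in> UA" "fst y \<in> UA"
  shows "f x y = g x y"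
  by (rule V_eq_on_homog[OF VV.vector_space_axioms bilin_left[OF assms(1)] bilin_left[OF assms(2)] _ assms(4)])
     (rule V_eq_on_homog[OF VV.vector_space_axioms bilin_right[OF assms(1)] bilin_right[OF assms(2)] _ assms(5)],
      rule assms(3))

text \<open>The last identity combines the Leibniz rule of \<open>A\<close> with the unit laws: the
  copies of 1_A that \<open>m1\<close> puts in for xi produce the curvature terms.\<close>

lemma m_eqs: 
  assumes "x \<in> homog V n" "y \<in> homog V m"
  shows "\<sigma> (m1 x) = - m1 (\<sigma> x)" "\<sigma> (m2 x y) = - m2 (\<sigma> x) (\<sigma> y)"
    "m1 (m2 x y) = scale V (snd x) y - scale V (snd y) x - m2 (m1 x) y - m2 (\<sigma> x) (m1 y)"
proof -
  note h = assms m_homog[OF assms]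
  obtain a c where x: "x = (a, c)" "a \<in> homog A (n + 1)" "n = -2 \<or> c = 0"
    using homog_cases[OF assms(1)] by blast
  obtain a' c' where y: "y = (a', c')" "a' \<in> homog A (m + 1)" "m = -2 \<or> c' = 0"
    using homog_cases[OF assms(2)] by blast
  note [simp] = homog_UA[OF x(2)] homog_UA[OF y(2)]
  have sx: "\<sigma> x = scale V ((-1) powi n) x" "\<sigma> (m1 x) = scale V ((-1) powi (n + 1)) (m1 x)"
    "\<sigma> y = scale V ((-1) powi m) y" "\<sigma> (m2 x y) = scale V ((-1) powi (n + m + 1)) (m2 x y)"
    using h by (blast intro: \<sigma>_homog)+
  \<comment> \<open>A nonzero coefficient of xi occurs only in degree -2, which is even.\<close>
  have c: "(-1) powi n * c = c" "(-1) powi m * c' = c'" using x(3) y(3) by (cases "n = -2"; cases "m = -2"; simp)+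
  note m_s = lin_simps[OF m_lin(1)] bilin_simps[OF m2_bilin]
  show "\<sigma> (m1 x) = - m1 (\<sigma> x)"
    by (simp only: m_s sx neg_one_powi_Suc VV.scale_minus_left)
  have "m2 (\<sigma> x) (\<sigma> y) = scale V ((-1) powi (n + m)) (m2 x y)"
    by (simp only: sx m_s VV.scale_scale) (simp add: power_int_add mult.commute)
  then show "\<sigma> (m2 x y) = - m2 (\<sigma> x) (\<sigma> y)"
    by (simp only: sx(4) neg_one_powi_Suc VV.scale_minus_left)
  have ss: "\<sigma> (\<sigma> x) = x" "\<sigma> (m1 x) = - scale V ((-1) powi n) (m1 x)"
    using bar_cobar.\<sigma>_\<sigma>[OF bar_cobar_VW, of x] by (simp add: x) (simp only: sx neg_one_powi_Suc VV.scale_minus_left)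
  have 1: "m1 (m2 x y) = (scale A ((-1) powi n) (mA (dA a) a') - mA a (dA a'), 0)"
  proof -
    have "m2 x y = (- scale A ((-1) powi n) (mA a a'), 0)"
      unfolding m2_def sx(1) by (simp add: x(1) y(1))
    then show ?thesis
      using dA_mA[OF x(2), of a'] by (simp add: m1_def neg_one_powi_Suc scale_right_diff_distrib)
  qed
  have 2: "m2 (m1 x) y = (scale A c a' - scale A ((-1) powi n) (mA (dA a) a'), 0)"
  proof -
    have "m2 (m1 x) y = (scale A ((-1) powi n) (scale A c a' - mA (dA a) a'), 0)"
      by (simp add: m2_def ss) (simp add: m1_def x(1) y(1))
    then show ?thesis by (simp add: scale_right_diff_distrib c)
  qed
  have 3: "m2 (\<sigma> x) (m1 y) = (- scale A c' a + mA a (dA a'), 0)"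
    by (simp add: m2_def ss) (simp add: m1_def x(1) y(1))
  show "m1 (m2 x y) = scale V (snd x) y - scale V (snd y) x - m2 (m1 x) y - m2 (\<sigma> x) (m1 y)"
    unfolding 1 2 3 by (simp add: x(1) y(1) mult.commute)
qed

text \<open>Associativity of \<open>A\<close>: applying \<open>\<sigma>\<close> to
  \<open>m2 x y\<close> removes the minus and moves the sign operator from \<open>x\<close> to
  \<open>y\<close>, after which both sides are the same triple product.\<close>

lemma m2_m2:
  assumes "fst x \<in> UA" "fst y \<in> UA" "fst z \<in> UA"
  shows "m2 (\<sigma> x) (m2 y z) = - m2 (m2 x y) z"
proof -
  note lin_s = \<sigma>_simps' bilin_simps[OF m2_bilin]
  have "fst (\<sigma> (m2 x y)) = mA (fst x) (fst (\<sigma> y))"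
  proof -
    have "\<sigma> (m2 x y) = (mA (fst x) (fst (\<sigma> y)), 0)"
    proof (rule V_eq_on_homog2[OF _ _ _ assms(1,2)])
      show "bilin (scale V) (scale V) (scale V) (\<lambda>x y. \<sigma> (m2 x y))"
        unfolding bilin_def lin_def by (simp only: lin_s) simp
      show "bilin (scale V) (scale V) (scale V) (\<lambda>x y. (mA (fst x) (fst (\<sigma> y)), 0))"
        unfolding bilin_def lin_def by (simp only: lin_s) simp
      fix n m x y assume h: "x \<in> homog V n" "y \<in> homog V m"
      have "bar_cobar V W \<sigma>" by (rule bar_cobar_VW)
      then have "\<sigma> (\<sigma> x) = x" using homog_V_U[OF h(1)] by (simp add: bar_cobar.\<sigma>_\<sigma>)
      then show "\<sigma> (m2 x y) = (mA (fst x) (fst (\<sigma> y)), 0)"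
        by (simp only: m_eqs(2)[OF h]) (simp add: m2_def)
    qed
    then show ?thesis by simp
  qed
  moreover have "\<sigma> (\<sigma> x) = x" using assms(1) bar_cobar.\<sigma>_\<sigma>[OF bar_cobar_VW, of x] by simp
  ultimately show ?thesis by (simp add: m2_def mA_assoc)
qed

lemma curved_VW: "curved V W \<sigma> m1 m2 snd"
proof (intro curved.intro bar_maps_m curved_axioms.intro)
  note lin_s = \<sigma>_simps' lin_simps[OF m_lin(1)] bilin_simps[OF m2_bilin]
  show "lin (scale V) (*) snd" by (rule snd_lin)
  fix x y z assume "x \<in> underlying V" "y \<in> underlying V" "z \<in> underlying V"
  then have U: "fst x \<in> UA" "fst y \<in> UA" "fst z \<in> UA" by simp_all
  show "\<sigma> (m1 x) = - m1 (\<sigma> x)"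
  proof (rule V_eq_on_homog[OF VV.vector_space_axioms _ _ _ U(1)])
    show "\<sigma> (m1 x) = - m1 (\<sigma> x)" if "x \<in> homog V n" for n x using m_eqs(1)[OF that that] .
  qed (unfold lin_def, (simp only: lin_s, simp)+)
  show "\<sigma> (m2 x y) = - m2 (\<sigma> x) (\<sigma> y)"
  proof (rule V_eq_on_homog2[OF _ _ _ U(1,2)])
    show "\<sigma> (m2 x y) = - m2 (\<sigma> x) (\<sigma> y)" if "x \<in> homog V n" "y \<in> homog V m" for n m x y
      using m_eqs(2)[OF that] .
  qed (unfold bilin_def lin_def, (simp only: lin_s, simp)+)
  show "m1 (m1 x) = 0" by (simp add: m1_def zero_prod_def)
  show "m1 (m2 x y) = scale V (snd x) y - scale V (snd y) x - m2 (m1 x) y - m2 (\<sigma> x) (m1 y)"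
  proof (rule V_eq_on_homog2[OF _ _ _ U(1,2)])
    show "m1 (m2 x y) = scale V (snd x) y - scale V (snd y) x - m2 (m1 x) y - m2 (\<sigma> x) (m1 y)"
      if "x \<in> homog V n" "y \<in> homog V m" for n m x y
      using m_eqs(3)[OF that] .
    show "bilin (scale V) (scale V) (scale V) (\<lambda>x y. m1 (m2 x y))"
      unfolding bilin_def lin_def by (simp only: lin_s) simp
    show "bilin (scale V) (scale V) (scale V)
      (\<lambda>x y. scale V (snd x) y - scale V (snd y) x - m2 (m1 x) y - m2 (\<sigma> x) (m1 y))"
      unfolding bilin_def lin_def by (simp only: lin_s)
        (simp add: algebra_simps scale_right_distrib scale_left_distrib scale_right_diff_distrib)
  qed
  show "m2 (\<sigma> x) (m2 y z) = - m2 (m2 x y) z" using m2_m2[OF U] .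
  show "snd (\<sigma> x) = snd x"
  proof (rule V_eq_on_homog[OF vector_space_mult _ snd_lin _ U(1)])
    show "lin (scale V) (*) (\<lambda>x. snd (\<sigma> x))" by (rule lin_compose[OF \<sigma>_lin snd_lin])
    show "snd (\<sigma> x) = snd x" if "x \<in> homog V n" for n x
    proof (cases "n = -2")
      case False
      then show ?thesis using that by (simp add: \<sigma>_homog[OF that] mem_Times_iff)
    qed (simp add: \<sigma>_homog[OF that])
  qed
  show "snd (m1 x) = 0" "snd (m2 x y) = 0" by (simp_all add: m1_def m2_def)
qed

lemma curved_homotopy_VW: "curved_homotopy V W \<sigma> m1 m2 snd xi"
  by (intro curved_homotopy.intro curved_VW curved_homotopy_axioms.intro) (simp_all add: xi_def)

end

sublocale cobar_bar_algebra \<subseteq> CH: curved_homotopy V W \<sigma> m1 m2 snd xi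
  by (rule curved_homotopy_VW)

section \<open>The differentials of \<open>C(A)\<close>\<close>

lemma pure_cong:
  fixes V :: "('k::field, 'v::ab_group_add, 'm) gvs_scheme" and V' :: "('k, 'v, 'n) gvs_scheme"
  assumes "scale V = scale V'" "underlying V = underlying V'"
  shows "pure V = pure V'"
  unfolding pure_def multilinear_def assms ..

lemma graded_space_cong:
  fixes V :: "('k::field, 'v::ab_group_add, 'm) gvs_scheme" and V' :: "('k, 'v, 'n) gvs_scheme"
  assumes "graded_space V" "scale V' = scale V" "homog V' = homog V"
  shows "graded_space V'"
  using assms unfolding graded_space_def graded_space_axioms_def by simp

lemma sum_greaterThanLessThan_Suc:
  fixes g :: "nat \<Rightarrow> 'a::comm_monoid_add"
  assumes "0 < n"
  shows "(\<Sum>i\<in>{0<..<Suc n}. g i) = g (Suc 0) + (\<Sum>i\<in>{0<..<n}. g (Suc i))"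
  unfolding atLeastSucLessThan_greaterThanLessThan[symmetric] sum.shift_bounds_Suc_ivl
  using assms by (rule sum.atLeast_Suc_lessThan)

sublocale cobar_bar_algebra \<subseteq> GW: graded_tspace W
proof -
  have "graded_space (Bar R)"
    by (rule graded_space_cong[OF VV.graded_reduced_tensors]) (simp_all add: Bar_def bar_space_def)
  then show "graded_tspace W"
    by (intro graded_tspace.intro WW.tspace_axioms graded_shift)
qed

sublocale cobar_bar_algebra \<subseteq> DB: bar_maps V W \<sigma> md m2
  by (rule bar_maps_d)

sublocale cobar_bar_algebra \<subseteq> BB: bar_maps V W \<sigma> mb mz
  by (rule bar_maps_b)

context cobar_bar_algebra
begin

lemma fst_UA [simp]:
  "fst (m1 x) \<in> UA" "fst (md x) \<in> UA" "fst (mb x) \<in> UA" "fst (m2 x y) \<in> UA" "fst x \<in> UA \<Longrightarrow> fst (\<sigma> x) \<in> UA"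
  by (simp_all add: m1_def md_def mb_def m2_def \<sigma>_U)

lemma underlying_bar_space: "underlying (bar_space R) = VV.Tr"
  by (simp only: bar_space_def VV.Tr_eq)

lemma homog_bar_space: "homog (bar_space R) m = VV.TH m \<inter> VV.Tr"
  by (simp only: bar_space_def VV.reduced_TH)

lemma pure_bar_space: "pure (bar_space R) = pure W"
  by (rule pure_cong) (simp_all add: underlying_bar_space, simp add: bar_space_def reduced_tensors_def)

lemma sgW_eq: "c \<in> VV.Tr \<Longrightarrow> WW.sg c = pure W [c]"
  by (rule WW.sg_eq) simp

lemma pureW2: "c \<in> VV.Tr \<Longrightarrow> c' \<in> VV.Tr \<Longrightarrow> pure W [c, c'] = WW.mul (WW.sg c) (WW.sg c')"
  by (simp add: WW.pure_Cons flip: sgW_eq)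

section \<open>The recursive coproduct agrees with deconcatenation\<close>

lemma deconcatenation_lin: "lin tscale tscale (deconcatenation R)"
  by (simp add: lin_def deconcatenation_def fun_eq_iff pointwise tscale_def)

text \<open>The term of index 1 is the cut after the head; the others are the cuts of the tail,
  shifted by one and lengthened by \<open>ext\<close>.\<close>

lemma deconc_pure:
  "set xs \<subseteq> VV.U \<Longrightarrow>
    CH.deconc (pure V xs) = (\<Sum>i\<in>{0<..<length xs}. pure W [pure V (take i xs), pure V (drop i xs)])"
proof (induction xs)
  case (Cons x xs)
  then have U: "fst x \<in> UA" "set xs \<subseteq> VV.U" by auto
  note T = VV.pure_T[OF U(2)]
  have "CH.deconc (pure V (x # xs)) = WW.mul (WW.sg (VV.sg x)) (WW.sg (VV.red (pure V xs))) + CH.ext x (CH.deconc (pure V xs))"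
    using U T by (simp add: VV.pure_Cons)
  also have "CH.ext x (CH.deconc (pure V xs)) =
      (\<Sum>i\<in>{0<..<length xs}. pure W [pure V (x # take i xs), pure V (drop i xs)])"
  proof -
    have "CH.ext x (pure W [pure V (take i xs), pure V (drop i xs)]) = pure W [pure V (x # take i xs), pure V (drop i xs)]"
      if "i \<in> {0<..<length xs}" for i
    proof -
      have s: "set (take i xs) \<subseteq> VV.U" "set (drop i xs) \<subseteq> VV.U" "take i xs \<noteq> []" "drop i xs \<noteq> []"
        using U(2) that by (auto dest: in_set_takeD in_set_dropD)
      have c: "pure V (x # take i xs) = VV.mul (VV.sg x) (pure V (take i xs))"
        using U(1) s(1) by (simp add: VV.pure_Cons)
      have "pure V (take i xs) \<in> VV.Tr" "pure V (drop i xs) \<in> VV.Tr"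
        using s by (simp_all only: VV.pure_Tr not_False_eq_True)
      then show ?thesis unfolding c by (simp add: pureW2)
    qed
    then show ?thesis
      unfolding Cons.IH[OF U(2)] by (simp only: CH.ext_simps cong: sum.cong)
  qed
  also have "WW.mul (WW.sg (VV.sg x)) (WW.sg (VV.red (pure V xs))) + \<dots> =
      (\<Sum>i\<in>{0<..<length (x # xs)}. pure W [pure V (take i (x # xs)), pure V (drop i (x # xs))])"
  proof (cases xs)
    case (Cons y ys)
    have "VV.red (pure V xs) = pure V xs" "pure V xs \<in> VV.Tr" using VV.pure_Tr[OF _ U(2)] by (simp_all add: Cons)
    moreover have "0 < length xs" by (simp add: Cons)
    ultimately show ?thesis
      using U(1) by (simp add: sum_greaterThanLessThan_Suc pureW2 flip: VV.sg_eq)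
  qed simp
  finally show ?case .
qed simp

lemma deconcatenation_eq: "F \<in> VV.T \<Longrightarrow> deconcatenation R F = CH.deconc F"
proof (induction rule: VV.T_span_induct)
  case (pure xs)
  have "vector_space (scale R)" using graded_R by (simp add: graded_space_def)
  moreover have "set xs \<subseteq> underlying R" using pure by (simp only: underlying_shift)
  ultimately show ?case
    unfolding deconc_pure[OF pure] pure_bar_space[symmetric] by (rule deconcatenation_pure)
qed (simp_all add: lin_simps[OF deconcatenation_lin])

lemma st_TH: "F \<in> VV.TH m \<Longrightarrow> CH.st F = tscale ((-1) powi m) F"
  unfolding CH.st_def by (rule VV.stt_TH[OF \<sigma>_lin \<sigma>_homog])

lemma coder_TH:
  assumes "bar_maps V W \<sigma> e f" "\<And>x n. x \<in> homog V n \<Longrightarrow> e x \<in> homog V (n + 1)"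
    "\<And>x y n m. x \<in> homog V n \<Longrightarrow> y \<in> homog V m \<Longrightarrow> f x y \<in> homog V (n + m + 1)" "F \<in> VV.TH m"
  shows "CH.coder e f F \<in> VV.TH (m + 1)"
proof -
  interpret X: bar_maps V W \<sigma> e f by fact
  have mu: "CH.mu f x F \<in> VV.TH (n + m + 1)" if "x \<in> homog V n" "F \<in> VV.TH m" for x F n m
    using that(2)
  proof (induction rule: VV.TH_induct)
    case (Cons y k F m)
    have "VV.mul (VV.sg (f x y)) F \<in> VV.TH (n + k + 1 + m)"
      by (intro VV.mul_TH VV.sg_TH assms(3) that Cons)
    then show ?case using Cons homog_V_U[OF Cons(1)] by (simp add: VV.TH_T add_ac)
  qed simp_all
  show ?thesis
    using assms(4)
  proof (induction rule: VV.TH_induct)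
    case (Cons x n F m)
    have "VV.mul (VV.sg (e x)) F \<in> VV.TH (n + 1 + m)" "CH.mu f x F \<in> VV.TH (n + m + 1)"
      "VV.mul (VV.sg (\<sigma> x)) (CH.coder e f F) \<in> VV.TH (n + (m + 1))"
      unfolding \<sigma>_homog[OF Cons(1)]
      by (intro VV.mul_TH VV.sg_TH assms(2) mu VV.homog_closed Cons)+
    then show ?case using Cons homog_V_U[OF Cons(1)] by (simp add: VV.TH_T add_ac)
  qed simp_all
qed

lemma b_TH:
  assumes "F \<in> VV.TH m"
  shows "DB.b F \<in> VV.TH (m + 1)" "BB.b F \<in> VV.TH (m + 1)"
proof -
  show "DB.b F \<in> VV.TH (m + 1)" by (rule coder_TH[OF bar_maps_d m_homog(2) m_homog(4) assms])
  show "BB.b F \<in> VV.TH (m + 1)"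
    by (rule coder_TH[OF bar_maps_b m_homog(3) _ assms]) (simp_all only: mz_def VV.homog_closed)
qed

subsection \<open>The bar differential\<close>

lemma sweedlerD:
  assumes "sweedler (bar_space R) (deconcatenation R) c ts" "c \<in> VV.T"
  shows "CH.deconc c = (\<Sum>(m, c', c'') \<leftarrow> ts. WW.mul (WW.sg c') (WW.sg c''))"
    and "(m, c', c'') \<in> set ts \<Longrightarrow> c' \<in> VV.TH m \<and> c' \<in> VV.Tr \<and> c'' \<in> VV.Tr"
proof -
  show t: "(m, c', c'') \<in> set ts \<Longrightarrow> c' \<in> VV.TH m \<and> c' \<in> VV.Tr \<and> c'' \<in> VV.Tr" for m c' c''
    using assms(1) unfolding sweedler_def underlying_bar_space homog_bar_space by auto
  have "CH.deconc c = (\<Sum>(m, c', c'') \<leftarrow> ts. pure W [c', c''])"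
    using assms unfolding sweedler_def pure_bar_space by (auto simp: deconcatenation_eq)
  also have "\<dots> = (\<Sum>(m, c', c'') \<leftarrow> ts. WW.mul (WW.sg c') (WW.sg c''))"
    by (intro arg_cong[where f = sum_list] map_cong refl) (auto dest: t simp: pureW2)
  finally show "CH.deconc c = (\<Sum>(m, c', c'') \<leftarrow> ts. WW.mul (WW.sg c') (WW.sg c''))" .
qed

text \<open>A coproduct has many Sweedler representations. The required sum is the linear map
  \<open>DB.cobar_b\<close> applied to the coproduct, hence the same for all of them.\<close>

lemma coderivation_DB: "coderivation (bar_space R) (deconcatenation R) DB.b"
  unfolding coderivation_def linear_map_of_degree_def linear_map_def underlying_bar_space
proof (intro conjI allI ballI impI)
  show "DB.b x \<in> homog (bar_space R) (m + 1)" if "x \<in> homog (bar_space R) m" for m x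
    using that unfolding homog_bar_space by (simp add: b_TH VV.Tr_T)
  fix c ts assume c: "c \<in> VV.Tr" and ts: "sweedler (bar_space R) (deconcatenation R) c ts"
  note S = sweedlerD[OF ts VV.Tr_T[OF c]]
  have "deconcatenation R (DB.b c) = DB.cobar_b (CH.deconc c)"
    using c by (simp add: deconcatenation_eq VV.Tr_T DB.deconc_b)
  also have "\<dots> = (\<Sum>(m, c', c'') \<leftarrow> ts. DB.cobar_b (WW.mul (WW.sg c') (WW.sg c'')))"
    unfolding S(1) lin_sum_list[OF DB.cobar_b_lin] by (simp add: case_prod_unfold)
  also have "\<dots> = (\<Sum>(m, c', c'')\<leftarrow>ts. pure (bar_space R) [DB.b c', c'']
      + tscale ((-1) powi m) (pure (bar_space R) [c', DB.b c'']))"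
    unfolding pure_bar_space
  proof (intro arg_cong[where f = sum_list] map_cong refl)
    fix t assume "t \<in> set ts"
    moreover obtain m c' c'' where "t = (m, c', c'')" by (cases t)
    ultimately show "(case t of (m, c', c'') \<Rightarrow> DB.cobar_b (WW.mul (WW.sg c') (WW.sg c''))) =
      (case t of (m, c', c'') \<Rightarrow> pure W [DB.b c', c''] + tscale ((-1) powi m) (pure W [c', DB.b c'']))"
      using S(2)[of m c' c''] by (simp add: pureW2 VV.Tr_T st_TH[of c' m])
  qed
  finally show "deconcatenation R (DB.b c) = (\<Sum>(m, c', c'')\<leftarrow>ts. pure (bar_space R) [DB.b c', c'']
      + tscale ((-1) powi m) (pure (bar_space R) [c', DB.b c'']))" .
qed (simp_all add: VV.Tr_T bar_space_def reduced_tensors_def)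

lemma is_bar_differential_DB: "is_bar_differential R DB.b"
  unfolding is_bar_differential_def
proof (intro conjI allI ballI impI coderivation_DB)
  show "tpart V 1 (DB.b (bar_word R [x])) = bar_word R [- diff R x]" if "x \<in> underlying R" for x
    using that by (simp add: VV.sg_eq[symmetric] md_def dA_eq)
  show "tpart V 1 (DB.b (bar_word R [x, y])) = bar_word R [scale R ((-1) powi m) (mult R x y)]"
    if "x \<in> homog R m" "y \<in> underlying R" for m x y
  proof -
    have x: "x \<in> homog V (m - 1)" using that(1) by simp
    have U: "fst x \<in> UA" "fst y \<in> UA" using homog_V_U[OF x] that(2) by simp_all
    have "m2 x y = scale R ((-1) powi m) (mult R x y)"
      unfolding m2_def \<sigma>_homog[OF x] using U by (simp add: mA_eq neg_one_powi_pred)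
    moreover have "tpart V 1 (DB.b (bar_word R [x, y])) = VV.sg (m2 x y)"
      using U by (simp add: VV.pure_Cons)
    ultimately show ?thesis using U by (simp add: VV.sg_eq mA_eq)
  qed
  show "tpart V 1 (DB.b (bar_word R xs)) = 0" if "set xs \<subseteq> underlying R \<and> 3 \<le> length xs" for xs
  proof -
    have "xs = hd xs # hd (tl xs) # hd (tl (tl xs)) # tl (tl (tl xs))"
      using that by (cases xs; cases "tl xs"; cases "tl (tl xs)") simp_all
    then obtain x y z ws where xs: "xs = x # y # z # ws" by blast
    have U: "fst x \<in> UA" "fst y \<in> UA" "fst z \<in> UA" "set ws \<subseteq> VV.U" using that by (auto simp: xs)
    have "pure V (z # ws) \<in> VV.Tr" using U by (intro VV.pure_Tr) auto
    then show ?thesis using U by (simp add: xs VV.pure_Cons[of x] VV.pure_Cons[of y] VV.Tr_T)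
  qed
qed

text \<open>\<open>k\<close> joins the factors of \<open>c \<boxtimes> c'\<close> again if
  \<open>c\<close> is one letter. A word with at least two letters has exactly one such cut, so
  \<open>k\<close> of the coproduct recovers everything but the one-letter part.\<close>

lemma deconc_kernel:
  assumes "F \<in> VV.Tr" "CH.deconc F = 0" "tpart V 1 F = 0"
  shows "F = 0"
proof -
  define k where "k = CH.pairing tscale (\<lambda>c c'. VV.mul (tpart V (Suc 0) c) c')"
  have "bilin tscale tscale tscale (\<lambda>c c'. VV.mul (tpart V (Suc 0) c) c')"
    by (simp add: bilin_def lin_def)
  note P = CH.pairing[OF vector_space_tscale this, folded k_def]
  note P_s = lin_simps[OF P(1)]
  have P_ext: "k (CH.ext x G) = 0" if "G \<in> CH.C2" "fst x \<in> UA" for x G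
    using that by (induction rule: CH.C2_induct) (simp_all add: P P_s)
  have "F = k (CH.deconc F) + tpart V 1 F"
  proof (rule VV.red_eq[OF vector_space_tscale _ _ _ assms(1)])
    show "lin tscale tscale (\<lambda>F. F)" by (simp add: lin_def)
    show "lin tscale tscale (\<lambda>F. k (CH.deconc F) + tpart V 1 F)"
      by (simp add: lin_def P_s tens.scale_right_distrib)
    fix x F assume "x \<in> VV.U" "F \<in> VV.T"
    then show "VV.mul (VV.sg x) F = k (CH.deconc (VV.mul (VV.sg x) F)) + tpart V 1 (VV.mul (VV.sg x) F)"
      by (simp add: P_s P_ext P(2) VV.tpart_Cons VV.tpart_0) (simp add: VV.red_def)
  qed
  then show ?thesis using assms by (simp add: P_s)
qed

lemma word_sweedler:
  assumes "xs \<noteq> []" "homog_word V xs ns"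
  defines "ts \<equiv> map (\<lambda>i. (sum_list (take i ns), pure V (take i xs), pure V (drop i xs))) [1..<length xs]"
  shows "sweedler (bar_space R) (deconcatenation R) (pure V xs) ts"
proof -
  have U: "set xs \<subseteq> VV.U" by (rule VV.homog_word_set[OF assms(2)])
  have "pure V (take i xs) \<in> VV.TH (sum_list (take i ns)) \<inter> VV.Tr" "pure V (drop i xs) \<in> VV.Tr"
    if "i \<in> {1..<length xs}" for i
  proof -
    have "homog_word V (take i xs) (take i ns)" using assms(2) by (simp add: homog_word_def list_all2_takeI)
    moreover have "set (take i xs) \<subseteq> VV.U" "set (drop i xs) \<subseteq> VV.U" "take i xs \<noteq> []" "drop i xs \<noteq> []"
      using U that by (auto dest: in_set_takeD in_set_dropD)
    ultimately show "pure V (take i xs) \<in> VV.TH (sum_list (take i ns)) \<inter> VV.Tr" "pure V (drop i xs) \<in> VV.Tr"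
      by (simp_all only: VV.pure_TH VV.pure_Tr IntI not_False_eq_True)
  qed
  moreover have "deconcatenation R (pure V xs) = (\<Sum>(m, c', c'') \<leftarrow> ts. pure W [c', c''])"
    unfolding deconcatenation_eq[OF VV.pure_T[OF U]] deconc_pure[OF U] atLeastSucLessThan_greaterThanLessThan[symmetric]
    by (simp add: ts_def interv_sum_list_conv_sum_set_nat comp_def)
  ultimately show ?thesis
    unfolding sweedler_def pure_bar_space underlying_bar_space homog_bar_space
    by (auto simp: ts_def)
qed

lemma Tr_span: "VV.Tr = tens.span {pure V xs |xs ns. xs \<noteq> [] \<and> homog_word V xs ns}"
  by (simp only: VV.Tr_eq[symmetric] underlying_reduced_tensors)

text \<open>Induction on the length of a word: the coproduct of its image involves \<open>b\<close>
  on proper subwords only, the one-letter part of the image is prescribed by the components, and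
  \<open>deconc_kernel\<close> says that these two determine it.\<close>

lemma bar_differential_unique:
  assumes "is_bar_differential R b" "c \<in> VV.Tr"
  shows "b c = DB.b c"
proof -
  have b: "b x \<in> VV.Tr" "y \<in> VV.Tr \<Longrightarrow> b (x + y) = b x + b y" "b (tscale r x) = tscale r (b x)"
    if "x \<in> VV.Tr" for x y r
    using assms(1) that
    unfolding is_bar_differential_def coderivation_def linear_map_of_degree_def linear_map_def underlying_bar_space
    by (simp_all add: bar_space_def reduced_tensors_def)
  have cod: "deconcatenation R (e c) = (\<Sum>(m, c', c'') \<leftarrow> ts. pure W [e c', c''] + tscale ((-1) powi m) (pure W [c', e c'']))"
    if "is_bar_differential R e" "c \<in> VV.Tr" "sweedler (bar_space R) (deconcatenation R) c ts" for e c ts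
    using that unfolding is_bar_differential_def coderivation_def underlying_bar_space pure_bar_space by blast
  have words: "b (pure V xs) = DB.b (pure V xs)" if "xs \<noteq> []" "homog_word V xs ns" for xs ns
    using that
  proof (induction xs arbitrary: ns rule: length_induct)
    case (1 xs)
    let ?ts = "map (\<lambda>i. (sum_list (take i ns), pure V (take i xs), pure V (drop i xs))) [1..<length xs]"
    have IH: "b (pure V (take i xs)) = DB.b (pure V (take i xs))" "b (pure V (drop i xs)) = DB.b (pure V (drop i xs))"
      if "i \<in> {1..<length xs}" for i
    proof -
      have "homog_word V (take i xs) (take i ns)" "homog_word V (drop i xs) (drop i ns)"
        using 1(3) by (simp_all add: homog_word_def list_all2_takeI list_all2_dropI)
      moreover have "length (take i xs) < length xs" "length (drop i xs) < length xs" "take i xs \<noteq> []" "drop i xs \<noteq> []"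
        using that by auto
      ultimately show "b (pure V (take i xs)) = DB.b (pure V (take i xs))" "b (pure V (drop i xs)) = DB.b (pure V (drop i xs))"
        using 1(1) by blast+
    qed
    have U: "set xs \<subseteq> VV.U" by (rule VV.homog_word_set[OF 1(3)])
    have Tr: "pure V xs \<in> VV.Tr" by (rule VV.pure_Tr[OF 1(2) U])
    note S = word_sweedler[OF 1(2,3)]
    have "deconcatenation R (b (pure V xs)) = deconcatenation R (DB.b (pure V xs))"
      unfolding cod[OF assms(1) Tr S] cod[OF is_bar_differential_DB Tr S]
      by (intro arg_cong[where f = sum_list] map_cong refl) (auto simp: IH)
    then have 2: "CH.deconc (b (pure V xs) - DB.b (pure V xs)) = 0"
      using b(1)[OF Tr] Tr by (simp add: deconcatenation_eq VV.Tr_T)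
    have 3: "tpart V 1 (b (pure V xs)) = tpart V 1 (DB.b (pure V xs))"
    proof -
      consider x where "xs = [x]" | x y where "xs = [x, y]" | "3 \<le> length xs"
        using 1(2) by (cases xs; cases "tl xs"; cases "tl (tl xs)") auto
      then show ?thesis
      proof cases
        case (1 x)
        then show ?thesis
          using U assms(1) is_bar_differential_DB unfolding is_bar_differential_def by simp
      next
        case (2 x y)
        with \<open>homog_word V xs ns\<close> obtain n where "x \<in> homog R (n + 1)"
          by (auto simp: homog_word_def list_all2_Cons1 simp del: R_simps)
        then show ?thesis
          using 2 U assms(1) is_bar_differential_DB unfolding is_bar_differential_def
          by (simp del: R_simps)
      next
        case 3
        moreover have "set xs \<subseteq> underlying R" using U by (simp only: underlying_shift)
        ultimately show ?thesis
          using assms(1) is_bar_differential_DB unfolding is_bar_differential_def by simp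
      qed
    qed
    have "b (pure V xs) - DB.b (pure V xs) = 0"
    proof (rule deconc_kernel[OF _ 2])
      show "b (pure V xs) - DB.b (pure V xs) \<in> VV.Tr" using b(1)[OF Tr] VV.Tr_T[OF Tr] by simp
      show "tpart V 1 (b (pure V xs) - DB.b (pure V xs)) = 0" by (simp only: CH.tpart_simps 3 diff_self)
    qed
    then show ?case by simp
  qed
  have "c \<in> VV.Tr \<and> b c = DB.b c"
    using assms(2) unfolding Tr_span
  proof (induction rule: tens.span_induct_alt)
    case base
    then show ?case unfolding Tr_span[symmetric] using b(3)[of 0 0] by simp
  next
    case (step r x y)
    then obtain xs ns where xs: "x = pure V xs" "xs \<noteq> []" "homog_word V xs ns" by blast
    then have "x \<in> VV.Tr" "b x = DB.b x" using words VV.pure_Tr VV.homog_word_set by blast+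
    with step(2) show ?case unfolding Tr_span[symmetric] by (simp add: b VV.Tr_T)
  qed
  then show ?thesis ..
qed

lemma bar_differential_eq: "c \<in> VV.Tr \<Longrightarrow> bar_differential R c = DB.b c"
  unfolding bar_differential_def
  by (rule bar_differential_unique) (rule someI[of "is_bar_differential R", OF is_bar_differential_DB])

subsection \<open>The three derivations\<close>

text \<open>The sign operator on the generators of the cobar construction, opposite to
  \<open>CH.st\<close> because of the shift.\<close>

definition nst :: "('k, 'a \<times> 'k) tens \<Rightarrow> ('k, 'a \<times> 'k) tens" where "nst c = - CH.st c"
definition gBar :: "('k, 'a \<times> 'k) tens \<Rightarrow> ('k, ('k, 'a \<times> 'k) tens) tens" where "gBar c = - WW.sg (DB.b c)"
definition gCobar :: "('k, 'a \<times> 'k) tens \<Rightarrow> ('k, ('k, 'a \<times> 'k) tens) tens" where "gCobar c = - CH.ksig (CH.deconc c)"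
definition gxi :: "('k, 'a \<times> 'k) tens \<Rightarrow> ('k, ('k, 'a \<times> 'k) tens) tens" where
  "gxi c = tscale (CH.eps c) WW.one - WW.sg (BB.b c)"

lemma g_lin: "lin (scale W) (scale W) nst" "lin (scale W) tscale gBar" "lin (scale W) tscale gCobar" "lin (scale W) tscale gxi"
proof -
  show "lin (scale W) (scale W) nst" unfolding W_simps(1) by (simp add: lin_def nst_def)
  show "lin (scale W) tscale gBar" unfolding W_simps(1) by (simp add: lin_def gBar_def)
  show "lin (scale W) tscale gCobar" unfolding W_simps(1) by (simp add: lin_def gCobar_def)
  show "lin (scale W) tscale gxi"
    unfolding W_simps(1)
    by (simp add: lin_def gxi_def tens.scale_left_distrib tens.scale_right_diff_distrib algebra_simps)
qed

lemma nst_homog: "c \<in> homog W n \<Longrightarrow> nst c = scale W ((-1) powi n) c"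
  by (simp add: nst_def st_TH[of c "n - 1"] neg_one_powi_pred)

lemma ext_TH:
  assumes "x \<in> homog V n" "G \<in> GW.TH m"
  shows "CH.ext x G \<in> GW.TH (n + m)"
  using assms(2)
proof (induction rule: GW.TH_induct)
  case (Cons c k G m)
  then have c: "c \<in> VV.TH (k - 1)" "c \<in> VV.Tr" by simp_all
  have "VV.mul (VV.sg x) c \<in> VV.TH (n + (k - 1))" by (intro VV.mul_TH VV.sg_TH assms(1) c)
  then have "VV.mul (VV.sg x) c \<in> homog W (n + k)" by (simp add: add_diff_eq)
  then have "WW.mul (WW.sg (VV.mul (VV.sg x) c)) G \<in> GW.TH (n + k + m)"
    by (intro GW.mul_TH GW.sg_TH Cons)
  then show ?case using Cons c by (simp add: GW.TH_T add_ac)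
qed simp_all

lemma deconc_TH: "F \<in> VV.TH m \<Longrightarrow> CH.deconc F \<in> GW.TH (m + 2)"
proof (induction rule: VV.TH_induct)
  case (Cons x n F m)
  \<comment> \<open>The empty word has degree 0, so removing it preserves homogeneity.\<close>
  have r: "VV.red F \<in> VV.TH m"
  proof (cases "VV.ctr F = 0")
    case False
    have "m = 0 \<or> VV.ctr F = 0" using Cons(2) by (induction rule: VV.TH_induct) auto
    with False Cons(2) show ?thesis by (simp add: VV.red_def VV.TH_T)
  qed (use Cons(2) in \<open>simp add: VV.red_def VV.TH_T\<close>)
  have "WW.sg (VV.sg x) \<in> GW.TH (n + 1)" "WW.sg (VV.red F) \<in> GW.TH (m + 1)"
    by (intro GW.sg_TH; simp add: VV.sg_TH[OF Cons(1)] r)+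
  from GW.mul_TH[OF this] ext_TH[OF Cons(1,3)]
  show ?case using homog_V_U[OF Cons(1)] Cons(2) by (simp add: VV.TH_T add_ac)
qed simp_all

lemma ksig_TH: "G \<in> GW.TH m \<Longrightarrow> CH.ksig G \<in> GW.TH m"
proof (induction rule: GW.TH_induct)
  case (Cons c k G m)
  then have c: "c \<in> VV.TH (k - 1)" "c \<in> VV.Tr" by simp_all
  have "CH.st c \<in> homog W k" using c by (simp add: st_TH[OF c(1)])
  then have "WW.mul (WW.sg (CH.st c)) G \<in> GW.TH (k + m)" by (intro GW.mul_TH GW.sg_TH Cons)
  then show ?case using Cons c by (simp add: GW.TH_T)
qed simp_all

lemma eps_TH: "F \<in> VV.TH m \<Longrightarrow> m = -2 \<or> CH.eps F = 0"
proof (induction rule: VV.TH_induct)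
  case (Cons x n F m)
  have "m = 0 \<or> VV.ctr F = 0" using Cons(2) by (induction rule: VV.TH_induct) auto
  moreover have "n = -2 \<or> snd x = 0" using homog_cases[OF Cons(1)] by auto
  ultimately show ?case using homog_V_U[OF Cons(1)] Cons(2) by (auto simp: VV.TH_T)
qed auto

lemma g_TH:
  assumes "c \<in> homog W n"
  shows "gBar c \<in> GW.TH (n + 1)" "gCobar c \<in> GW.TH (n + 1)" "gxi c \<in> GW.TH (n + 1)"
proof -
  have c: "c \<in> VV.TH (n - 1)" "c \<in> VV.Tr" using assms by simp_all
  have "DB.b c \<in> homog W (n + 1)" "BB.b c \<in> homog W (n + 1)"
    using b_TH[OF c(1)] c(2) by (simp_all add: VV.Tr_T)
  note s = this[THEN GW.sg_TH]
  show "gBar c \<in> GW.TH (n + 1)" using s(1) by (simp add: gBar_def)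
  show "gCobar c \<in> GW.TH (n + 1)" using ksig_TH[OF deconc_TH[OF c(1)]] by (simp add: gCobar_def add.commute)
  \<comment> \<open>\<open>eps\<close> sees only the word \<open>[xi]\<close>, a generator of degree
    -1; in that case the constant lies in degree n + 1 = 0.\<close>
  have "tscale (CH.eps c) WW.one \<in> GW.TH (n + 1)"
    using eps_TH[OF c(1)] by (cases "n = -1") auto
  then show "gxi c \<in> GW.TH (n + 1)" using s(2) by (simp add: gxi_def)
qed

lemma cobar_space_eq: "cobar_space (Bar R) = tensor_algebra W"
  by (simp add: cobar_space_def)

lemma derivation_g:
  assumes "g \<in> {gBar, gCobar, gxi}"
  shows "derivation (cobar_space (Bar R)) (cobar_mult (Bar R)) (WW.der nst g)"
  unfolding cobar_space_eq
  by (rule GW.derivation_der) (use assms g_lin g_TH nst_homog in auto)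

lemma der_g_sg:
  assumes "g \<in> {gBar, gCobar, gxi}" "c \<in> VV.Tr"
  shows "WW.der nst g (WW.sg c) = g c"
  by (rule WW.der_sg) (use assms g_lin in \<open>auto simp: gBar_def gCobar_def gxi_def CH.C2_T VV.Tr_T\<close>)

text \<open>The values of a differential are known only on generators given by certain words; this
  suffices as soon as their letters span \<open>V\<close>.\<close>

lemma derivation_eq_on_words:
  assumes D: "derivation (cobar_space (Bar R)) (cobar_mult (Bar R)) D"
    and g: "g \<in> {gBar, gCobar, gxi}"
    and S: "VV.U \<subseteq> VV.span S" "S \<subseteq> VV.U"
    and words: "\<And>xs. xs \<noteq> [] \<Longrightarrow> set xs \<subseteq> S \<Longrightarrow> D (WW.sg (pure V xs)) = g (pure V xs)"
    and F: "F \<in> WW.T"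
  shows "D F = WW.der nst g F"
proof (rule GW.derivation_eq_der[OF g_lin(1) nst_homog _ D[unfolded cobar_space_eq] _ F])
  show gl: "lin (scale W) tscale g" using g g_lin by auto
  then have g_simps: "g (x + y) = g x + g y" "g (tscale r x) = tscale r (g x)" "g 0 = 0" for x y r
    by (simp_all add: lin_simps[OF gl]) (use lin_scale[OF gl] in simp)
  have D_simps: "x \<in> WW.T \<Longrightarrow> y \<in> WW.T \<Longrightarrow> D (x + y) = D x + D y" "x \<in> WW.T \<Longrightarrow> D (tscale r x) = tscale r (D x)" for x y r
    using D unfolding derivation_def linear_map_of_degree_def linear_map_def cobar_space_eq WW.T_eq by auto
  fix c assume "c \<in> WW.U"
  then have "c \<in> VV.Tr" by simp
  from VV.Tr_span_letters[OF S this] show "D (WW.sg c) = g c"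
  proof (induction rule: tens.span_induct_alt)
    case base
    then show ?case using D_simps(2)[of 0 0] by (simp add: g_simps)
  next
    case (step r x y)
    then show ?case using words by (auto simp: D_simps g_simps)
  qed
qed

lemma d_Bar_eq: "F \<in> WW.T \<Longrightarrow> d_Bar (Bar R) F = WW.der nst gBar F"
proof -
  have dif: "diff (Bar R) = bar_differential R" by (simp add: Bar_def)
  have 1: "is_d_Bar (Bar R) (WW.der nst gBar)"
    unfolding is_d_Bar_def dif
  proof (intro conjI ballI derivation_g)
    fix c assume "c \<in> underlying (Bar R)"
    then have c: "c \<in> VV.Tr" by simp
    then show "WW.der nst gBar (gen (Bar R) c) = - gen (Bar R) (bar_differential R c)"
      using der_g_sg[of gBar c] by (simp add: bar_differential_eq gBar_def sgW_eq VV.Tr_T)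
  qed simp
  then have D: "is_d_Bar (Bar R) (d_Bar (Bar R))" unfolding d_Bar_def by (rule someI[where P = "is_d_Bar (Bar R)"])
  assume "F \<in> WW.T"
  then show ?thesis
  proof (rule derivation_eq_on_words[rotated -1])
    show "derivation (cobar_space (Bar R)) (cobar_mult (Bar R)) (d_Bar (Bar R))"
      using D by (simp add: is_d_Bar_def)
    show "VV.U \<subseteq> VV.span VV.U" by (rule VV.span_superset)
    fix xs assume "xs \<noteq> []" "set xs \<subseteq> VV.U"
    then have c: "pure V xs \<in> VV.Tr" by (rule VV.pure_Tr)
    then show "d_Bar (Bar R) (WW.sg (pure V xs)) = gBar (pure V xs)"
      using D c unfolding is_d_Bar_def dif by (simp add: bar_differential_eq gBar_def sgW_eq VV.Tr_T)
  qed simp_all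
qed

lemma sweedler_Bar:
  "sweedler (Bar R) (comult (Bar R)) c ts \<longleftrightarrow> sweedler (bar_space R) (deconcatenation R) c ts"
proof -
  have "pure (Bar R) = pure (bar_space R)"
    by (rule pure_cong) (simp_all add: underlying_bar_space, simp add: Bar_def)
  then show ?thesis unfolding sweedler_def by (simp add: underlying_bar_space) (simp add: Bar_def)
qed

text \<open>The sum is the linear map \<open>CH.ksig\<close> applied to the coproduct, so its value
  does not depend on the Sweedler representation.\<close>

lemma gCobar_sweedler:
  assumes "c \<in> VV.Tr" "sweedler (Bar R) (comult (Bar R)) c ts"
  shows "gCobar c =
    - (\<Sum>(m, c', c'') \<leftarrow> ts. tscale ((-1) powi m) (cobar_mult (Bar R) (gen (Bar R) c') (gen (Bar R) c'')))"
proof -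
  note S = sweedlerD[OF assms(2)[unfolded sweedler_Bar] VV.Tr_T[OF assms(1)]]
  have "CH.ksig (CH.deconc c) = (\<Sum>(m, c', c'') \<leftarrow> ts. CH.ksig (WW.mul (WW.sg c') (WW.sg c'')))"
    unfolding S(1) lin_sum_list[OF CH.ksig_lin] by (simp add: case_prod_unfold)
  also have "\<dots> = (\<Sum>(m, c', c'') \<leftarrow> ts. tscale ((-1) powi m) (cobar_mult (Bar R) (gen (Bar R) c') (gen (Bar R) c'')))"
  proof (intro arg_cong[where f = sum_list] map_cong refl)
    fix t assume "t \<in> set ts"
    moreover obtain m c' c'' where t: "t = (m, c', c'')" by (cases t)
    ultimately have c: "c' \<in> VV.TH m" "c' \<in> VV.Tr" "c'' \<in> VV.Tr" using S(2)[of m c' c''] by auto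
    then have "CH.ksig (WW.mul (WW.sg c') (WW.sg c'')) = tscale ((-1) powi m) (WW.mul (WW.sg c') (WW.sg c''))"
      by (simp add: st_TH[OF c(1)])
    then show "(case t of (m, c', c'') \<Rightarrow> CH.ksig (WW.mul (WW.sg c') (WW.sg c''))) =
      (case t of (m, c', c'') \<Rightarrow> tscale ((-1) powi m) (cobar_mult (Bar R) (gen (Bar R) c') (gen (Bar R) c'')))"
      using c by (simp add: t WW.mul_eq flip: sgW_eq)
  qed
  finally show ?thesis by (simp add: gCobar_def)
qed

text \<open>Uniqueness is tested on words in homogeneous letters, for which
  \<open>word_sweedler\<close> provides an explicit representation of the coproduct.\<close>

lemma d_Cobar_eq: "F \<in> WW.T \<Longrightarrow> d_Cobar (Bar R) F = WW.der nst gCobar F"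
proof -
  have 1: "is_d_Cobar (Bar R) (WW.der nst gCobar)"
    unfolding is_d_Cobar_def
  proof (intro conjI ballI allI impI derivation_g)
    fix c ts assume "c \<in> underlying (Bar R)" and ts: "sweedler (Bar R) (comult (Bar R)) c ts"
    then have c: "c \<in> VV.Tr" by simp
    show "WW.der nst gCobar (gen (Bar R) c) =
      - (\<Sum>(m, c', c'') \<leftarrow> ts. tscale ((-1) powi m) (cobar_mult (Bar R) (gen (Bar R) c') (gen (Bar R) c'')))"
      using der_g_sg[of gCobar c] c unfolding gCobar_sweedler[OF c ts] sgW_eq[OF c] by simp
  qed simp
  then have D: "is_d_Cobar (Bar R) (d_Cobar (Bar R))" unfolding d_Cobar_def by (rule someI[where P = "is_d_Cobar (Bar R)"])
  assume "F \<in> WW.T"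
  then show ?thesis
  proof (rule derivation_eq_on_words[rotated -1])
    show "derivation (cobar_space (Bar R)) (cobar_mult (Bar R)) (d_Cobar (Bar R))"
      using D by (simp add: is_d_Cobar_def)
    show "VV.U \<subseteq> VV.span (\<Union>n. homog V n)" by (simp only: underlying_def order.refl)
    show "(\<Union>n. homog V n) \<subseteq> VV.U" using VV.homog_U by blast
    fix xs assume xs: "xs \<noteq> []" "set xs \<subseteq> (\<Union>n. homog V n)"
    have "\<exists>ns. homog_word V xs ns"
      using xs(2)
    proof (induction xs)
      case (Cons x xs)
      then obtain n ns where "x \<in> homog V n" "homog_word V xs ns" by (auto simp del: V_simps)
      then have "homog_word V (x # xs) (n # ns)" by (simp add: homog_word_def del: V_simps)
      then show ?case ..
    qed (auto simp: homog_word_def)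
    then obtain ns where ns: "homog_word V xs ns" ..
    have c: "pure V xs \<in> VV.Tr" using xs(1) VV.homog_word_set[OF ns] by (rule VV.pure_Tr)
    note s = word_sweedler[OF xs(1) ns, folded sweedler_Bar]
    have "pure V xs \<in> underlying (Bar R)" using c by simp
    then show "d_Cobar (Bar R) (WW.sg (pure V xs)) = gCobar (pure V xs)"
      using D s unfolding gCobar_sweedler[OF c s] sgW_eq[OF c] is_d_Cobar_def by blast
  qed simp_all
qed

lemma BB_mu [simp]: "F \<in> VV.T \<Longrightarrow> CH.mu mz x F = 0"
  by (induction rule: VV.T_induct) (simp_all, simp add: mz_def)

definition xi_letter :: "'a \<times> 'k \<Rightarrow> int \<Rightarrow> bool" where
  "xi_letter x n \<longleftrightarrow> x = xi \<and> n = -1 \<or> (\<exists>a\<in>homog A n. x = incl a)"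

lemma xi_letter_homog: "xi_letter x n \<Longrightarrow> x \<in> homog V (n - 1)"
  by (auto simp: xi_letter_def xi_def incl_def)

lemma xi_neq_incl [simp]: "xi \<noteq> incl a" "incl a \<noteq> xi"
  by (simp_all add: xi_def incl_def)

lemma mb_xi [simp]: "mb xi = incl (unit A)" and mb_incl [simp]: "mb (incl a) = 0"
  by (simp_all add: mb_def xi_def incl_def zero_prod_def)

lemma fst_incl [simp]: "fst (incl a) = a" "snd (incl a) = 0" "fst xi = 0" "snd xi = 1"
  by (simp_all add: incl_def xi_def)

text \<open>A head equal to xi gives the term of index 0. Moving past the head shifts the other
  indices and multiplies by its sign, whose exponent is \<open>n - 1\<close> after
  suspension.\<close>

lemma BB_b_word:
  "list_all2 xi_letter xs ns \<Longrightarrow>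
    BB.b (pure V xs) = (\<Sum>i<length xs. if xs ! i = xi
      then tscale ((-1) powi (\<Sum>j<i. ns ! j - 1)) (pure V (xs[i := incl (unit A)])) else 0)"
proof (induction rule: list_all2_induct)
  case (Cons x xs n ns)
  have x: "x \<in> homog V (n - 1)" using Cons(1) by (rule xi_letter_homog)
  have xU: "fst x \<in> UA" using homog_V_U[OF x] .
  have U: "set xs \<subseteq> VV.U"
    using Cons(2) by (induction rule: list_all2_induct) (auto simp: homog_V_U[OF xi_letter_homog] simp del: homog_V_U)
  let ?u = "incl (unit A) :: 'a \<times> 'k"
  let ?f = "\<lambda>i. if xs ! i = xi then tscale ((-1) powi (\<Sum>j<i. ns ! j - 1)) (pure V (xs[i := ?u])) else 0"
  let ?g = "\<lambda>i. if (x # xs) ! i = xi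
      then tscale ((-1) powi (\<Sum>j<i. (n # ns) ! j - 1)) (pure V ((x # xs)[i := ?u])) else 0"
  have g0: "VV.mul (VV.sg (mb x)) (pure V xs) = ?g 0"
    using Cons(1) U by (auto simp: xi_letter_def VV.pure_Cons)
  have gS: "VV.mul (VV.sg (\<sigma> x)) (?f i) = ?g (Suc i)" if "i < length xs" for i
  proof (cases "xs ! i = xi")
    case True
    have "set (xs[i := ?u]) \<subseteq> insert ?u (set xs)" by (rule set_update_subset_insert)
    then have "set (xs[i := ?u]) \<subseteq> VV.U" using U by auto
    then have "pure V (x # xs[i := ?u]) = VV.mul (VV.sg x) (pure V (xs[i := ?u]))"
      using xU by (intro VV.pure_Cons) simp_all
    then show ?thesis
      unfolding \<sigma>_homog[OF x] VV.sg_simps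
      by (simp add: True sum.lessThan_Suc_shift power_int_add mult.commute del: sum.lessThan_Suc V_simps)
  qed simp
  have "BB.b (pure V (x # xs)) = VV.mul (VV.sg (mb x)) (pure V xs) + VV.mul (VV.sg (\<sigma> x)) (BB.b (pure V xs))"
    using xU U by (simp add: VV.pure_Cons VV.pure_T)
  also have "\<dots> = ?g 0 + (\<Sum>i<length xs. ?g (Suc i))"
    unfolding Cons.IH VV.mul_simps g0 by (intro arg_cong2[where f = "(+)"] sum.cong refl) (simp only: gS lessThan_iff)
  also have "\<dots> = (\<Sum>i<length (x # xs). ?g i)"
    by (simp only: list.size add_Suc_right add_0_right sum.lessThan_Suc_shift)
  finally show ?case .
qed simp

lemma gxi_word:
  assumes "list_all2 xi_letter xs ns" "2 \<le> length xs"
  shows "gxi (pure V xs) =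
    - (\<Sum>i | i < length xs \<and> xs ! i = xi.
        tscale ((-1) powi (\<Sum>j<i. ns ! j - 1)) (gen_word A (xs[i := incl (unit A)])))"
proof -
  have U: "set xs \<subseteq> VV.U"
    using assms(1) by (induction rule: list_all2_induct) (auto simp: homog_V_U[OF xi_letter_homog])
  have "CH.eps (pure V xs) = 0"
  proof -
    obtain x y ws where xs: "xs = x # y # ws"
      using assms(2) by (cases xs; cases "tl xs") auto
    show ?thesis using U by (simp add: xs VV.pure_Cons VV.pure_T)
  qed
  moreover have "WW.sg (BB.b (pure V xs)) = (\<Sum>i | i < length xs \<and> xs ! i = xi.
        tscale ((-1) powi (\<Sum>j<i. ns ! j - 1)) (gen_word A (xs[i := incl (unit A)])))"
  proof -
    have "WW.sg (BB.b (pure V xs)) = (\<Sum>i<length xs. if xs ! i = xi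
      then tscale ((-1) powi (\<Sum>j<i. ns ! j - 1)) (WW.sg (pure V (xs[i := incl (unit A)]))) else 0)"
      unfolding BB_b_word[OF assms(1)] CH.Jsg_simps by (intro sum.cong) auto
    also have "\<dots> = (\<Sum>i | i < length xs \<and> xs ! i = xi.
        tscale ((-1) powi (\<Sum>j<i. ns ! j - 1)) (WW.sg (pure V (xs[i := incl (unit A)]))))"
      by (subst sum.inter_filter[symmetric]) (auto intro: sum.cong)
    also have "\<dots> = (\<Sum>i | i < length xs \<and> xs ! i = xi.
        tscale ((-1) powi (\<Sum>j<i. ns ! j - 1)) (gen_word A (xs[i := incl (unit A)])))"
    proof (rule sum.cong[OF refl])
      fix i assume "i \<in> {i. i < length xs \<and> xs ! i = xi}"
      have "set (xs[i := incl (unit A)]) \<subseteq> insert (incl (unit A)) (set xs)" by (rule set_update_subset_insert)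
      then have "pure V (xs[i := incl (unit A)]) \<in> VV.Tr"
        using U assms(2) by (intro VV.pure_Tr) auto
      then show "tscale ((-1) powi (\<Sum>j<i. ns ! j - 1)) (WW.sg (pure V (xs[i := incl (unit A)]))) =
        tscale ((-1) powi (\<Sum>j<i. ns ! j - 1)) (gen_word A (xs[i := incl (unit A)]))"
        by (simp only: sgW_eq)
    qed
    finally show ?thesis .
  qed
  ultimately show ?thesis by (simp add: gxi_def)
qed

text \<open>The letter xi and the homogeneous elements of \<open>A\<close> together span
  \<open>V\<close>, so the words on which d_xi is prescribed determine it.\<close>

lemma d_xi_eq: "F \<in> WW.T \<Longrightarrow> d_xi A F = WW.der nst gxi F"
proof -
  have w: "set xs \<subseteq> VV.U" if "list_all2 xi_letter xs ns" for xs ns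
    using that by (induction rule: list_all2_induct) (auto simp: homog_V_U[OF xi_letter_homog])
  have g1: "WW.der nst gxi (gen_word A xs) = gxi (pure V xs)" if "xs \<noteq> []" "set xs \<subseteq> VV.U" for xs
    using der_g_sg[of gxi "pure V xs"] VV.pure_Tr[OF that] by (simp add: sgW_eq)
  have xi1: "gxi (pure V [xi]) = WW.one - gen_word A [incl (unit A)]"
  proof -
    have "gxi (pure V [xi]) = WW.one - WW.sg (VV.sg (incl (unit A)))"
      by (simp add: gxi_def flip: VV.sg_eq)
    also have "VV.sg (incl (unit A)) = pure V [incl (unit A)]" by (rule VV.sg_eq) simp
    finally show ?thesis using VV.pure_Tr[of "[incl (unit A)]"] by (simp add: sgW_eq)
  qed
  have inc: "gxi (pure V [incl a]) = 0" if "a \<in> UA" for a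
    using that by (simp add: gxi_def flip: VV.sg_eq)
  have 1: "is_d_xi A (WW.der nst gxi)"
    unfolding is_d_xi_def xi_letter_def[symmetric]
  proof (intro conjI allI ballI impI derivation_g)
    show "WW.der nst gxi (gen_word A [xi]) = WW.one - gen_word A [incl (unit A)]"
      using g1[of "[xi]"] xi1 by simp
    show "WW.der nst gxi (gen_word A [incl a]) = 0" if "a \<in> UA" for a
      using g1[of "[incl a]"] inc[OF that] that by simp
    fix xs ns assume h: "2 \<le> length xs \<and> list_all2 xi_letter xs ns"
    then have "xs \<noteq> []" by auto
    from g1[OF this w[of xs ns]] gxi_word[of xs ns] h
    show "WW.der nst gxi (gen_word A xs) = - (\<Sum>i | i < length xs \<and> xs ! i = xi.
        tscale ((-1) powi (\<Sum>j<i. ns ! j - 1)) (gen_word A (xs[i := incl (unit A)])))"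
      by simp
  qed simp
  then have D: "is_d_xi A (d_xi A)" unfolding d_xi_def by (rule someI[where P = "is_d_xi A"])
  let ?S = "{x. \<exists>n. xi_letter x n}"
  assume "F \<in> WW.T"
  then show ?thesis
  proof (rule derivation_eq_on_words[rotated -1])
    show "derivation (cobar_space (Bar R)) (cobar_mult (Bar R)) (d_xi A)"
      using D by (simp add: is_d_xi_def)
    show "?S \<subseteq> VV.U" using VV.homog_U[OF xi_letter_homog] by blast
    show "VV.U \<subseteq> VV.span ?S"
    proof
      fix x assume "x \<in> VV.U"
      then have x: "fst x \<in> UA" by simp
      have "xi \<in> ?S" by (auto simp: xi_letter_def)
      then have 1: "scale V (snd x) xi \<in> VV.span ?S" by (intro VV.span_scale VV.span_base)
      have "incl (fst x) \<in> VV.span ?S"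
        using x unfolding underlying_def
      proof (induction rule: span_induct_alt)
        case base
        show ?case using VV.span_zero[of ?S] by (simp only: incl_def zero_prod_def)
      next
        case (step r a b)
        then have "incl a \<in> ?S" by (auto simp: xi_letter_def)
        then have "scale V r (incl a) + incl b \<in> VV.span ?S"
          by (rule VV.span_add[OF VV.span_scale[OF VV.span_base] step(2)])
        moreover have "incl (scale A r a + b) = scale V r (incl a) + incl b" by (simp add: incl_def)
        ultimately show ?case by (simp only:)
      qed
      then have "incl (fst x) + scale V (snd x) xi \<in> VV.span ?S" using 1 by (rule VV.span_add)
      moreover have "x = incl (fst x) + scale V (snd x) xi" by (simp add: incl_def xi_def prod_eq_iff)
      ultimately show "x \<in> VV.span ?S" by (simp only:)
    qed
    fix xs assume xs: "xs \<noteq> []" "set xs \<subseteq> ?S"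
    have "\<exists>ns. list_all2 xi_letter xs ns"
      using xs(2)
    proof (induction xs)
      case (Cons x xs)
      then obtain n ns where "xi_letter x n" "list_all2 xi_letter xs ns" by auto
      then have "list_all2 xi_letter (x # xs) (n # ns)" by simp
      then show ?case ..
    qed auto
    then obtain ns where ns: "list_all2 xi_letter xs ns" ..
    have c: "pure V xs \<in> VV.Tr" by (rule VV.pure_Tr[OF xs(1) w[OF ns]])
    show "d_xi A (WW.sg (pure V xs)) = gxi (pure V xs)"
      unfolding sgW_eq[OF c]
    proof (cases "2 \<le> length xs")
      case True
      then show "d_xi A (gen_word A xs) = gxi (pure V xs)"
        using D ns unfolding is_d_xi_def xi_letter_def[symmetric] by (simp add: gxi_word[OF ns True])
    next
      case False
      then obtain x where x: "xs = [x]" using xs(1) by (cases xs; cases "tl xs") auto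
      then obtain n where "xi_letter x n" using ns by (auto simp: list_all2_Cons1)
      then show "d_xi A (gen_word A xs) = gxi (pure V xs)"
        using D unfolding is_d_xi_def xi_letter_def x by (auto simp: xi1 inc homog_UA)
    qed
  qed simp_all
qed

subsection \<open>\<open>C(A)\<close> is a dg algebra\<close>

lemma CH_b_eq: "F \<in> VV.T \<Longrightarrow> CH.b F = DB.b F + BB.b F"
proof (induction rule: VV.T_induct)
  case (Cons x F)
  have "m1 x = md x + mb x" by (simp add: m1_def md_def mb_def)
  with Cons show ?case by simp
qed (simp_all add: tens.scale_right_distrib)

lemma dC_gen_eq: "c \<in> VV.Tr \<Longrightarrow> CH.dC_gen c = gBar c + gCobar c + gxi c"
  by (simp add: CH.dC_gen_def gBar_def gCobar_def gxi_def CH_b_eq VV.Tr_T)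

lemma dC_eq: "F \<in> WW.T \<Longrightarrow> d_Bar (Bar R) F + d_Cobar (Bar R) F + d_xi A F = CH.dC F"
proof -
  assume F: "F \<in> WW.T"
  have "WW.der nst gBar F + WW.der nst gCobar F + WW.der nst gxi F = CH.dC F"
  proof (rule WW.lin_eq[OF vector_space_tscale _ CH.dC_lin _ _ F])
    note d = WW.der[OF g_lin(1,2)] WW.der[OF g_lin(1,3)] WW.der[OF g_lin(1,4)]
    show "lin tscale tscale (\<lambda>F. WW.der nst gBar F + WW.der nst gCobar F + WW.der nst gxi F)"
      by (simp add: lin_def lin_simps[OF d(1)] lin_simps[OF d(5)] lin_simps[OF d(9)] tens.scale_right_distrib add_ac)
    show "WW.der nst gBar WW.one + WW.der nst gCobar WW.one + WW.der nst gxi WW.one = CH.dC WW.one"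
      by (simp only: d CH.dC_one add_0_right)
    fix c G assume h: "c \<in> WW.U" "G \<in> WW.T"
      "WW.der nst gBar G + WW.der nst gCobar G + WW.der nst gxi G = CH.dC G"
    have c: "c \<in> VV.Tr" using h(1) by simp
    have "CH.dC (WW.mul (WW.sg c) G) = WW.mul (CH.dC_gen c) G - WW.mul (WW.sg (CH.st c)) (CH.dC G)"
      using c h(2) by simp
    also have "\<dots> = WW.mul (gBar c + gCobar c + gxi c) G + WW.mul (WW.sg (nst c)) (CH.dC G)"
      by (simp add: dC_gen_eq[OF c] nst_def)
    finally show "WW.der nst gBar (WW.mul (WW.sg c) G) + WW.der nst gCobar (WW.mul (WW.sg c) G)
        + WW.der nst gxi (WW.mul (WW.sg c) G) = CH.dC (WW.mul (WW.sg c) G)"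
      unfolding d(4)[OF h(1,2)] d(8)[OF h(1,2)] d(12)[OF h(1,2)] h(3)[symmetric] by (simp add: add_ac)
  qed
  then show ?thesis by (simp add: d_Bar_eq d_Cobar_eq d_xi_eq F)
qed

abbreviation C :: "('k, ('k, ('k, 'a \<times> 'k) tens) tens) dga" where "C \<equiv> CobarBar A"

lemma C_simps [simp]:
  "scale C = tscale" "homog C n = GW.TH n" "mult C = tmult W" "unit C = WW.one"
  by (simp_all add: CobarBar_def cobar_space_eq)

lemma C_underlying [simp]: "underlying C = WW.T"
  unfolding WW.T_eq[symmetric] by (simp add: underlying_def)

lemma C_diff [simp]: "F \<in> WW.T \<Longrightarrow> diff C F = CH.dC F"
  by (simp add: CobarBar_def dC_eq)

lemma dC_TH:
  assumes "F \<in> GW.TH n"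
  shows "CH.dC F \<in> GW.TH (n + 1)"
proof -
  have "WW.der nst CH.dC_gen F \<in> GW.TH (n + 1)"
  proof (rule GW.der_TH[OF g_lin(1) CH.dC_gen_lin' _ _ assms])
    show "nst x \<in> homog W n" if "x \<in> homog W n" for x n
      unfolding nst_homog[OF that] using that by (rule GW.homog_closed)
    show "CH.dC_gen x \<in> GW.TH (n + 1)" if "x \<in> homog W n" for x n
      using dC_gen_eq[of x] g_TH[OF that] that by simp
  qed
  then show ?thesis by (simp add: CH.dC_def nst_def[abs_def])
qed

lemma dg_algebra_C: "dg_algebra C"
proof -
  have gC: "graded_space C"
    by (rule graded_space_cong[OF GW.graded_tensor_algebra]) (simp_all add: fun_eq_iff)
  have lm: "linear_map_of_degree 1 C C (diff C)"
    unfolding linear_map_of_degree_def linear_map_def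
    by (simp add: dC_TH GW.TH_T)
  interpret C: graded_space C by (rule gC)
  show ?thesis
  proof
    show "linear_map_of_degree 1 C C (diff C)" by (rule lm)
    show "diff C (diff C x) = 0" if "x \<in> underlying C" for x using that by (simp add: CH.dC_dC)
    show "mult C x y \<in> homog C (m + n)" if "x \<in> homog C m" "y \<in> homog C n" for x y m n
      using that by (simp add: WW.mul_eq GW.TH_T GW.mul_TH)
    show "linear_map C C (\<lambda>x. mult C x y)" if "y \<in> underlying C" for y
      using that by (simp add: linear_map_def WW.mul_eq)
    show "linear_map C C (\<lambda>y. mult C x y)" if "x \<in> underlying C" for x
      using that by (simp add: linear_map_def WW.mul_eq)
    show "mult C (mult C x y) z = mult C x (mult C y z)"
      if "x \<in> underlying C" "y \<in> underlying C" "z \<in> underlying C" for x y z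
      using that by (simp add: WW.mul_eq WW.mul_assoc)
    show "derivation C (mult C) (diff C)"
      unfolding derivation_def
    proof (intro conjI lm allI ballI)
      fix m x y assume x: "x \<in> homog C m" and y: "y \<in> underlying C"
      have x': "x \<in> GW.TH m" "x \<in> WW.T" using x by (simp_all add: GW.TH_T)
      have "CH.s2 x = tscale ((-1) powi m) x"
        using GW.stt_TH[OF g_lin(1) nst_homog x'(1)] by (simp add: CH.s2_def nst_def[abs_def])
      then show "diff C (mult C x y) = mult C (diff C x) y + scale C ((-1) powi m) (mult C x (diff C y))"
        using x' y by (simp add: WW.mul_eq CH.dC_mul)
    qed
    show "unit C \<in> homog C 0" by simp
    show "mult C (unit C) x = x" "mult C x (unit C) = x" if "x \<in> underlying C" for x
      using that by (simp_all add: WW.mul_eq)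
  qed
qed

end

section \<open>The projection and its homotopy inverse\<close>

context dg_space
begin

lemma homog_underlying: "x \<in> homog V n \<Longrightarrow> x \<in> underlying V"
  unfolding underlying_def by (rule span_base) auto

lemma diff_add: "x \<in> homog V n \<Longrightarrow> y \<in> homog V n \<Longrightarrow> diff V (x + y) = diff V x + diff V y"
  and diff_scale: "x \<in> homog V n \<Longrightarrow> diff V (scale V c x) = scale V c (diff V x)"
  using diff_degree by (simp_all add: linear_map_of_degree_def linear_map_def homog_underlying)

lemma diff_neg: "x \<in> homog V n \<Longrightarrow> diff V (- x) = - diff V x"
  using diff_scale[of x n "-1"] by simp

lemma diff_zero: "diff V 0 = 0"
  using diff_scale[of 0 0 0] by simp

lemma equiv_cohomologous: "equiv (cocycles V n) (cohomologous V n)"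
proof (rule equivI)
  show "cohomologous V n \<subseteq> cocycles V n \<times> cocycles V n" by (auto simp: cohomologous_def)
  show "refl_on (cocycles V n) (cohomologous V n)"
  proof (rule refl_onI)
    show "(x, x) \<in> cohomologous V n" if "x \<in> cocycles V n" for x
      using that diff_zero homog_closed(1)[of "n - 1"] by (auto simp: cohomologous_def intro!: image_eqI[of _ _ 0])
  qed
  show "sym (cohomologous V n)"
  proof (rule symI)
    fix x y assume "(x, y) \<in> cohomologous V n"
    then obtain w where w: "x \<in> cocycles V n" "y \<in> cocycles V n" "w \<in> homog V (n - 1)" "x - y = diff V w"
      by (auto simp: cohomologous_def)
    then have "y - x = diff V (- w)" using diff_neg[OF w(3)] by (metis minus_diff_eq)
    with w show "(y, x) \<in> cohomologous V n" by (auto simp: cohomologous_def)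
  qed
  show "trans (cohomologous V n)"
  proof (rule transI)
    fix x y z assume "(x, y) \<in> cohomologous V n" "(y, z) \<in> cohomologous V n"
    then obtain w w' where w: "x \<in> cocycles V n" "z \<in> cocycles V n" "w \<in> homog V (n - 1)" "x - y = diff V w"
      "w' \<in> homog V (n - 1)" "y - z = diff V w'" by (auto simp: cohomologous_def)
    then have "x - z = diff V (w + w')" by (simp add: diff_add[OF w(3,5)] flip: w(4,6))
    with w show "(x, z) \<in> cohomologous V n" by (auto simp: cohomologous_def)
  qed
qed

end

text \<open>\<open>f\<close> preserves and reflects the relations, which makes the map of classes
  well defined and injective; hitting every class of \<open>Y\<close> makes it surjective.\<close>

lemma bij_betw_quotient:
  assumes "equiv X r" "equiv Y s" "\<And>x. x \<in> X \<Longrightarrow> f x \<in> Y"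
    "\<And>x x'. x \<in> X \<Longrightarrow> x' \<in> X \<Longrightarrow> (x, x') \<in> r \<longleftrightarrow> (f x, f x') \<in> s"
    "\<And>y. y \<in> Y \<Longrightarrow> \<exists>x\<in>X. (f x, y) \<in> s"
  shows "bij_betw (\<lambda>K. s `` (f ` K)) (X // r) (Y // s)"
proof -
  have cl: "s `` (f ` (r `` {x})) = s `` {f x}" if x: "x \<in> X" for x
  proof
    have "(x, x) \<in> r" using assms(1) x by (simp add: equiv_def refl_on_def)
    then show "s `` {f x} \<subseteq> s `` (f ` (r `` {x}))" by blast
    show "s `` (f ` (r `` {x})) \<subseteq> s `` {f x}"
    proof
      fix y assume "y \<in> s `` (f ` (r `` {x}))"
      then obtain x' where x': "(x, x') \<in> r" "(f x', y) \<in> s" by blast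
      then have "x' \<in> X" using assms(1) by (auto simp: equiv_def refl_on_def)
      then have "(f x, f x') \<in> s" using assms(4) x x' by blast
      then show "y \<in> s `` {f x}" using x'(2) assms(2) by (auto simp: equiv_def dest: transD)
    qed
  qed
  show ?thesis
    unfolding bij_betw_def
  proof
    show "inj_on (\<lambda>K. s `` (f ` K)) (X // r)"
    proof (rule inj_onI)
      fix K K' assume K: "K \<in> X // r" "K' \<in> X // r" "s `` (f ` K) = s `` (f ` K')"
      then obtain x x' where x: "K = r `` {x}" "x \<in> X" "K' = r `` {x'}" "x' \<in> X" by (auto elim!: quotientE)
      then have "s `` {f x} = s `` {f x'}" using K(3) cl by simp
      then have "(f x, f x') \<in> s" using assms(2,3) x by (simp add: eq_equiv_class)
      then have "(x, x') \<in> r" using assms(4) x by blast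
      then show "K = K'" unfolding x by (rule equiv_class_eq[OF assms(1)])
    qed
    show "(\<lambda>K. s `` (f ` K)) ` (X // r) = Y // s"
    proof
      show "(\<lambda>K. s `` (f ` K)) ` (X // r) \<subseteq> Y // s"
        by (auto elim!: quotientE simp: cl intro!: quotientI assms(3))
      show "Y // s \<subseteq> (\<lambda>K. s `` (f ` K)) ` (X // r)"
      proof
        fix L assume "L \<in> Y // s"
        then obtain y where y: "L = s `` {y}" "y \<in> Y" by (auto elim!: quotientE)
        then obtain x where x: "x \<in> X" "(f x, y) \<in> s" using assms(5) by blast
        then have "L = s `` (f ` (r `` {x}))" unfolding cl[OF x(1)] y(1) using equiv_class_eq[OF assms(2)] by blast
        then show "L \<in> (\<lambda>K. s `` (f ` K)) ` (X // r)" using x(1) by (blast intro: quotientI)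
      qed
    qed
  qed
qed

section \<open>The projection onto \<open>A\<close> as a map of dg algebras\<close>

context cobar_bar_algebra
begin

text \<open>The component in \<open>A\<close> of the one-letter part; \<open>proj\<close> is its
  multiplicative extension.\<close>

definition lpart :: "('k, 'a \<times> 'k) tens \<Rightarrow> 'a" where
  "lpart = VV.trec (scale A) 0 (\<lambda>x F. scale A (VV.ctr F) (pA (fst x))) (\<lambda>_ _. 0)"

definition proj :: "('k, ('k, 'a \<times> 'k) tens) tens \<Rightarrow> 'a" where
  "proj = WW.trec (scale A) (unit A) (\<lambda>_ _. 0) (\<lambda>c a. mA (lpart c) a)"

lemma lpart_lin: "lin tscale (scale A) lpart"
  and lpart_Cons [simp]: "fst x \<in> UA \<Longrightarrow> F \<in> VV.T \<Longrightarrow> lpart (VV.mul (VV.sg x) F) = scale A (VV.ctr F) (fst x)"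
proof -
  have 1: "bilin (scale V) tscale (scale A) (\<lambda>x F. scale A (VV.ctr F) (pA (fst x)))"
    by (simp add: bilin_def lin_def lin_simps[OF pA_lin] scale_left_distrib scale_right_distrib mult.commute)
  note R = VV.trec[OF vector_space_axioms 1 VV.bilin_zero[OF vector_space_axioms], where w = 0, folded lpart_def]
  show "lin tscale (scale A) lpart" by (rule R)
  show "lpart (VV.mul (VV.sg x) F) = scale A (VV.ctr F) (fst x)" if "fst x \<in> UA" "F \<in> VV.T"
    using R(4)[of x F] that by simp
qed

lemmas lpart_simps [simp] = lin_simps[OF lpart_lin]

lemma lpart_sg [simp]: "fst x \<in> UA \<Longrightarrow> lpart (VV.sg x) = fst x"
  using lpart_Cons[of x VV.one] by simp

lemma lpart_UA [simp]: "F \<in> VV.Tr \<Longrightarrow> lpart F \<in> UA"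
proof -
  have "lpart (VV.red F) \<in> UA" if "F \<in> VV.T"
    using that by (induction rule: VV.T_induct) simp_all
  then show "F \<in> VV.Tr \<Longrightarrow> lpart F \<in> UA" by (simp add: VV.Tr_T)
qed

lemma proj_lin: "lin tscale (scale A) proj" and proj_one [simp]: "proj WW.one = unit A"
  and proj_Cons [simp]: "c \<in> VV.Tr \<Longrightarrow> G \<in> WW.T \<Longrightarrow> proj (WW.mul (WW.sg c) G) = mA (lpart c) (proj G)"
proof -
  have 2: "bilin (scale W) (scale A) (scale A) (\<lambda>c a. mA (lpart c) a)"
    unfolding W_simps(1) by (simp add: bilin_def lin_def)
  note R = WW.trec[OF vector_space_axioms WW.bilin_zero[OF vector_space_axioms] 2, where w = "unit A", folded proj_def]
  show "lin tscale (scale A) proj" "proj WW.one = unit A"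
    "c \<in> VV.Tr \<Longrightarrow> G \<in> WW.T \<Longrightarrow> proj (WW.mul (WW.sg c) G) = mA (lpart c) (proj G)"
    by (rule R | simp add: R)+
qed

lemmas proj_simps [simp] = lin_simps[OF proj_lin]

lemma proj_sg [simp]: "c \<in> VV.Tr \<Longrightarrow> proj (WW.sg c) = lpart c"
  using proj_Cons[of c WW.one] by simp

lemma proj_UA [simp]: "G \<in> WW.T \<Longrightarrow> proj G \<in> UA"
  by (induction rule: WW.T_induct) simp_all

lemma proj_mul: "F \<in> WW.T \<Longrightarrow> G \<in> WW.T \<Longrightarrow> proj (WW.mul F G) = mA (proj F) (proj G)"
  by (induction F rule: WW.T_induct) (simp_all add: WW.mul_assoc mA_assoc)

lemma ctr_TH: "F \<in> VV.TH m \<Longrightarrow> m = 0 \<or> VV.ctr F = 0"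
  by (induction rule: VV.TH_induct) auto

lemma lpart_TH: "F \<in> VV.TH m \<Longrightarrow> F \<in> VV.Tr \<Longrightarrow> lpart F \<in> homog A (m + 1)"
proof -
  have "lpart (VV.red F) \<in> homog A (m + 1)" if "F \<in> VV.TH m" for F m
    using that
  proof (induction rule: VV.TH_induct)
    case (Cons x n F m)
    then have "fst x \<in> homog A (n + 1)" using homog_cases[OF Cons(1)] by auto
    then show ?case using ctr_TH[OF Cons(2)] homog_V_U[OF Cons(1)] Cons(2) by (auto simp: VV.TH_T)
  qed simp_all
  then show "F \<in> VV.TH m \<Longrightarrow> F \<in> VV.Tr \<Longrightarrow> lpart F \<in> homog A (m + 1)" by fastforce
qed

lemma proj_TH: "G \<in> GW.TH m \<Longrightarrow> proj G \<in> homog A m"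
proof (induction rule: GW.TH_induct)
  case (Cons c n G m)
  then have c: "c \<in> VV.TH (n - 1)" "c \<in> VV.Tr" by simp_all
  have "lpart c \<in> homog A n" using lpart_TH[OF c] by simp
  from mA_homog[OF this Cons(3)] show ?case using c Cons(2) by (simp add: GW.TH_T)
qed (simp_all add: unit_degree)

text \<open>The Leibniz rule of \<open>A\<close> written with the sign of the suspended letter,
  which differs by a minus from that of the letter itself.\<close>

lemma dA_mA_letter:
  assumes "fst x \<in> UA" "a \<in> UA"
  shows "dA (mA (fst x) a) = mA (dA (fst x)) a - mA (fst (\<sigma> x)) (dA a)"
proof (rule V_eq_on_homog[OF vector_space_axioms _ _ _ assms(1)])
  show "lin (scale V) (scale A) (\<lambda>x. dA (mA (fst x) a))" by (simp add: lin_def)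
  show "lin (scale V) (scale A) (\<lambda>x. mA (dA (fst x)) a - mA (fst (\<sigma> x)) (dA a))"
    unfolding lin_def \<sigma>_simps' by (simp add: scale_right_diff_distrib algebra_simps)
  fix n x assume x: "x \<in> homog V n"
  then have "fst x \<in> homog A (n + 1)" using homog_cases[OF x] by auto
  from dA_mA[OF this assms(2)] show "dA (mA (fst x) a) = mA (dA (fst x)) a - mA (fst (\<sigma> x)) (dA a)"
    unfolding \<sigma>_homog[OF x] neg_one_powi_Suc by simp
qed

lemma dA_mA_lpart:
  assumes "c \<in> VV.Tr" "a \<in> UA"
  shows "dA (mA (lpart c) a) = mA (dA (lpart c)) a - mA (lpart (CH.st c)) (dA a)"
proof (rule VV.red_eq[OF vector_space_axioms _ _ _ assms(1)])
  show "lin tscale (scale A) (\<lambda>c. dA (mA (lpart c) a))" by (simp add: lin_def)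
  show "lin tscale (scale A) (\<lambda>c. mA (dA (lpart c)) a - mA (lpart (CH.st c)) (dA a))"
    by (simp add: lin_def scale_right_diff_distrib algebra_simps)
  fix x F assume "x \<in> VV.U" "F \<in> VV.T"
  then show "dA (mA (lpart (VV.mul (VV.sg x) F)) a) =
      mA (dA (lpart (VV.mul (VV.sg x) F))) a - mA (lpart (CH.st (VV.mul (VV.sg x) F))) (dA a)"
    using dA_mA_letter[of x a] assms(2) by (simp add: scale_right_diff_distrib)
qed

lemma proj_ext: "G \<in> CH.C2 \<Longrightarrow> fst x \<in> UA \<Longrightarrow> proj (CH.ext x G) = 0"
  by (induction rule: CH.C2_induct) (simp_all add: VV.Tr_T)

text \<open>On a single letter the constant from \<open>eps\<close> cancels the 1_A in
  \<open>m1\<close>, which leaves the differential of \<open>A\<close>. On two letters their product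
  in \<open>b\<close> cancels the product of the two factors of the coproduct. On longer words every
  term is sent to 0.\<close>

lemma proj_dC_gen:
  assumes "c \<in> VV.Tr"
  shows "proj (CH.dC_gen c) = dA (lpart c)"
proof (rule VV.red_eq[OF vector_space_axioms _ _ _ assms])
  show "lin tscale (scale A) (\<lambda>c. proj (CH.dC_gen c))" by (rule lin_compose[OF CH.dC_gen_lin proj_lin])
  show "lin tscale (scale A) (\<lambda>c. dA (lpart c))" by (rule lin_compose[OF lpart_lin dA_lin])
  fix x F assume x: "x \<in> VV.U" and F: "F \<in> VV.T"
  show "proj (CH.dC_gen (VV.mul (VV.sg x) F)) = dA (lpart (VV.mul (VV.sg x) F))"
    using F
  proof (induction rule: VV.T_induct)
    case one
    have "fst (m1 x) = scale A (snd x) (unit A) - dA (fst x)" by (simp add: m1_def)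
    then show ?case using x by simp
  next
    case (Cons y F)
    have "fst (m2 x y) = - mA (fst (\<sigma> x)) (fst y)" by (simp add: m2_def)
    moreover have "CH.dC_gen (VV.mul (VV.sg x) (VV.mul (VV.sg y) F)) =
        - WW.sg (VV.mul (VV.sg (m1 x)) (VV.mul (VV.sg y) F)) - WW.sg (VV.mul (VV.sg (m2 x y)) F)
        - WW.sg (VV.mul (VV.sg (\<sigma> x)) (CH.b (VV.mul (VV.sg y) F)))
        - WW.mul (WW.sg (VV.sg (\<sigma> x))) (WW.sg (VV.mul (VV.sg y) F))
        - CH.ext (\<sigma> x) (CH.ksig (CH.deconc (VV.mul (VV.sg y) F)))"
      using CH.dC_gen_Cons[OF x, of "VV.mul (VV.sg y) F"] CH.\<mu>_Cons[OF Cons(1,2)] by simp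
    moreover have "proj (CH.ext (\<sigma> x) (CH.ksig (CH.deconc (VV.mul (VV.sg y) F)))) = 0"
      using x by (intro proj_ext CH.ksig_T CH.deconc_C2) simp_all
    moreover have "VV.ctr (CH.b (VV.mul (VV.sg y) F)) = 0" "CH.b (VV.mul (VV.sg y) F) \<in> VV.T"
      by (rule CH.ctr_b CH.b_T; simp)+
    ultimately show ?case using x Cons(1,2) by (simp del: CH.b_Cons)
  qed simp_all
qed

lemma proj_dC: "G \<in> WW.T \<Longrightarrow> proj (CH.dC G) = dA (proj G)"
proof (induction rule: WW.T_induct)
  case (Cons c G)
  then have c: "c \<in> VV.Tr" by simp
  with Cons show ?case
    using dA_mA_lpart[OF c, of "proj G"] by (simp add: proj_mul proj_dC_gen VV.Tr_T)
qed simp_all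

lemma dg_algebra_hom_proj: "dg_algebra_hom C A proj"
proof (intro dg_algebra_hom.intro dg_algebra_C dg_algebra_axioms dg_algebra_hom_axioms.intro)
  show "linear_map_of_degree 0 C A proj"
    by (simp add: linear_map_of_degree_def linear_map_def proj_TH)
  show "proj (diff C x) = diff A (proj x)" if "x \<in> underlying C" for x
    using that by (simp add: proj_dC dA_eq)
  show "proj (mult C x y) = mult A (proj x) (proj y)" if "x \<in> underlying C" "y \<in> underlying C" for x y
    using that by (simp add: WW.mul_eq proj_mul mA_eq)
qed simp

section \<open>Degree of the homotopy, inclusion of \<open>A\<close>, and cohomology\<close>

lemma tpart_TH: "F \<in> VV.TH m \<Longrightarrow> tpart V n F \<in> VV.TH m"
proof (induction rule: VV.TH_span_induct)
  case (pure xs ns)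
  then show ?case using VV.pure_TH[of xs ns] by (simp add: tpart_pure)
qed simp_all

lemma homotopy_at_TH:
  assumes "c \<in> homog W k" "G \<in> GW.TH m"
  shows "CH.homotopy_at c G \<in> GW.TH (k + m - 1)"
  using assms(2)
proof (induction rule: GW.TH_induct)
  case (Cons c' n G m)
  have c: "c \<in> VV.TH (k - 1)" "c' \<in> VV.TH (n - 1)" "c' \<in> VV.Tr" using assms(1) Cons(1) by simp_all
  have t: "CH.st (tpart V 1 c) \<in> VV.TH (k - 1)"
    unfolding st_TH[OF tpart_TH[OF c(1)]] by (intro VV.TH_closed tpart_TH c)
  have "VV.mul (CH.st (tpart V 1 c)) c' \<in> VV.TH (k - 1 + (n - 1))" using t c(2) by (rule VV.mul_TH)
  moreover have "VV.mul (CH.st (tpart V 1 c)) c' \<in> VV.Tr"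
    using VV.Tr_T[OF c(3)] c(3)
  proof -
    have "VV.mul F c' \<in> VV.Tr" if "F \<in> VV.T" for F
      using that by (induction rule: VV.T_induct) (simp_all add: c(3) VV.Tr_T VV.mul_assoc)
    then show ?thesis using VV.TH_T[OF t] .
  qed
  ultimately have "VV.mul (CH.st (tpart V 1 c)) c' \<in> homog W (k + n - 1)" by (simp add: algebra_simps)
  from GW.mul_TH[OF GW.sg_TH[OF this] Cons(2)]
  show ?case using c(3) Cons(2) by (simp add: GW.TH_T algebra_simps)
qed simp_all

lemma homotopy_TH: "G \<in> GW.TH m \<Longrightarrow> CH.homotopy G \<in> GW.TH (m - 1)"
proof (induction rule: GW.TH_induct)
  case one
  have "VV.sg xi \<in> VV.TH (-2)" by (rule VV.sg_TH) (simp add: xi_def)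
  then have "VV.sg xi \<in> homog W (-1)" by simp
  from GW.sg_TH[OF this] show ?case by simp
next
  case (Cons c n G m)
  then show ?case using homotopy_at_TH[OF Cons(1,2)] by (simp add: GW.TH_T)
qed simp_all

text \<open>Inverse to \<open>proj\<close> on cohomology, but only a map of complexes: the unit of
  \<open>A\<close> goes to the letter \<open>[1_A]\<close> and not to \<open>one\<close>.\<close>

definition incl_C :: "'a \<Rightarrow> ('k, ('k, 'a \<times> 'k) tens) tens" where "incl_C a = WW.sg (VV.sg (incl a))"

lemma incl_C_lin: "lin (scale A) tscale incl_C"
proof -
  have "(incl (a + b) :: 'a \<times> 'k) = incl a + incl b" "incl (scale A r a) = scale V r (incl a)" for a b r
    by (simp_all add: incl_def)
  then show ?thesis unfolding lin_def incl_C_def by (simp only: VV.sg_simps CH.Jsg_simps simp_thms)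
qed

lemma incl_C_TH: "a \<in> homog A n \<Longrightarrow> incl_C a \<in> GW.TH n"
proof -
  assume "a \<in> homog A n"
  then have "VV.sg (incl a) \<in> VV.TH (n - 1)" by (intro VV.sg_TH) (simp add: incl_def)
  then show ?thesis unfolding incl_C_def by (intro GW.sg_TH) simp
qed

lemma proj_incl_C: "a \<in> UA \<Longrightarrow> proj (incl_C a) = a"
  by (simp add: incl_C_def)

lemma dC_incl_C: "a \<in> UA \<Longrightarrow> CH.dC (incl_C a) = incl_C (dA a)"
proof -
  assume a: "a \<in> UA"
  have "m1 (incl a) = - (incl (dA a) :: 'a \<times> 'k)" by (simp add: m1_def incl_def)
  then show ?thesis using a by (simp add: incl_C_def)
qed

text \<open>
  Subtracting \<open>d(h z)\<close> from a cocycle \<open>z\<close> lowers its number of letters, until only one is left.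
\<close>

lemma exact_if_proj_exact:
  assumes "z \<in> CH.Fil (Suc N)" "z \<in> GW.TH n" "CH.dC z = 0" "proj z = dA a" "a \<in> homog A (n - 1)"
  shows "\<exists>w\<in>GW.TH (n - 1). CH.dC w = z"
  using assms
proof (induction N arbitrary: z a)
  case 0
  \<comment> \<open>With at most one letter the defect is \<open>incl_C (proj z)\<close>, which here
    is \<open>incl_C (dA a)\<close>, itself a boundary.\<close>
  have "CH.defect z = incl_C (proj z)"
  proof (rule CH.defect_Fil_1[OF lin_compose[OF proj_lin incl_C_lin] _ _ 0(1)])
    show "incl_C (proj WW.one) = WW.sg (VV.sg (m1 xi))" by (simp add: incl_C_def m1_def incl_def)
    show "incl_C (proj (WW.sg (VV.sg x))) = WW.sg (VV.sg (x - scale V (snd x) xi))" if "x \<in> VV.U" for x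
    proof -
      have "x - scale V (snd x) xi = incl (fst x)" by (simp add: incl_def xi_def prod_eq_iff)
      then show ?thesis using that by (simp only: incl_C_def) simp
    qed
  qed
  then have "z = CH.dC (CH.homotopy z) + CH.dC (incl_C a)"
    using 0 by (simp add: CH.defect_def dC_incl_C homog_UA algebra_simps)
  moreover have "CH.homotopy z + incl_C a \<in> GW.TH (n - 1)"
    using homotopy_TH[OF 0(2)] incl_C_TH[OF 0(5)] by simp
  ultimately show ?case by (intro bexI[of _ "CH.homotopy z + incl_C a"]) simp_all
next
  case (Suc N)
  have hz: "CH.homotopy z \<in> GW.TH (n - 1)" by (rule homotopy_TH[OF Suc.prems(2)])
  have e: "CH.defect z = z - CH.dC (CH.homotopy z)" using Suc.prems(3) by (simp add: CH.defect_def)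
  \<comment> \<open>The defect is cohomologous to \<open>z\<close> and has a smaller bound on its
    letters; the primitive of its projection changes by \<open>proj (CH.homotopy z)\<close>.\<close>
  have "\<exists>w\<in>GW.TH (n - 1). CH.dC w = CH.defect z"
  proof (rule Suc.IH)
    show "CH.defect z \<in> CH.Fil (Suc N)" by (rule CH.defect_Fil[OF Suc.prems(1)])
    show "CH.defect z \<in> GW.TH n" unfolding e using dC_TH[OF hz] Suc.prems(2) by simp
    show "CH.dC (CH.defect z) = 0" unfolding e using Suc.prems(3) GW.TH_T[OF hz] by (simp add: CH.dC_dC)
    show "proj (CH.defect z) = dA (a - proj (CH.homotopy z))"
      unfolding e using Suc.prems(4) GW.TH_T[OF hz] by (simp add: proj_dC)
    show "a - proj (CH.homotopy z) \<in> homog A (n - 1)" using Suc.prems(5) proj_TH[OF hz] by simp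
  qed
  then obtain w where w: "w \<in> GW.TH (n - 1)" "CH.dC w = CH.defect z" by blast
  have "CH.dC (w + CH.homotopy z) = z" using w(2) by (simp add: e)
  then show ?case using w(1) hz by (intro bexI[of _ "w + CH.homotopy z"]) simp_all
qed

text \<open>Injectivity on cohomology is \<open>exact_if_proj_exact\<close> applied to a difference
  of cocycles; surjectivity comes from the section \<open>incl_C\<close>.\<close>

lemma quasi_isomorphism_proj: "quasi_isomorphism C A proj"
  unfolding quasi_isomorphism_def cohomology_map_def cohomology_def
proof
  fix n
  interpret C: dg_algebra C by (rule dg_algebra_C)
  have cC: "x \<in> cocycles C n \<longleftrightarrow> x \<in> GW.TH n \<and> CH.dC x = 0" for x
    by (auto simp: cocycles_def GW.TH_T)
  have cA: "a \<in> cocycles A n \<longleftrightarrow> a \<in> homog A n \<and> dA a = 0" for a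
    by (auto simp: cocycles_def dA_eq homog_UA)
  have pc: "proj x \<in> cocycles A n" if "x \<in> cocycles C n" for x
  proof -
    have x: "x \<in> GW.TH n" "CH.dC x = 0" using that by (simp_all add: cC)
    show ?thesis using proj_dC[OF GW.TH_T[OF x(1)]] proj_TH[OF x(1)] x(2) by (simp add: cA)
  qed
  show "bij_betw (\<lambda>X. cohomologous A n `` (proj ` X)) (cocycles C n // cohomologous C n)
      (cocycles A n // cohomologous A n)"
  proof (rule bij_betw_quotient[OF C.equiv_cohomologous equiv_cohomologous pc])
    fix x x' assume x: "x \<in> cocycles C n" "x' \<in> cocycles C n"
    show "(x, x') \<in> cohomologous C n \<longleftrightarrow> (proj x, proj x') \<in> cohomologous A n"
    proof
      assume "(x, x') \<in> cohomologous C n"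
      then obtain w where w: "w \<in> GW.TH (n - 1)" "x - x' = CH.dC w"
        by (auto simp: cohomologous_def GW.TH_T)
      have "proj x - proj x' = diff A (proj w)"
        using proj_dC[OF GW.TH_T[OF w(1)]] GW.TH_T[OF w(1)] by (simp add: dA_eq flip: w(2))
      then show "(proj x, proj x') \<in> cohomologous A n"
        using pc x proj_TH[OF w(1)] by (auto simp: cohomologous_def)
    next
      assume "(proj x, proj x') \<in> cohomologous A n"
      then obtain a where a: "a \<in> homog A (n - 1)" "proj x - proj x' = dA a"
        by (auto simp: cohomologous_def dA_eq homog_UA)
      have z: "x - x' \<in> GW.TH n" "CH.dC (x - x') = 0" "proj (x - x') = dA a"
        using x a(2) by (simp_all add: cC)
      obtain N where "x - x' \<in> CH.Fil N" using CH.Fil_exists[OF GW.TH_T[OF z(1)]] by blast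
      then have "x - x' \<in> CH.Fil (Suc N)" by (rule CH.Fil_mono[rotated]) simp
      from exact_if_proj_exact[OF this z a(1)] obtain w where "w \<in> GW.TH (n - 1)" "CH.dC w = x - x'" by blast
      then show "(x, x') \<in> cohomologous C n"
        using x by (auto simp: cohomologous_def GW.TH_T intro!: image_eqI[of _ _ w])
    qed
  next
    fix a assume a: "a \<in> cocycles A n"
    then have h: "a \<in> homog A n" "dA a = 0" by (simp_all add: cA)
    have "incl_C a \<in> cocycles C n"
      using dC_incl_C[OF homog_UA[OF h(1)]] by (simp add: cC incl_C_TH[OF h(1)] h(2) lin_0[OF incl_C_lin])
    moreover have "proj (incl_C a) = a" by (rule proj_incl_C[OF homog_UA[OF h(1)]])
    moreover have "(a, a) \<in> cohomologous A n"
      using equiv_cohomologous[of n] a by (simp add: equiv_def refl_on_def)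
    ultimately show "\<exists>x\<in>cocycles C n. (proj x, a) \<in> cohomologous A n" by (intro bexI[of _ "incl_C a"]) simp_all
  qed
qed

end

theorem propositionB2:
  fixes A :: "('k::field, 'a::ab_group_add) dga"
  assumes "dg_algebra A"
  shows "\<exists>p. dg_algebra_hom (CobarBar A) A p \<and> quasi_isomorphism (CobarBar A) A p"
proof -
  interpret cobar_bar_algebra A by (rule cobar_bar_algebra.intro[OF assms])
  show ?thesis using dg_algebra_hom_proj quasi_isomorphism_proj by blast
qed

end
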